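(* Assume (A1) $n_i/n\to\kappa_i>0$ as $n\to\infty$ for every $i\in\{1,\dots,k\}$, and (A2) for every $i\in\{1,\dots,k\}$ and $\ell\in\{1,\dots,d\}$ the marginal distribution function $F_{i\ell}$ is continuously differentiable at $q_{i\ell}$ with positive derivative $f_{i\ell}(q_{i\ell})>0$. Let $\hat{\mathbf\Sigma}$ be a consistent estimator of $\mathbf\Sigma$ and let $\hat{\mathbf\Sigma}^*$ denote its consistent bootstrap version. Let $$S_n^*(\mathbf T)=n\left[\mathbf T(\hat{\mathbf q}^*-\hat{\mathbf q})\right]'E(\mathbf T,\hat{\mathbf\Sigma}^* )\,\mathbf T(\hat{\mathbf q}^*-\hat{\mathbf q}),$$ where $E$ is either the ATS choice or the MATS choice (see context). Then $S_n^*(\mathbf T)$ always converges, conditionally given the data $\mathbf X$, in distribution to a real-valued random variable $B^*$; i.e., under $\mathcal H_0:\mathbf T\mathbf q=\mathbf 0_{dk}$ as well as under $\mathcal H_1:\mathbf T\mathbf q\ne\mathbf 0_{dk}$, $$\sup_{x\in\mathbb R}\left|P\left(S_n^*(\mathbf T)\le x\mid\mathbf X\right)-P(B^*\le x)\right|\stackrel{P}{\longrightarrow}0\quad(n\to\infty).$$ The distribution of $B^*$ depends on the underlying setting and can be expressed by $B^*=\sum_{i=1}^{dk}\lambda_i^*B_i$, where $\lambda_i^*\ge0$ and the $B_i$ are independent and $\chi_1^2$-distributed. Under $\mathcal H_0$, the distribution of $B^*$ coincides with the limit null distribution of $S_n(\mathbf T)=n(\mathbf T\hat{\mathbf q})'E(\mathbf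 T,\hat{\mathbf\Sigma})\mathbf T\hat{\mathbf q}$, that is, $B\stackrel{d}{=}B^*$, where $B=\sum_{i=1}^{dk}\lambda_iB_i$ is the limit in distribution of $S_n(\mathbf T)$ under $\mathcal H_0$ and $\lambda_1,\dots,\lambda_{dk}\ge0$ are the eigenvalues of $E(\mathbf T,\mathbf\Sigma)\mathbf T\mathbf\Sigma\mathbf T$.
   Context: Setting. Fix integers $k,d\ge1$ and $p\in(0,1)$. For each group $i\in\{1,\dots,k\}$ let $\mathbf X_{ij}=(X_{ij1},\dots,X_{ijd})'$, $j=1,\dots,n_i$, be $\mathbb R^d$-valued with joint distribution $\mathbb P_i$; all observation vectors are mutually independent. Put $n=\sum_{i=1}^kn_i$; all limits are as $n\to\infty$. $F_{i\ell}$ denotes the distribution function of $X_{i1\ell}$ (with existing density $f_{i\ell}$) and $F_{i\ell m}$ the joint distribution function of $(X_{i1\ell},X_{i1m})$. $\mathbf X$ denotes all the data. Quantiles. $q_{i\ell}=F_{i\ell}^{-1}(p)=\inf\{t\in\mathbb R: F_{i\ell}(t)\ge p\}$, $\mathbf q_i=(q_{i1},\dots,q_{id})'$, $\mathbf q=(\mathbf q_1',\dots,\mathbf q_k')'\in\mathbb R^{dk}$. Empirical versions: $\hat F_{i\ell}(t)=n_i^{-1}\sum_{j=1}^{n_i}\mathbf 1\{X_{ij\ell}\le t\}$, $\hat q_{i\ell}=\inf\{t:\hat F_{i\ell}(t)\ge p\}$, and $\hat{\mathbf q}$ is the vector of all $\hat q_{i\ell}$ stacked like $\mathbf q$. Group-wise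 bootstrap. For each group $i$, independently across groups, given the data, $\mathbf X_{i1}^*,\dots,\mathbf X_{in_i}^*$ are drawn independently with replacement from $\{\mathbf X_{i1},\dots,\mathbf X_{in_i}\}$. A superscript $^*$ means that a statistic is computed from the bootstrap sample instead of the original one; e.g. $\hat{\mathbf q}^*$ is the vector of empirical $p$-quantiles of the bootstrap sample. Consistency of $\hat{\mathbf\Sigma}$ means $\hat{\mathbf\Sigma}\to\mathbf\Sigma$ in probability. Consistency of $\hat{\mathbf\Sigma}^*$ means convergence to $\mathbf\Sigma$ given the data in probability: for every $\varepsilon>0$, $P(\|\hat{\mathbf\Sigma}^*-\mathbf\Sigma\|>\varepsilon\mid\mathbf X)\to0$ in probability. Matrix $\mathbf T$. Let $\mathbf H\in\mathbb R^{r\times dk}$ be a contrast matrix ($\mathbf H\mathbf 1_{dk}=\mathbf 0_r$) and $\mathbf T=\mathbf H'(\mathbf H\mathbf H')^+\mathbf H\in\mathbb R^{dk\times dk}$, where $^+$ denotes the Moore–Penrose inverse; $\mathbf T$ is symmetric and idempotent. Covariance matrix. $\mathbf\Sigma=\bigoplus_{i=1}^k\mathbf\Sigma^{(i)}$ (block diagonal) with $\mathbf\Sigma^{(i)}_{\ell\ell}=\kappa_i^{-1}f_{i\ell}(q_{i\ell})^{-2}(p-p^2)$ and $\mathbf\Sigma^{(i)}_{\ell m}=\kappa_i^{-1}\{f_{i\ell}(q_{i\ell})f_{im}(q_{im})\}^{-1}\left[F_{i\ell m}(q_{i\ell},q_{im})-p^2\right]$ for $\ell\ne m$. Choices of $E$.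 For a symmetric $dk\times dk$ matrix $\mathbf A$: ATS (ANOVA-type statistic): $E(\mathbf T,\mathbf A)=\mathrm{tr}(\mathbf T\mathbf A\mathbf T)^{-1}\mathbf I_{dk}$; MATS (modified ANOVA-type statistic): $E(\mathbf T,\mathbf A)=(\mathbf T\mathbf A_0\mathbf T)^+$, where $\mathbf A_0$ is the diagonal matrix containing the diagonal elements of $\mathbf A$.
   Formalization: ATS also assumes tr(TΣT) ≠ 0 (else E(T,Σ) is undefined); sup convergence is claimed only if T = 0 or TΣT ≠ 0, convergence in distribution always. With TΣT = 0 it can fail: X_2 = g(X_1), g strictly convex of slope 1 at the quantile, H = (1,-1), MATS. *)

theory Defs
  imports "HOL-Probability.Probability"
begin

text \<open>
  Groups are indexed by a finite type \<open>'g\<close> and components by a finite type \<open>'c\<close>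
  (so k = CARD('g) and d = CARD('c)); stacked vectors of length dk are indexed by
  \<open>'g \<times> 'c\<close>. Observations within a group are numbered from 0.
\<close>

section \<open>Samples and quantiles\<close>

type_synonym ('g, 'c) sample = "'g \<times> nat \<Rightarrow> real ^ 'c"

definition obs_index :: "('g \<Rightarrow> nat) \<Rightarrow> ('g \<times> nat) set" where
  "obs_index n = {(i, j). j < n i}"

definition total_size :: "('g::finite \<Rightarrow> nat) \<Rightarrow> nat" where
  "total_size n = (\<Sum>i\<in>UNIV. n i)"

definition data ::
  "('g \<Rightarrow> nat) \<Rightarrow> ('g \<Rightarrow> nat \<Rightarrow> 'a \<Rightarrow> real ^ ('c::finite)) \<Rightarrow> 'a \<Rightarrow> ('g, 'c) sample" where
  "data n X \<omega> = restrict (\<lambda>(i, j). X i j \<omega>) (obs_index n)"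

definition quantile :: "real \<Rightarrow> (real \<Rightarrow> real) \<Rightarrow> real" where
  "quantile p F = Inf {t. p \<le> F t}"

definition marginal_cdf :: "(real ^ ('c::finite)) measure \<Rightarrow> 'c \<Rightarrow> real \<Rightarrow> real" where
  "marginal_cdf P l = cdf (distr P borel (\<lambda>x. x $ l))"

definition joint_cdf :: "(real ^ ('c::finite)) measure \<Rightarrow> 'c \<Rightarrow> 'c \<Rightarrow> real \<Rightarrow> real \<Rightarrow> real" where
  "joint_cdf P l m s t = measure P {x \<in> space P. x $ l \<le> s \<and> x $ m \<le> t}"

definition ecdf :: "('g \<Rightarrow> nat) \<Rightarrow> ('g, 'c::finite) sample \<Rightarrow> 'g \<Rightarrow> 'c \<Rightarrow> real \<Rightarrow> real" where
  "ecdf n s i l t = real (card {j. j < n i \<and> s (i, j) $ l \<le> t}) / real (n i)"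

definition quantiles ::
  "real \<Rightarrow> ('g::finite \<Rightarrow> (real ^ ('c::finite)) measure) \<Rightarrow> real ^ ('g \<times> 'c)" where
  "quantiles p P = (\<chi> a. quantile p (marginal_cdf (P (fst a)) (snd a)))"

definition emp_quantiles ::
  "real \<Rightarrow> ('g::finite \<Rightarrow> nat) \<Rightarrow> ('g, 'c::finite) sample \<Rightarrow> real ^ ('g \<times> 'c)" where
  "emp_quantiles p n s = (\<chi> a. quantile p (ecdf n s (fst a) (snd a)))"

section \<open>Group-wise bootstrap\<close>

text \<open>
  The conditional law of the bootstrap sample given that the data equal \<open>s\<close>: all entries are
  independent, and each entry of group i is uniformly drawn (by its number, so that tied
  observations keep their multiplicity) from the observations of group i. Probabilities under
  \<open>boot_pmf n (data n X \<omega>)\<close>, as functions of \<open>\<omega>\<close>, are the conditional probabilities given the data.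
\<close>

definition boot_pmf :: "('g \<Rightarrow> nat) \<Rightarrow> ('g, 'c::finite) sample \<Rightarrow> ('g, 'c) sample pmf" where
  "boot_pmf n s =
     Pi_pmf (obs_index n) undefined (\<lambda>(i, j). map_pmf (\<lambda>j'. s (i, j')) (pmf_of_set {..<n i}))"

definition boot_prob ::
  "('g \<Rightarrow> nat) \<Rightarrow> ('g, 'c::finite) sample \<Rightarrow> (('g, 'c) sample \<Rightarrow> bool) \<Rightarrow> real" where
  "boot_prob n s Q = measure_pmf.prob (boot_pmf n s) {s'. Q s'}"

section \<open>Modes of convergence\<close>

definition conv_in_prob ::
  "'a measure \<Rightarrow> (nat \<Rightarrow> 'a \<Rightarrow> 'b::metric_space) \<Rightarrow> 'b \<Rightarrow> bool" where
  "conv_in_prob M Y c \<longleftrightarrow>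
     (\<forall>\<nu>. Y \<nu> \<in> borel_measurable M) \<and>
     (\<forall>\<epsilon>>0. (\<lambda>\<nu>. measure M {\<omega> \<in> space M. dist (Y \<nu> \<omega>) c > \<epsilon>}) \<longlonglongrightarrow> 0)"

text \<open>Convergence of bootstrap statistics to a constant, given the data, in probability.\<close>

definition boot_consistent ::
  "'a measure \<Rightarrow> (nat \<Rightarrow> 'g \<Rightarrow> nat) \<Rightarrow> ('g \<Rightarrow> nat \<Rightarrow> 'a \<Rightarrow> real ^ ('c::finite)) \<Rightarrow>
   (nat \<Rightarrow> ('g, 'c) sample \<Rightarrow> 'b::real_normed_vector) \<Rightarrow> 'b \<Rightarrow> bool" where
  "boot_consistent M N X V c \<longleftrightarrow>
     (\<forall>\<epsilon>>0. conv_in_prob M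
        (\<lambda>\<nu> \<omega>. boot_prob (N \<nu>) (data (N \<nu>) X \<omega>) (\<lambda>s'. norm (V \<nu> s' - c) > \<epsilon>)) 0)"

section \<open>Matrices\<close>

definition pinv :: "real ^ ('n::finite) ^ ('m::finite) \<Rightarrow> real ^ 'm ^ 'n" where
  "pinv A = (THE G. A ** G ** A = A \<and> G ** A ** G = G \<and>
                    transpose (A ** G) = A ** G \<and> transpose (G ** A) = G ** A)"

definition contrast_proj :: "real ^ ('n::finite) ^ ('r::finite) \<Rightarrow> real ^ 'n ^ 'n" where
  "contrast_proj H = transpose H ** pinv (H ** transpose H) ** H"

definition diag_part :: "real ^ ('n::finite) ^ 'n \<Rightarrow> real ^ 'n ^ 'n" where
  "diag_part A = (\<chi> a b. if a = b then A $ a $ b else 0)"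

text \<open>If the trace vanishes, \<open>ATS_E\<close> is the zero matrix, since \<open>inverse 0 = 0\<close>.\<close>

definition ATS_E :: "real ^ ('n::finite) ^ 'n \<Rightarrow> real ^ 'n ^ 'n \<Rightarrow> real ^ 'n ^ 'n" where
  "ATS_E T A = inverse (trace (T ** A ** T)) *\<^sub>R mat 1"

definition MATS_E :: "real ^ ('n::finite) ^ 'n \<Rightarrow> real ^ 'n ^ 'n \<Rightarrow> real ^ 'n ^ 'n" where
  "MATS_E T A = pinv (T ** diag_part A ** T)"

text \<open>
  The eigenvalues of \<open>A\<close>, listed with algebraic multiplicity, are the roots of its
  characteristic polynomial.
\<close>

definition eigenvalue_family :: "real ^ ('n::finite) ^ 'n \<Rightarrow> ('n \<Rightarrow> real) \<Rightarrow> bool" where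
  "eigenvalue_family A lam \<longleftrightarrow> (\<forall>x. det (mat x - A) = (\<Prod>a\<in>UNIV. x - lam a))"

definition quantile_cov ::
  "real \<Rightarrow> ('g::finite \<Rightarrow> real) \<Rightarrow> ('g \<Rightarrow> (real ^ ('c::finite)) measure) \<Rightarrow> ('g \<Rightarrow> 'c \<Rightarrow> real \<Rightarrow> real) \<Rightarrow>
   real ^ ('g \<times> 'c) ^ ('g \<times> 'c)" where
  "quantile_cov p \<kappa> P f = (\<chi> a b.
     let i = fst a; l = snd a; m = snd b; q = quantiles p P in
     if fst b \<noteq> i then 0
     else if l = m then inverse (\<kappa> i) * inverse ((f i l (q $ (i, l)))\<^sup>2) * (p - p\<^sup>2)
     else inverse (\<kappa> i) * inverse (f i l (q $ (i, l)) * f i m (q $ (i, m))) *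
          (joint_cdf (P i) l m (q $ (i, l)) (q $ (i, m)) - p\<^sup>2))"

section \<open>Statistics and limit laws\<close>

definition quad_stat ::
  "(real ^ ('g::finite \<times> 'c::finite) ^ ('g \<times> 'c) \<Rightarrow> real ^ ('g \<times> 'c) ^ ('g \<times> 'c) \<Rightarrow>
    real ^ ('g \<times> 'c) ^ ('g \<times> 'c)) \<Rightarrow>
   ('g \<Rightarrow> nat) \<Rightarrow> real ^ ('g \<times> 'c) ^ ('g \<times> 'c) \<Rightarrow>
   real ^ ('g \<times> 'c) ^ ('g \<times> 'c) \<Rightarrow> real ^ ('g \<times> 'c) \<Rightarrow> real" where
  "quad_stat E n T A v = real (total_size n) * ((T *v v) \<bullet> (E T A *v (T *v v)))"

definition chi2_1 :: "real measure" where
  "chi2_1 = distr std_normal_distribution borel (\<lambda>x. x\<^sup>2)"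

text \<open>The law of \<open>\<Sum>a. lam a * B a\<close> for independent chi-square variables \<open>B a\<close> with one
  degree of freedom.\<close>

definition chi2_mixture :: "('n::finite \<Rightarrow> real) \<Rightarrow> real measure" where
  "chi2_mixture lam =
     distr (Pi\<^sub>M UNIV (\<lambda>_. chi2_1)) borel (\<lambda>b. \<Sum>a\<in>UNIV. lam a * b a)"

end

(*
  By Ghosh's argument, sqrt n (q^ - q) agrees up to o_P(1) with the linear statistic
  sqrt n (p - F^(q)) / f(q), whose increments in the argument of F^ are controlled by second
  moments. Applying this to the sample and to the bootstrap sample, both around the true q, and
  subtracting, sqrt n (q^* - q^) agrees with sqrt n (F^(q) - F^*(q)) / f(q), conditionally a normed
  sum of independent bounded vectors whose covariance converges to Sigma in probability. Under
  the null hypothesis T q = 0 the original statistic is centred at q as well.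

  The limit of a quadratic form of such a sum Y is found without a multivariate central limit
  theorem. Write the positive semidefinite weight as T E T = R'R with R Sigma R' = diag(lambda).
  Then exp(-k |R Y|^2) is the average of exp(i sqrt(2k) z'R Y) over a standard Gaussian z, so that
  a quantitative estimate of the characteristic function of Y yields
  E exp(-k |R Y|^2) -> E exp(-k sum_a lambda_a z_a^2). By the Weierstrass theorem for functions
  of exp(-u), these limits for natural k determine the limits of the distribution functions.
  All bounds are explicit in the covariance and hence apply to the random conditional laws as well.
*)
theory Submission
  imports Defs
begin

section \<open>Linear algebra: spectral theorem, pseudoinverse and weight matrices\<close>

subsection \<open>Symmetric matrices\<close>

text \<open>Three obstacles shape the argument. The conditional law given the data is itself random,
  so a theorem about one fixed sequence of laws does not apply to it. The limit theorems are
  therefore stated along an arbitrary filter, with explicit error bounds instead of subsequences,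
  and conditional convergence in probability becomes ordinary convergence along a filter on stages
  and outcomes. The empirical distribution function has no derivative at the empirical quantile;
  this is why the bootstrap quantiles are expanded around the true \<open>q\<close>, where only the
  derivative of \<open>F\<close> enters. The Moore-Penrose inverse jumps where the rank changes: the
  positive diagonal of the limit covariance keeps the rank of the MATS weight constant near the
  limit, and elsewhere Borel measurability is enough. If all weights \<open>lam\<close> vanish, the
  limit law is the point mass at 0 and pointwise convergence no longer gives uniform convergence;
  hence the condition on \<open>T ** \<Sigma> ** T\<close> in the conclusion.\<close>

definition diagm :: "('n::finite \<Rightarrow> real) \<Rightarrow> real ^ 'n ^ 'n" where
  "diagm lam = (\<chi> i j. if i = j then lam i else 0)"

lemma diagm_mult [simp]: "diagm a ** diagm b = diagm (\<lambda>i. a i * b i)"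
proof -
  have "(\<Sum>k\<in>UNIV. (if i = k then a i else 0) * (if k = j then b k else 0)) = (if i = j then a i * b i else 0)" for i j
  proof -
    have "(\<Sum>k\<in>UNIV. (if i = k then a i else 0) * (if k = j then b k else 0))
        = (\<Sum>k\<in>UNIV. if i = k then (if k = j then a k * b k else 0) else 0)"
      by (intro sum.cong) auto
    then show ?thesis by (simp add: sum.delta')
  qed
  then show ?thesis
    by (simp add: diagm_def matrix_matrix_mult_def vec_eq_iff)
qed

lemma transpose_diagm [simp]: "transpose (diagm a) = diagm a"
  by (auto simp: diagm_def transpose_def vec_eq_iff)

lemma diagm_vec: "(diagm a *v x) $ i = a i * x $ i"
proof -
  have "(\<Sum>j\<in>UNIV. (if i = j then a i else 0) * x $ j) = (\<Sum>j\<in>UNIV. if i = j then a j * x $ j else 0)"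
    by (intro sum.cong) auto
  then show ?thesis by (simp add: diagm_def matrix_vector_mult_def)
qed

lemma mat_vec: "mat c *v x = c *\<^sub>R (x :: real ^ 'n::finite)"
proof -
  have "mat c = diagm (\<lambda>_::'n. c)" by (simp add: mat_def diagm_def)
  then have "mat c *v x = diagm (\<lambda>_::'n. c) *v x" by simp
  then show ?thesis unfolding vec_eq_iff diagm_vec by simp
qed

lemma symmetric_dot:
  assumes "transpose W = (W :: real ^ 'n ^ 'n::finite)"
  shows "x \<bullet> (W *v y) = (W *v x) \<bullet> y"
  by (metis assms dot_lmul_matrix transpose_matrix_vector)

text \<open>A maximizer v of the Rayleigh quotient on the unit sphere of \<open>V\<close> works.
  With c the maximum, \<open>B\<close> = c I - \<open>W\<close> is nonnegative on \<open>V\<close>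
  and vanishes as a quadratic form at v; moving v slightly along \<open>B v\<close> then forces
  \<open>B v = 0\<close>.\<close>

lemma symmetric_eigenvector:
  fixes W :: "real ^ 'n::finite ^ 'n"
  assumes W: "transpose W = W" and V: "subspace V" and inv: "\<And>v. v \<in> V \<Longrightarrow> W *v v \<in> V"
    and ne: "u \<in> V" "u \<noteq> 0"
  shows "\<exists>v\<in>V. norm v = 1 \<and> (\<exists>c. W *v v = c *\<^sub>R v)"
proof -
  let ?S = "V \<inter> sphere 0 1"
  have "compact ?S"
    using V closed_subspace by (metis Int_commute compact_Int_closed compact_sphere)
  moreover have "(1 / norm u) *\<^sub>R u \<in> ?S"
    using ne V by (simp add: subspace_scale)
  moreover have "continuous_on ?S (\<lambda>v. v \<bullet> (W *v v))"
    by (intro continuous_intros matrix_vector_mult_linear_continuous_on)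
  ultimately obtain v where v: "v \<in> ?S" and vmax: "\<And>w. w \<in> ?S \<Longrightarrow> w \<bullet> (W *v w) \<le> v \<bullet> (W *v v)"
    using continuous_attains_sup[of ?S "\<lambda>v. v \<bullet> (W *v v)"] by blast
  define c where "c = v \<bullet> (W *v v)"
  have nv: "norm v = 1" "v \<in> V" using v by auto
  have le: "w \<bullet> (W *v w) \<le> c * (w \<bullet> w)" if "w \<in> V" for w
  proof (cases "w = 0")
    case False
    let ?w = "(1 / norm w) *\<^sub>R w"
    have "?w \<in> ?S" using that False V by (simp add: subspace_scale)
    then have "?w \<bullet> (W *v ?w) \<le> c" using vmax c_def by blast
    then have "(w \<bullet> (W *v w)) / (norm w)\<^sup>2 \<le> c"
      by (simp add: matrix_vector_mult_scaleR power2_eq_square)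
    then show ?thesis using False
      by (simp add: divide_simps dot_square_norm power2_eq_square)
  qed simp
  define B where "B w = c *\<^sub>R w - W *v w" for w
  have Blin: "B (x + t *\<^sub>R y) = B x + t *\<^sub>R B y" for x y t
    by (simp add: B_def algebra_simps matrix_vector_mult_scaleR matrix_vector_right_distrib)
  have Bsym: "x \<bullet> B y = y \<bullet> B x" for x y
    using symmetric_dot[OF W, of x y] by (simp add: B_def inner_diff_right inner_commute)
  have Bpos: "0 \<le> w \<bullet> B w" if "w \<in> V" for w
    using le[OF that] by (simp add: B_def inner_diff_right)
  have BV: "B w \<in> V" if "w \<in> V" for w
    using that V inv by (simp add: B_def subspace_diff subspace_scale)
  have v0: "v \<bullet> B v = 0"
    using nv by (simp add: B_def inner_diff_right c_def dot_square_norm)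
  define a where "a = B v \<bullet> B v"
  define b where "b = B v \<bullet> B (B v)"
  have b0: "b \<ge> 0" using Bpos BV nv b_def by simp
  \<comment> \<open>The minimizer of 2 t a + t^2 b would be - a / b; the added 1 avoids a zero
    denominator and still makes the expression equal to - t^2 (b + 2).\<close>
  define t where "t = - a / (b + 1)"
  have "v + t *\<^sub>R B v \<in> V" using V BV nv by (simp add: subspace_add subspace_scale)
  from Bpos[OF this] have "0 \<le> v \<bullet> B v + t * (B v \<bullet> B v) + t * (v \<bullet> B (B v)) + t * (t * (B v \<bullet> B (B v)))"
    unfolding Blin inner_add_left inner_add_right inner_scaleR_left inner_scaleR_right
    by (simp add: distrib_left)
  then have "0 \<le> 2 * (t * a) + t * (t * b)"
    using v0 Bsym[of v "B v"] by (simp add: a_def b_def)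
  moreover have a: "a = - t * (b + 1)" using b0 by (simp add: t_def)
  ultimately have "t\<^sup>2 * (b + 2) \<le> 0"
    unfolding a by (simp add: algebra_simps power2_eq_square)
  then have "t = 0" using b0 by (simp add: mult_le_0_iff)
  then have "a = 0" using a by simp
  then have "B v = 0" by (simp add: a_def)
  then show ?thesis using nv B_def by (metis eq_iff_diff_eq_0)
qed

text \<open>An orthonormal family of eigenvectors that is still too small can be enlarged, since its
  orthogonal complement is nonzero and invariant under \<open>W\<close>.\<close>

theorem symmetric_diagonalization:
  fixes W :: "real ^ 'n::finite ^ 'n"
  assumes W: "transpose W = W"
  obtains Q lam where "orthogonal_matrix Q" "W = transpose Q ** diagm lam ** Q"
proof -
  have "\<exists>B. finite B \<and> card B = k \<and> pairwise orthogonal B \<and>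
      (\<forall>b\<in>B. norm b = 1 \<and> (\<exists>c. W *v b = c *\<^sub>R b))" if "k \<le> CARD('n)" for k
    using that
  proof (induction k)
    case 0 then show ?case by (intro exI[of _ "{}"]) auto
  next
    case (Suc k)
    then obtain B where B: "finite B" "card B = k" "pairwise orthogonal B"
      "\<And>b. b \<in> B \<Longrightarrow> norm b = 1 \<and> (\<exists>c. W *v b = c *\<^sub>R b)" by auto
    let ?V = "{u. \<forall>b\<in>B. orthogonal b u}"
    have V: "subspace ?V" by (auto simp: subspace_def orthogonal_def inner_add_right)
    have inv: "W *v u \<in> ?V" if "u \<in> ?V" for u
    proof -
      have "b \<bullet> (W *v u) = 0" if b: "b \<in> B" for b
      proof -
        obtain c where "W *v b = c *\<^sub>R b" using B(4) b by blast
        then show ?thesis using \<open>u \<in> ?V\<close> b by (simp add: symmetric_dot[OF W] orthogonal_def)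
      qed
      then show ?thesis by (simp add: orthogonal_def)
    qed
    have "dim B < DIM(real^'n)"
      using dim_le_card'[OF B(1)] B(2) Suc.prems by simp
    then obtain u where u: "u \<noteq> 0" "\<And>y. y \<in> span B \<Longrightarrow> orthogonal u y"
      using orthogonal_to_subspace_exists by blast
    have "u \<in> ?V" using u(2) span_base orthogonal_commute by blast
    then obtain v where v: "v \<in> ?V" "norm v = 1" "\<exists>c. W *v v = c *\<^sub>R v"
      using symmetric_eigenvector[OF W V inv] u(1) by blast
    have "v \<notin> B" using v by (auto simp: orthogonal_def)
    then show ?case using B v
      by (intro exI[of _ "insert v B"]) (auto simp: pairwise_insert orthogonal_commute)
  qed
  from this[of "CARD('n)"] obtain B where B: "finite B" "card B = CARD('n)" "pairwise orthogonal B"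
      "\<And>b. b \<in> B \<Longrightarrow> norm b = 1 \<and> (\<exists>c. W *v b = c *\<^sub>R b)" by blast
  obtain h where h: "bij_betw h (UNIV::'n set) B"
    using B(1,2) finite_same_card_bij[of "UNIV :: 'n set" B] by auto
  have hB: "h i \<in> B" for i using h bij_betwE by blast
  have "\<forall>i. \<exists>c. W *v h i = c *\<^sub>R h i" using B(4) hB by blast
  then obtain lam where lam: "\<And>i. W *v h i = lam i *\<^sub>R h i" unfolding choice_iff by blast
  have orth: "h i \<bullet> h j = (if i = j then 1 else 0)" for i j
  proof (cases "i = j")
    case True then show ?thesis using B(4)[OF hB] by (simp add: dot_square_norm)
  next
    case False
    then have "h i \<noteq> h j" using h by (auto simp: bij_betw_def inj_on_def)
    then show ?thesis using B(3) hB False by (auto simp: pairwise_def orthogonal_def)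
  qed
  define Q where "Q = (\<chi> i. h i)"
  have QQ: "Q ** transpose Q = mat 1"
    by (simp add: Q_def matrix_matrix_mult_def transpose_def mat_def vec_eq_iff orth[unfolded inner_vec_def, simplified])
  then have o: "orthogonal_matrix Q"
    by (simp add: orthogonal_matrix_def matrix_left_right_inverse)
  then have Q2: "transpose Q ** Q = mat 1" by (simp add: orthogonal_matrix_def)
  have "Q ** W = diagm lam ** Q"
  proof -
    have "(W *v h i) $ j = (\<Sum>k\<in>UNIV. h i $ k * W $ k $ j)" for i j
      using W by (auto simp: matrix_vector_mult_def transpose_def vec_eq_iff intro!: sum.cong)
    moreover have "(W *v h i) $ j = lam i * h i $ j" for i j using lam by simp
    moreover have "(\<Sum>k\<in>UNIV. (if i = k then lam i else 0) * h k $ j) = lam i * h i $ j" for i j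
    proof -
      have "(\<Sum>k\<in>UNIV. (if i = k then lam i else 0) * h k $ j) = (\<Sum>k\<in>UNIV. if i = k then lam k * h k $ j else 0)"
        by (intro sum.cong) auto
      then show ?thesis by simp
    qed
    ultimately show ?thesis
      by (simp add: Q_def matrix_matrix_mult_def diagm_def vec_eq_iff)
  qed
  then have "transpose Q ** diagm lam ** Q = W"
    by (metis Q2 matrix_mul_assoc matrix_mul_lid)
  then show ?thesis using that o by metis
qed

lemma orthogonal_matrix_cancel:
  assumes "orthogonal_matrix (Q :: real^'n::finite^'n)"
  shows "Q ** (transpose Q ** X) = X" "transpose Q ** (Q ** X) = X"
  using assms by (metis matrix_mul_assoc matrix_mul_lid orthogonal_matrix_def)+

lemma conj_diagm_mult:
  assumes "orthogonal_matrix (Q :: real^'n::finite^'n)"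
  shows "(transpose Q ** diagm a ** Q) ** (transpose Q ** diagm b ** Q)
    = transpose Q ** diagm (\<lambda>i. a i * b i) ** Q"
proof -
  have "(transpose Q ** diagm a ** Q) ** (transpose Q ** diagm b ** Q)
      = transpose Q ** (diagm a ** (Q ** (transpose Q ** (diagm b ** Q))))"
    by (simp only: matrix_mul_assoc)
  also have "\<dots> = transpose Q ** (diagm a ** diagm b) ** Q"
    by (simp only: orthogonal_matrix_cancel[OF assms]) (simp only: matrix_mul_assoc)
  finally show ?thesis by simp
qed

lemma transpose_conj_diagm [simp]:
  "transpose (transpose Q ** diagm a ** Q) = transpose Q ** diagm a ** Q"
  by (simp add: matrix_transpose_mul matrix_mul_assoc)

subsection \<open>Moore--Penrose inverse\<close>

definition penrose :: "real ^ 'n::finite ^ 'm::finite \<Rightarrow> real ^ 'm ^ 'n \<Rightarrow> bool" where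
  "penrose A G \<longleftrightarrow> A ** G ** A = A \<and> G ** A ** G = G \<and>
                    transpose (A ** G) = A ** G \<and> transpose (G ** A) = G ** A"

lemma penrose_unique:
  assumes G: "penrose A G" and K: "penrose A K"
  shows "G = K"
proof -
  \<comment> \<open>Since A = A K A, the matrix A G equals (A K)(A G). Transposing this product of
    symmetric matrices reverses it to (A G)(A K), which is A K. The next equation is the mirror
    image.\<close>
  have a: "A ** G = A ** K"
    by (smt (verit) G K matrix_mul_assoc matrix_transpose_mul penrose_def)
  have b: "G ** A = K ** A"
    by (smt (verit) G K matrix_mul_assoc matrix_transpose_mul penrose_def)
  show ?thesis by (metis G K a b matrix_mul_assoc penrose_def)
qed

lemma pinv_eq: "penrose A G \<Longrightarrow> pinv A = G"
  unfolding pinv_def by (rule the_equality) (auto simp flip: penrose_def intro: penrose_unique)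

text \<open>The convention \<open>inverse 0 = 0\<close> makes the entrywise inverse the
  pseudoinverse of a diagonal matrix, and all four Penrose conditions are invariant under orthogonal
  conjugation.\<close>

lemma penrose_conj_diagm:
  assumes "orthogonal_matrix Q"
  shows "penrose (transpose Q ** diagm a ** Q) (transpose Q ** diagm (\<lambda>i. inverse (a i)) ** Q)"
proof -
  have "(\<lambda>i. a i * inverse (a i) * a i) = a" "(\<lambda>i. inverse (a i) * a i * inverse (a i)) = (\<lambda>i. inverse (a i))"
    by (auto simp: fun_eq_iff field_simps)
  then show ?thesis by (simp add: penrose_def conj_diagm_mult[OF assms])
qed

lemma penrose_pinv:
  fixes A :: "real ^ 'n::finite ^ 'n"
  assumes "transpose A = A"
  shows "penrose A (pinv A)"
  using symmetric_diagonalization[OF assms] penrose_conj_diagm pinv_eq by metis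

lemma transpose_pinv:
  fixes A :: "real ^ 'n::finite ^ 'n"
  assumes "transpose A = A"
  shows "transpose (pinv A) = pinv A"
proof -
  let ?G = "pinv A"
  have G: "A ** ?G ** A = A" "?G ** A ** ?G = ?G" "transpose (A ** ?G) = A ** ?G" "transpose (?G ** A) = ?G ** A"
    using penrose_pinv[OF assms] by (auto simp: penrose_def)
  have t: "transpose ?G ** A = A ** ?G" "A ** transpose ?G = ?G ** A"
    using G(3,4) by (simp_all add: matrix_transpose_mul assms)
  have "A ** transpose ?G ** A = A"
    using arg_cong[OF G(1), of transpose] by (simp add: matrix_transpose_mul assms matrix_mul_assoc)
  moreover have "transpose ?G ** A ** transpose ?G = transpose ?G"
    using arg_cong[OF G(2), of transpose] by (simp add: matrix_transpose_mul assms matrix_mul_assoc)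
  ultimately have "penrose A (transpose ?G)"
    using G(3,4) by (simp add: penrose_def t)
  then show ?thesis using penrose_pinv[OF assms] penrose_unique by blast
qed

lemma contrast_proj_symmetric: "transpose (contrast_proj H) = contrast_proj H"
  by (simp add: contrast_proj_def matrix_transpose_mul transpose_pinv matrix_mul_assoc)

lemma contrast_proj_idem: "contrast_proj H ** contrast_proj H = contrast_proj H"
proof -
  have "penrose (H ** transpose H) (pinv (H ** transpose H))"
    by (intro penrose_pinv) (simp add: matrix_transpose_mul)
  then have "pinv (H ** transpose H) ** (H ** transpose H) ** pinv (H ** transpose H) = pinv (H ** transpose H)"
    by (simp add: penrose_def)
  then show ?thesis unfolding contrast_proj_def by (metis (no_types, lifting) matrix_mul_assoc)
qed

subsection \<open>Characteristic polynomials\<close>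

lemma matrix_diff_ldistrib: "A ** (B - C) = A ** B - A ** (C :: real ^ 'n::finite ^ 'm::finite)"
  by (simp add: matrix_matrix_mult_def vec_eq_iff right_diff_distrib sum_subtractf)

lemma matrix_diff_rdistrib: "(A - B) ** C = A ** C - B ** (C :: real ^ 'n::finite ^ 'm::finite)"
  by (simp add: matrix_matrix_mult_def vec_eq_iff left_diff_distrib sum_subtractf)

lemma matrix_add_rdistrib: "(A + B) ** C = A ** C + B ** (C :: real ^ 'n::finite ^ 'm::finite)"
  by (simp add: matrix_matrix_mult_def vec_eq_iff distrib_right sum.distrib)

lemma matrix_mult_zero [simp]:
  fixes A :: "real ^ 'm::finite ^ 'k::finite"
  shows "A ** (0 :: real ^ 'n::finite ^ 'm) = 0" "(0 :: real ^ 'k ^ 'n) ** A = 0"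
  by (simp_all add: matrix_matrix_mult_def vec_eq_iff)

lemma matrix_scaleR_mult:
  fixes A :: "real ^ 'm::finite ^ 'k::finite" and B :: "real ^ 'n::finite ^ 'm"
  shows "A ** (c *\<^sub>R B) = c *\<^sub>R (A ** B)" "(c *\<^sub>R A) ** B = c *\<^sub>R (A ** B)"
  by (simp_all add: matrix_matrix_mult_def vec_eq_iff sum_distrib_left mult_ac)

lemma tendsto_det [tendsto_intros]:
  fixes A :: "'a \<Rightarrow> real ^ 'n::finite ^ 'n"
  shows "(A \<longlongrightarrow> L) F \<Longrightarrow> ((\<lambda>x. det (A x)) \<longlongrightarrow> det L) F"
  unfolding det_def by (intro tendsto_intros)

lemma tendsto_matrix_mult [tendsto_intros]:
  fixes A :: "'a \<Rightarrow> real ^ 'm::finite ^ 'k::finite" and B :: "'a \<Rightarrow> real ^ 'n::finite ^ 'm"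
  assumes "(A \<longlongrightarrow> L) F" "(B \<longlongrightarrow> K) F"
  shows "((\<lambda>x. A x ** B x) \<longlongrightarrow> L ** K) F"
  unfolding matrix_matrix_mult_def
  by (intro vec_tendstoI) (simp, intro tendsto_intros assms)

lemma tendsto_mat [tendsto_intros]:
  fixes f :: "'a \<Rightarrow> real"
  shows "(f \<longlongrightarrow> c) F \<Longrightarrow> ((\<lambda>x. mat (f x) :: real ^ 'n::finite ^ 'n) \<longlongrightarrow> mat c) F"
  by (intro vec_tendstoI) (simp add: mat_def)

text \<open>For invertible \<open>C\<close> the products C B and B C are similar. A general
  \<open>A\<close> is approached by A + e I, which is invertible for all but finitely many e, and
  both determinants are continuous in e.\<close>

lemma det_mat_minus_mult_commute:
  fixes A B :: "real ^ 'n::finite ^ 'n"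
  shows "det (mat x - A ** B) = det (mat x - B ** A)"
proof -
  have inv: "det (mat x - C ** B) = det (mat x - B ** C)" if Cinv: "invertible C" for C :: "real^'n^'n"
  proof -
    obtain C' where C: "C ** C' = mat 1" "C' ** C = mat 1" using Cinv unfolding invertible_def by blast
    have eq: "mat x - C ** B = C ** (mat x - B ** C) ** C'"
    proof -
      have m: "mat x = x *\<^sub>R (mat 1 :: real^'n^'n)" by (simp add: mat_def vec_eq_iff)
      have "C ** mat x ** C' = mat x"
        unfolding m by (simp add: C matrix_scaleR_mult)
      moreover have "C ** (B ** C) ** C' = C ** B"
        by (simp add: C(1) flip: matrix_mul_assoc)
      ultimately show ?thesis
        by (simp add: matrix_diff_ldistrib matrix_diff_rdistrib)
    qed
    then have "det (mat x - C ** B) = det C * det (mat x - B ** C) * det C'"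
      by (subst eq) (simp only: det_mul)
    moreover have "det C * det C' = 1" using C(1) by (simp flip: det_mul)
    ultimately show ?thesis by (simp add: mult.commute mult.left_commute)
  qed
 let ?D = "\<lambda>e. det (mat x - (A + mat e) ** B) - det (mat x - B ** (A + mat e))"
  \<comment> \<open>det (A + e I) as a polynomial in e, written out by the Leibniz formula so that
    the finiteness of its roots is available.\<close>
  define pol where "pol = (\<Sum>p | p permutes (UNIV :: 'n set). of_int (sign p) *
      (\<Prod>i\<in>UNIV. [:A $ i $ p i, (if i = p i then 1 else 0):]))"
  have "poly [:A $ i $ j, (if i = j then 1 else 0):] e = (A + mat e) $ i $ j" for i j e
    by (simp add: mat_def)
  then have pol: "poly pol e = det (A + mat e)" for e
    unfolding pol_def det_def poly_sum poly_mult poly_prod by simp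
  \<comment> \<open>Beyond the operator norm of \<open>A\<close> the matrix A + e I is injective, so
    \<open>pol\<close> is not the zero polynomial.\<close>
  define e0 where "e0 = onorm ((*v) A) + 1"
  have "v = 0" if "(A + mat e0) *v v = 0" for v
  proof -
    have "A *v v = - (e0 *\<^sub>R v)"
      using that by (simp add: matrix_vector_mult_add_rdistrib add_eq_0_iff2 mat_vec)
    moreover have "norm (A *v v) \<le> onorm ((*v) A) * norm v"
      by (intro onorm matrix_vector_mul_bounded_linear)
    moreover have "onorm ((*v) A) \<ge> 0" by (simp add: matrix_vector_mul_bounded_linear onorm_pos_le)
    ultimately have "e0 * norm v \<le> onorm ((*v) A) * norm v" by (simp add: e0_def)
    then show "v = 0" by (simp add: e0_def distrib_right)
  qed
  then have "invertible (A + mat e0)"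
    using matrix_left_invertible_ker[of "A + mat e0"] invertible_left_inverse by blast
  then have "pol \<noteq> 0" using pol[of e0] by (auto simp: invertible_det_nz)
  then have fin: "finite {e. poly pol e = 0}" by (rule poly_roots_finite)
  have zero: "?D e = 0" if "poly pol e \<noteq> 0" for e
    using inv[of "A + mat e"] that by (simp add: pol invertible_det_nz)
  have lim: "?D \<midarrow>0\<rightarrow> ?D 0"
    by (intro tendsto_intros)
  have "eventually (\<lambda>e. \<not> poly pol e = 0) (at 0)"
    using islimpt_finite[OF fin, of 0] by (simp add: islimpt_iff_eventually)
  then have "eventually (\<lambda>e. ?D e = 0) (at 0)"
    by (rule eventually_mono) (rule zero)
  then have "?D \<midarrow>0\<rightarrow> 0" by (simp add: tendsto_eventually)
  then have "?D 0 = 0" using lim by (rule LIM_unique[rotated])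
  then show ?thesis by simp
qed

section \<open>Positive semidefinite matrices and their factorizations\<close>

lemma inner_transpose: "(transpose Q *v x) \<bullet> y = x \<bullet> (Q *v (y :: real ^ 'n::finite))"
  by (simp add: transpose_matrix_vector dot_lmul_matrix)

definition psd :: "real ^ 'n::finite ^ 'n \<Rightarrow> bool" where
  "psd A \<longleftrightarrow> transpose A = A \<and> (\<forall>v. 0 \<le> v \<bullet> (A *v v))"

lemma psd_transpose_mult: "psd (transpose R ** (R :: real ^ 'n::finite ^ 'm::finite))"
proof -
  have "v \<bullet> ((transpose R ** R) *v v) = (R *v v) \<bullet> (R *v v)" for v
    using inner_transpose[of R "R *v v" v] by (metis inner_commute matrix_vector_mul_assoc)
  then show ?thesis by (simp add: psd_def matrix_transpose_mul)
qed

lemma psd_congruence: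
  fixes A :: "real ^ 'n::finite ^ 'n" and R :: "real ^ 'n ^ 'm::finite"
  assumes "psd A" shows "psd (R ** A ** transpose R)"
proof -
  have "v \<bullet> ((R ** A ** transpose R) *v v) = (transpose R *v v) \<bullet> (A *v (transpose R *v v))" for v
    by (simp only: inner_transpose flip: matrix_vector_mul_assoc)
  then show ?thesis using assms by (simp add: psd_def matrix_transpose_mul matrix_mul_assoc)
qed

lemma psd_diagm_nonneg:
  assumes "psd (diagm lam)" shows "0 \<le> lam i"
proof -
  have "axis i 1 \<bullet> (diagm lam *v axis i 1) = lam i"
    by (simp add: inner_axis' diagm_vec)
  then show ?thesis using assms unfolding psd_def by metis
qed

lemma psd_factorization:
  fixes G :: "real ^ 'n::finite ^ 'n"
  assumes "psd G"
  obtains R :: "real ^ 'n ^ 'n" where "G = transpose R ** R"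
proof -
  obtain Q lam where Q: "orthogonal_matrix Q" "G = transpose Q ** diagm lam ** Q"
    using assms unfolding psd_def by (blast elim: symmetric_diagonalization)
  have "Q ** G ** transpose Q = diagm lam"
    using Q by (simp add: orthogonal_matrix_cancel orthogonal_matrix_def flip: matrix_mul_assoc)
  then have pos: "0 \<le> lam i" for i using psd_congruence[OF assms, of Q] psd_diagm_nonneg by metis
  define R where "R = diagm (\<lambda>i. sqrt (lam i)) ** Q"
  have "transpose R ** R = transpose Q ** (diagm (\<lambda>i. sqrt (lam i)) ** diagm (\<lambda>i. sqrt (lam i))) ** Q"
    by (simp only: R_def matrix_transpose_mul transpose_diagm matrix_mul_assoc)
  also have "\<dots> = G" using pos by (simp add: Q(2))
  finally show ?thesis using that by metis
qed

text \<open>Diagonalizing the covariance along the factor \<open>R\<close> of \<open>G\<close> makes \<open>\<bar>R Y\<bar>\<^sup>2\<close>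
  a weighted sum of squares of independent coordinates for a centred Gaussian \<open>Y\<close>.\<close>

lemma simultaneous_diagonalization:
  fixes G V :: "real ^ 'n::finite ^ 'n"
  assumes G: "psd G" and V: "psd V"
  obtains R lam where "G = transpose R ** R" "R ** V ** transpose R = diagm lam"
    "\<And>i. 0 \<le> lam i" "eigenvalue_family (G ** V) lam"
proof -
  obtain R0 :: "real ^ 'n ^ 'n" where R0: "G = transpose R0 ** R0" using G by (rule psd_factorization)
  let ?W = "R0 ** V ** transpose R0"
  have "transpose ?W = ?W" using psd_congruence[OF V, of R0] unfolding psd_def by blast
  then obtain Q lam where Q: "orthogonal_matrix Q" "?W = transpose Q ** diagm lam ** Q"
    by (rule symmetric_diagonalization)
  define R where "R = Q ** R0"
  have a: "G = transpose R ** R"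
    using Q(1) by (simp add: R_def R0 matrix_transpose_mul orthogonal_matrix_cancel flip: matrix_mul_assoc)
  have "R ** V ** transpose R = Q ** ?W ** transpose Q"
    by (simp add: R_def matrix_transpose_mul matrix_mul_assoc)
  also have "\<dots> = diagm lam"
    using Q(1) unfolding Q(2) by (simp add: orthogonal_matrix_cancel orthogonal_matrix_def flip: matrix_mul_assoc)
  finally have b: "R ** V ** transpose R = diagm lam" .
  then have "psd (diagm lam)" using psd_congruence[OF V, of R] by simp
  then have c: "0 \<le> lam i" for i by (rule psd_diagm_nonneg)
  \<comment> \<open>Moving the factor \<open>transpose R\<close> of \<open>G\<close> to the end
    turns G V into the diagonal matrix without changing the characteristic polynomial.\<close>
  have "det (mat x - G ** V) = (\<Prod>i\<in>UNIV. x - lam i)" for x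
  proof -
    have "det (mat x - G ** V) = det (mat x - (R ** V) ** transpose R)"
      by (subst det_mat_minus_mult_commute) (simp add: a matrix_mul_assoc)
    also have "\<dots> = det (mat x - diagm lam)" by (simp add: b)
    also have "\<dots> = (\<Prod>i\<in>UNIV. (mat x - diagm lam) $ i $ i)"
      by (rule det_diagonal) (simp add: mat_def diagm_def)
    finally show ?thesis by (simp add: mat_def diagm_def)
  qed
  then have "eigenvalue_family (G ** V) lam" by (simp add: eigenvalue_family_def)
  with a b c show ?thesis using that by blast
qed

lemma mult_transpose_eq_0:
  fixes X :: "real ^ 'n::finite ^ 'm::finite"
  assumes "X ** transpose X = 0" shows "X = 0"
proof -
  have "(X ** transpose X) $ i $ i = X $ i \<bullet> X $ i" for i
    by (simp add: matrix_matrix_mult_def transpose_def inner_vec_def)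
  then have "X $ i = 0" for i using assms by (metis inner_eq_zero_iff zero_index)
  then show ?thesis by (simp add: vec_eq_iff)
qed

text \<open>With V = S'S the hypothesis says that R S' times its own transpose vanishes, and the
  diagonal of such a product consists of squared row norms.\<close>

lemma psd_zero_factor:
  fixes R V :: "real ^ 'n::finite ^ 'n"
  assumes V: "psd V" and "R ** V ** transpose R = 0"
  shows "V ** transpose R = 0"
proof -
  obtain S :: "real ^ 'n ^ 'n" where S: "V = transpose S ** S" using V by (rule psd_factorization)
  have "(R ** transpose S) ** transpose (R ** transpose S) = 0"
    using assms(2) unfolding S matrix_transpose_mul transpose_transpose matrix_mul_assoc .
  then have "R ** transpose S = 0" by (rule mult_transpose_eq_0)
  then have "transpose (R ** transpose S) = 0"
    by (simp add: transpose_def vec_eq_iff)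
  then have "S ** transpose R = 0" by (simp add: matrix_transpose_mul)
  then show ?thesis
    by (simp add: S flip: matrix_mul_assoc)
qed

subsection \<open>The weight matrices\<close>

text \<open>Cramer's rule: the entries are quotients of determinants, so continuity at invertible
  matrices can be read off.\<close>

definition minv :: "real ^ 'n::finite ^ 'n \<Rightarrow> real ^ 'n ^ 'n" where
  "minv A = (\<chi> k j. det (\<chi> r c. if c = k then mat 1 $ r $ j else A $ r $ c) / det A)"

lemma minv:
  fixes A :: "real ^ 'n::finite ^ 'n"
  assumes "invertible A" shows "A ** minv A = mat 1" "minv A ** A = mat 1"
proof -
  have d: "det A \<noteq> 0" using assms by (simp add: invertible_det_nz)
  have "(A ** minv A) $ i $ j = mat 1 $ i $ j" for i j
  proof -
    have "A *v (\<chi> k. minv A $ k $ j) = (\<chi> r. mat 1 $ r $ j)"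
      by (subst cramer[OF d]) (simp add: minv_def vec_eq_iff cong: if_cong)
    then have "(A *v (\<chi> k. minv A $ k $ j)) $ i = mat 1 $ i $ j" by simp
    then show ?thesis by (simp add: matrix_vector_mult_def matrix_matrix_mult_def)
  qed
  then show "A ** minv A = mat 1" by (simp add: vec_eq_iff)
  then show "minv A ** A = mat 1" by (simp add: matrix_left_right_inverse)
qed

lemma minv_unique:
  fixes A :: "real ^ 'n::finite ^ 'n"
  assumes "A ** B = mat 1" shows "minv A = B"
proof -
  have "invertible A" using assms invertible_right_inverse by blast
  then show ?thesis using minv[of A] assms by (metis matrix_mul_assoc matrix_mul_lid matrix_mul_rid)
qed

lemma tendsto_minv [tendsto_intros]:
  fixes A :: "'a \<Rightarrow> real ^ 'n::finite ^ 'n"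
  assumes "(A \<longlongrightarrow> L) F" "invertible L"
  shows "((\<lambda>x. minv (A x)) \<longlongrightarrow> minv L) F"
  unfolding minv_def
proof (intro vec_tendstoI, simp, intro tendsto_divide tendsto_det assms(1))
  show "det L \<noteq> 0" using assms(2) by (simp add: invertible_det_nz)
  show "((\<lambda>x. \<chi> r c. if c = i then mat 1 $ r $ j else A x $ r $ c) \<longlongrightarrow>
      (\<chi> r c. if c = i then mat 1 $ r $ j else L $ r $ c)) F" for i j
    by (intro vec_tendstoI) (simp add: tendsto_vec_nth assms(1))
qed

lemma invertible_iff_kernel:
  fixes A :: "real ^ 'n::finite ^ 'n"
  shows "invertible A \<longleftrightarrow> (\<forall>x. A *v x = 0 \<longrightarrow> x = 0)"
  using matrix_left_invertible_ker[of A] invertible_left_inverse by blast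

text \<open>Tikhonov regularization: an eigenvalue lam becomes lam / (lam^2 + \<delta>), which tends
  to 1 / lam, or stays 0 if lam = 0. It exhibits the discontinuous pseudoinverse as a pointwise
  limit of continuous maps, which settles its measurability.\<close>

lemma pinv_symmetric_limit:
  fixes S :: "real ^ 'n::finite ^ 'n"
  assumes "transpose S = S"
  shows "(\<lambda>m. minv (S ** S + mat (inverse (real (Suc m)))) ** S) \<longlonglongrightarrow> pinv S"
proof -
  obtain Q lam where Q: "orthogonal_matrix Q" "S = transpose Q ** diagm lam ** Q"
    using symmetric_diagonalization[OF assms] .
  define \<delta> where "\<delta> m = inverse (real (Suc m))" for m
  have pos: "\<delta> m > 0" for m by (simp add: \<delta>_def)
  have nz: "lam i * lam i + \<delta> m \<noteq> 0" for i m
    using pos[of m] zero_le_square[of "lam i"] by linarith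
  have m: "mat c = transpose Q ** diagm (\<lambda>_. c) ** Q" for c
  proof -
    have "mat c = c *\<^sub>R (transpose Q ** Q)"
      using Q(1) by (simp add: orthogonal_matrix_def mat_def vec_eq_iff)
    also have "\<dots> = transpose Q ** (c *\<^sub>R mat 1) ** Q" by (simp add: matrix_scaleR_mult)
    also have "c *\<^sub>R mat 1 = diagm (\<lambda>_. c)" by (simp add: mat_def diagm_def vec_eq_iff)
    finally show ?thesis .
  qed
  have add: "transpose Q ** diagm a ** Q + transpose Q ** diagm b ** Q = transpose Q ** diagm (\<lambda>i. a i + b i) ** Q" for a b
  proof -
    have "diagm (\<lambda>i. a i + b i) = diagm a + diagm b" by (simp add: diagm_def vec_eq_iff)
    then show ?thesis by (simp add: matrix_add_ldistrib matrix_add_rdistrib)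
  qed
  have eq: "S ** S + mat (\<delta> m) = transpose Q ** diagm (\<lambda>i. lam i * lam i + \<delta> m) ** Q" for m
    unfolding Q(2) conj_diagm_mult[OF Q(1)] m[of "\<delta> m"] add ..
  have "(transpose Q ** diagm (\<lambda>i. lam i * lam i + \<delta> m) ** Q) **
        (transpose Q ** diagm (\<lambda>i. inverse (lam i * lam i + \<delta> m)) ** Q) = mat 1" for m
    unfolding conj_diagm_mult[OF Q(1)] m[of 1] by (simp add: nz)
  then have "minv (S ** S + mat (\<delta> m)) = transpose Q ** diagm (\<lambda>i. inverse (lam i * lam i + \<delta> m)) ** Q" for m
    unfolding eq by (rule minv_unique)
  then have "minv (S ** S + mat (\<delta> m)) ** S = transpose Q ** diagm (\<lambda>i. inverse (lam i * lam i + \<delta> m) * lam i) ** Q" for m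
    by (subst (2) Q(2)) (simp add: conj_diagm_mult[OF Q(1)])
  moreover have "(\<lambda>m. inverse (lam i * lam i + \<delta> m) * lam i) \<longlonglongrightarrow> inverse (lam i)" for i
  proof (cases "lam i = 0")
    case False
    have "\<delta> \<longlonglongrightarrow> 0" unfolding \<delta>_def by (rule LIMSEQ_inverse_real_of_nat)
    then have "(\<lambda>m. inverse (lam i * lam i + \<delta> m) * lam i) \<longlonglongrightarrow> inverse (lam i * lam i + 0) * lam i"
      using False by (intro tendsto_intros) auto
    then show ?thesis using False by (simp add: field_simps)
  qed simp
  then have "(\<lambda>m. diagm (\<lambda>i. inverse (lam i * lam i + \<delta> m) * lam i)) \<longlonglongrightarrow> diagm (\<lambda>i. inverse (lam i))"
    unfolding diagm_def by (intro vec_tendstoI) simp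
  then have "(\<lambda>m. transpose Q ** diagm (\<lambda>i. inverse (lam i * lam i + \<delta> m) * lam i) ** Q)
      \<longlonglongrightarrow> transpose Q ** diagm (\<lambda>i. inverse (lam i)) ** Q"
    by (intro tendsto_intros)
  moreover have "pinv S = transpose Q ** diagm (\<lambda>i. inverse (lam i)) ** Q"
    unfolding Q(2) by (intro pinv_eq penrose_conj_diagm Q(1))
  ultimately show ?thesis by (simp add: \<delta>_def)
qed

lemma psd_diagonal_nonneg: "psd A \<Longrightarrow> 0 \<le> A $ i $ i"
proof -
  assume "psd A"
  then have "0 \<le> axis i 1 \<bullet> (A *v axis i 1)" by (simp add: psd_def)
  then show ?thesis
    by (simp add: inner_axis' matrix_vector_mult_basis column_def)
qed

lemma psd_trace_nonneg: "psd A \<Longrightarrow> 0 \<le> trace A"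
  by (simp add: trace_def sum_nonneg psd_diagonal_nonneg)

lemma diag_part_eq: "diag_part A = diagm (\<lambda>i. A $ i $ i)"
  by (simp add: diag_part_def diagm_def vec_eq_iff)

lemma psd_diagm: "(\<And>i. 0 \<le> a i) \<Longrightarrow> psd (diagm a)"
proof -
  assume a: "\<And>i. 0 \<le> a i"
  have "v \<bullet> (diagm a *v v) = (\<Sum>i\<in>UNIV. a i * (v $ i)\<^sup>2)" for v
    by (simp add: inner_vec_def diagm_vec power2_eq_square mult_ac)
  then show ?thesis using a by (simp add: psd_def sum_nonneg)
qed

locale symmetric_projection =
  fixes T :: "real ^ 'n::finite ^ 'n"
  assumes sym: "transpose T = T" and idem: "T ** T = T"
begin

lemma idem_mult [simp]: "T ** (T ** X) = T ** X"
  by (simp add: matrix_mul_assoc idem)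

lemma psd_sandwich: "psd A \<Longrightarrow> psd (T ** A ** T)"
  using psd_congruence[of A T] by (simp add: sym)

text \<open>Applying \<open>T\<close> to the equation leaves T D T v = 0, so w = T v satisfies w'D w
  = 0 and vanishes because the diagonal is positive. What remains of the equation is v = 0.\<close>

lemma kernel_MATS:
  assumes d: "\<And>i. 0 < d i" and v: "(T ** diagm d ** T + (mat 1 - T)) *v v = 0"
  shows "v = 0"
proof -
  let ?w = "T *v v"
  have c: "T *v ((T ** diagm d ** T + (mat 1 - T)) *v v) = T *v (diagm d *v ?w)"
    by (simp add: matrix_vector_mul_assoc matrix_add_ldistrib matrix_diff_ldistrib idem flip: matrix_mul_assoc)
  have "?w \<bullet> (diagm d *v ?w) = v \<bullet> (T *v (diagm d *v ?w))"
    using inner_transpose[of T v] by (simp only: sym)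
  also have "\<dots> = 0" by (simp add: v flip: c)
  finally have "(\<Sum>i\<in>UNIV. d i * (?w $ i)\<^sup>2) = 0"
    by (simp add: inner_vec_def diagm_vec power2_eq_square mult_ac)
  then have "\<forall>i\<in>UNIV. d i * (?w $ i)\<^sup>2 = 0"
    by (subst (asm) sum_nonneg_eq_0_iff) (auto intro: mult_nonneg_nonneg less_imp_le[OF d])
  then have "d i = 0 \<or> ?w $ i = 0" for i by simp
  then have w: "?w = 0" using d by (metis less_irrefl vec_eq_iff zero_index)
  have "(T ** diagm d ** T + (mat 1 - T)) *v v = (T ** diagm d) *v ?w + (v - ?w)"
    by (simp add: matrix_vector_mult_add_rdistrib matrix_vector_mult_diff_rdistrib matrix_vector_mul_assoc)
  then show "v = 0" using v by (simp add: w)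
qed

lemma invertible_MATS: "(\<And>i. 0 < d i) \<Longrightarrow> invertible (T ** diagm d ** T + (mat 1 - T))"
  using kernel_MATS invertible_iff_kernel by blast

text \<open>On the range of \<open>T\<close> the matrix \<open>T D T + (I - T)\<close> acts as \<open>T D T\<close>, and unlike the
  Moore--Penrose inverse its inverse is visibly continuous in \<open>D\<close>.\<close>

lemma pinv_MATS:
  assumes d: "\<And>i. 0 < d i"
  defines "K \<equiv> T ** diagm d ** T + (mat 1 - T)"
  shows "pinv (T ** diagm d ** T) = minv K ** T"
    and "T ** (minv K ** T) = minv K ** T"
    and "minv K ** T ** (T ** diagm d ** T) = T"
    and "penrose (T ** diagm d ** T) (minv K ** T)"
proof -
  let ?A = "T ** diagm d ** T"
  have K: "K ** minv K = mat 1" "minv K ** K = mat 1"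
    by (intro minv; unfold K_def; intro invertible_MATS d)+
  have KT: "K ** T = ?A" "T ** K = ?A"
    by (simp_all add: K_def matrix_add_ldistrib matrix_add_rdistrib matrix_diff_ldistrib matrix_diff_rdistrib idem flip: matrix_mul_assoc)
  have cm: "T ** minv K = minv K ** T"
  proof -
    have "T ** minv K = minv K ** (K ** T) ** minv K" by (simp add: K matrix_mul_assoc)
    also have "\<dots> = minv K ** (T ** K) ** minv K" by (simp add: KT)
    also have "\<dots> = minv K ** T" by (simp add: K flip: matrix_mul_assoc)
    finally show ?thesis .
  qed
  show TG: "T ** (minv K ** T) = minv K ** T"
    by (simp only: matrix_mul_assoc cm) (simp only: idem flip: matrix_mul_assoc)
  have AG: "?A ** (minv K ** T) = T"
  proof -
    have "?A ** (minv K ** T) = T ** (K ** minv K) ** T" by (simp add: matrix_mul_assoc flip: KT(2))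
    then show ?thesis by (simp add: K idem)
  qed
  show GA: "minv K ** T ** ?A = T"
  proof -
    have "minv K ** T ** ?A = minv K ** ?A" by (simp flip: matrix_mul_assoc)
    also have "\<dots> = (minv K ** K) ** T" by (simp add: matrix_mul_assoc flip: KT(1))
    finally show ?thesis by (simp add: K)
  qed
  have "T ** ?A = ?A" by (simp flip: matrix_mul_assoc)
  then show pen: "penrose ?A (minv K ** T)"
    using TG by (simp add: penrose_def AG GA sym)
  then show "pinv ?A = minv K ** T" by (rule pinv_eq)
qed

text \<open>Close to \<open>V\<close> the diagonal stays positive, so that the expression by
  \<open>minv\<close> is valid there for both the limit and the approximating matrices.\<close>

lemma tendsto_MATS:
  assumes d: "\<And>i. 0 < V $ i $ i" and A: "(A \<longlongrightarrow> V) F"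
  shows "((\<lambda>x. MATS_E T (A x)) \<longlongrightarrow> MATS_E T V) F"
proof -
  have ev: "\<forall>\<^sub>F x in F. \<forall>i. 0 < A x $ i $ i"
    by (intro eventually_all_finite order_tendstoD(1)[OF tendsto_vec_nth[OF tendsto_vec_nth[OF A]] d])
  have "((\<lambda>x. diagm (\<lambda>i. A x $ i $ i)) \<longlongrightarrow> diagm (\<lambda>i. V $ i $ i)) F"
    unfolding diagm_def by (intro vec_tendstoI) (simp add: tendsto_vec_nth A)
  then have "((\<lambda>x. minv (T ** diagm (\<lambda>i. A x $ i $ i) ** T + (mat 1 - T)) ** T)
      \<longlongrightarrow> minv (T ** diagm (\<lambda>i. V $ i $ i) ** T + (mat 1 - T)) ** T) F"
    by (intro tendsto_intros invertible_MATS d)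
  then show ?thesis
    unfolding MATS_E_def diag_part_eq pinv_MATS(1)[OF d]
    by (rule Lim_transform_eventually) (use ev in eventually_elim, simp add: pinv_MATS(1))
qed

lemma tendsto_ATS:
  assumes d: "trace (T ** V ** T) \<noteq> 0" and A: "(A \<longlongrightarrow> V) F"
  shows "((\<lambda>x. ATS_E T (A x)) \<longlongrightarrow> ATS_E T V) F"
proof -
  have "((\<lambda>x. T ** A x ** T) \<longlongrightarrow> T ** V ** T) F" using A by (intro tendsto_intros)
  then have "((\<lambda>x. trace (T ** A x ** T)) \<longlongrightarrow> trace (T ** V ** T)) F"
    unfolding trace_def by (intro tendsto_sum tendsto_vec_nth)
  then show ?thesis using d unfolding ATS_E_def by (intro tendsto_intros)
qed

lemma measurable_ATS: "ATS_E T \<in> borel_measurable borel"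
proof -
  have "continuous_on UNIV (\<lambda>A. trace (T ** A ** T))"
    unfolding trace_def continuous_on_def by (intro ballI tendsto_sum tendsto_vec_nth tendsto_matrix_mult tendsto_const tendsto_ident_at)
  then have "(\<lambda>A. trace (T ** A ** T)) \<in> borel_measurable borel"
    by (rule borel_measurable_continuous_onI)
  then have "(\<lambda>A. ATS_E T A) \<in> borel_measurable borel" unfolding ATS_E_def by measurable
  then show ?thesis by simp
qed

text \<open>An estimated matrix may have zero or negative diagonal entries, where the expression by
  \<open>minv\<close> is not at hand. The regularized inverses are continuous everywhere, because
  \<open>S A ** S A\<close> plus a positive multiple of the identity is positive definite.\<close>

lemma measurable_MATS: "MATS_E T \<in> borel_measurable borel"
proof -
  define S where "S A = T ** diag_part A ** T" for A :: "real ^ 'n ^ 'n"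
  have S: "transpose (S A) = S A" for A
    by (simp add: S_def diag_part_eq matrix_transpose_mul sym matrix_mul_assoc)
  have inv: "invertible (S A ** S A + mat (inverse (real (Suc m))))" for A m
  proof -
    let ?\<delta> = "inverse (real (Suc m))"
    have "v = 0" if "(S A ** S A + mat ?\<delta>) *v v = 0" for v
    proof -
      have "0 = v \<bullet> ((S A ** S A + mat ?\<delta>) *v v)" using that by simp
      also have "\<dots> = (S A *v v) \<bullet> (S A *v v) + ?\<delta> * (v \<bullet> v)"
        using symmetric_dot[OF S, of v A "S A *v v"]
        by (simp add: matrix_vector_mult_add_rdistrib inner_add_right mat_vec matrix_vector_mul_assoc)
      finally have "?\<delta> * (v \<bullet> v) \<le> 0" by (smt (verit) inner_ge_zero)
      moreover have "?\<delta> > 0" by simp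
      ultimately have "v \<bullet> v \<le> 0" by (simp add: mult_le_0_iff)
      then show "v = 0" by (metis inner_gt_zero_iff not_le)
    qed
    then show ?thesis using invertible_iff_kernel by blast
  qed
  have cS: "((\<lambda>x. S x) \<longlongrightarrow> S A) (at A)" for A
  proof -
    have "((\<lambda>x. diagm (\<lambda>i. x $ i $ i)) \<longlongrightarrow> diagm (\<lambda>i. A $ i $ i)) (at A)"
      unfolding diagm_def by (intro vec_tendstoI) (simp add: tendsto_vec_nth)
    then show ?thesis unfolding S_def diag_part_eq by (intro tendsto_intros)
  qed
  have "continuous_on UNIV (\<lambda>A. minv (S A ** S A + mat (inverse (real (Suc m)))) ** S A)" for m
    unfolding continuous_on_def by (intro ballI tendsto_matrix_mult tendsto_minv tendsto_add tendsto_const cS inv)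
  then have "(\<lambda>A. minv (S A ** S A + mat (inverse (real (Suc m)))) ** S A) \<in> borel_measurable borel" for m
    by (rule borel_measurable_continuous_onI)
  then have "(\<lambda>A. pinv (S A)) \<in> borel_measurable borel"
    by (rule borel_measurable_LIMSEQ_metric) (rule pinv_symmetric_limit[OF S])
  then show ?thesis by (simp add: MATS_E_def[abs_def] S_def)
qed

lemma eigenvalue_family_weight:
  assumes "eigenvalue_family ((T ** E ** T) ** V) lam"
  shows "eigenvalue_family (E ** T ** V ** T) lam"
proof -
  have "det (mat x - E ** T ** V ** T) = det (mat x - (T ** E ** T) ** V)" for x
    by (subst det_mat_minus_mult_commute) (simp add: matrix_mul_assoc)
  then show ?thesis using assms by (simp add: eigenvalue_family_def)
qed

text \<open>For ATS the weight is a nonnegative multiple of T'T. For MATS a symmetric pseudoinverse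
  G of A equals G A G, a congruence of a positive semidefinite matrix.\<close>

lemma weight_psd:
  assumes V: "psd V" and E: "E = ATS_E \<or> E = MATS_E" and d: "\<And>i. 0 < V $ i $ i"
  shows "psd (T ** E T V ** T)"
  using E
proof
  assume "E = ATS_E"
  then have "T ** E T V ** T = inverse (trace (T ** V ** T)) *\<^sub>R (transpose T ** T)"
    by (simp add: ATS_E_def matrix_scaleR_mult idem sym)
  moreover have "psd (c *\<^sub>R A)" if "0 \<le> c" "psd A" for c and A :: "real^'n^'n"
    using that unfolding psd_def
    by (simp add: scaleR_matrix_vector_assoc[symmetric] transpose_scalar)
  moreover have "0 \<le> inverse (trace (T ** V ** T))"
    by (simp add: psd_trace_nonneg psd_sandwich V)
  ultimately show ?thesis by (simp add: psd_transpose_mult)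
next
  assume "E = MATS_E"
  let ?A = "T ** diagm (\<lambda>i. V $ i $ i) ** T"
  have A: "psd ?A" by (intro psd_sandwich psd_diagm less_imp_le d)
  have G: "penrose ?A (pinv ?A)" "transpose (pinv ?A) = pinv ?A"
    using A by (auto simp: psd_def penrose_pinv transpose_pinv)
  then have "psd (pinv ?A)"
    using psd_congruence[OF A, of "pinv ?A"] by (simp add: penrose_def)
  then show ?thesis using \<open>E = MATS_E\<close> by (simp add: MATS_E_def diag_part_eq psd_sandwich)
qed

text \<open>Used in contrapositive form: unless T V T vanishes, some weight of the limit law is
  nonzero and its distribution function is continuous. The hypothesis gives V (T E T) = 0, from
  which E is cancelled, as a nonzero scalar for ATS and by multiplying with T D T for MATS.\<close>

lemma weight_zero:
  fixes R :: "real ^ 'n ^ 'n"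
  assumes V: "psd V" and E: "E = ATS_E \<or> E = MATS_E" and d: "\<And>i. 0 < V $ i $ i"
    and tr: "E = ATS_E \<Longrightarrow> trace (T ** V ** T) \<noteq> 0"
    and G: "T ** E T V ** T = transpose R ** R" and z: "R ** V ** transpose R = 0"
  shows "T ** V ** T = 0"
proof -
  have "V ** (transpose R ** R) = V ** transpose R ** R" by (simp add: matrix_mul_assoc)
  then have VG: "V ** (T ** E T V ** T) = 0"
    by (simp add: G psd_zero_factor[OF V z])
  from E show ?thesis
  proof
    assume E: "E = ATS_E"
    then have "inverse (trace (T ** V ** T)) *\<^sub>R (V ** T) = 0"
      using VG by (simp add: ATS_E_def matrix_scaleR_mult idem)
    then have "V ** T = 0" using tr[OF E] by simp
    then show ?thesis by (simp flip: matrix_mul_assoc)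
  next
    assume E: "E = MATS_E"
    let ?A = "T ** diagm (\<lambda>i. V $ i $ i) ** T" and ?G = "minv (T ** diagm (\<lambda>i. V $ i $ i) ** T + (mat 1 - T)) ** T"
    have "T ** ?G ** T = ?G"
      by (simp add: pinv_MATS(2)[OF d]) (simp add: idem flip: matrix_mul_assoc)
    then have "V ** ?G = 0"
      using VG by (simp add: E MATS_E_def diag_part_eq pinv_MATS(1)[OF d])
    then have "V ** (?G ** ?A) = 0" by (subst matrix_mul_assoc) simp
    then have "V ** T = 0" by (simp only: pinv_MATS(3)[OF d])
    then show ?thesis by (simp flip: matrix_mul_assoc)
  qed
qed

end

section \<open>Limit laws of quadratic forms through Laplace transforms\<close>

subsection \<open>Laplace transforms at the natural numbers\<close>

lemma (in prob_space) integrable_bounded: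
  fixes f :: "'a \<Rightarrow> 'b::{banach, second_countable_topology}"
  assumes "f \<in> borel_measurable M" "AE x in M. norm (f x) \<le> B"
  shows "integrable M f"
  using assms by (rule integrable_const_bound[rotated])

lemma (in prob_space) norm_integral_diff_le:
  fixes f g :: "'a \<Rightarrow> 'b::{banach, second_countable_topology}"
  assumes "integrable M f" "integrable M g" "AE x in M. norm (f x - g x) \<le> B"
  shows "norm ((\<integral>x. f x \<partial>M) - (\<integral>x. g x \<partial>M)) \<le> B"
proof -
  have "norm (\<integral>x. f x - g x \<partial>M) \<le> (\<integral>x. norm (f x - g x) \<partial>M)"
    by (rule integral_norm_bound)
  also have "\<dots> \<le> (\<integral>x. B \<partial>M)"
    using assms by (intro integral_mono_AE) auto
  finally show ?thesis using assms by (simp add: prob_space)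
qed

lemma (in prob_space) integral_polynomial_approx:
  fixes g :: "real \<Rightarrow> real"
  assumes g: "continuous_on UNIV g" and Y: "Y \<in> borel_measurable M" "AE x in M. 0 \<le> Y x"
    and pol: "\<And>s. s \<in> {0..1} \<Longrightarrow> \<bar>g s - (\<Sum>k\<le>n. a k * s ^ k)\<bar> \<le> e"
  shows "\<bar>(\<integral>x. g (exp (- Y x)) \<partial>M) - (\<Sum>k\<le>n. a k * (\<integral>x. exp (- (real k * Y x)) \<partial>M))\<bar> \<le> e"
proof -
  have [measurable]: "g \<in> borel_measurable borel" using g by (rule borel_measurable_continuous_onI)
  note Y(1)[measurable]
  have "compact (g ` {0..1})"
    using g continuous_on_subset by (intro compact_continuous_image) auto
  then obtain B where B: "\<And>s. s \<in> {0..1} \<Longrightarrow> norm (g s) \<le> B"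
    using compact_imp_bounded by (metis bounded_iff image_eqI)
  have ig: "integrable M (\<lambda>x. g (exp (- Y x)))"
  proof (rule integrable_bounded[where B = B])
    show "AE x in M. norm (g (exp (- Y x))) \<le> B"
      using Y(2) by eventually_elim (auto intro!: B simp del: real_norm_def)
  qed simp
  have ie: "integrable M (\<lambda>x. exp (- (real k * Y x)))" for k
    by (rule integrable_bounded[where B = 1]) (use Y(2) in \<open>auto elim: eventually_mono\<close>)
  have "\<bar>(\<integral>x. g (exp (- Y x)) \<partial>M) - (\<integral>x. (\<Sum>k\<le>n. a k * exp (- (real k * Y x))) \<partial>M)\<bar> \<le> e"
    unfolding real_norm_def[symmetric]
  proof (rule norm_integral_diff_le[OF ig])
    show "AE x in M. norm (g (exp (- Y x)) - (\<Sum>k\<le>n. a k * exp (- (real k * Y x)))) \<le> e"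
      using Y(2)
    proof eventually_elim
      case (elim x)
      have "exp (- (real k * Y x)) = exp (- Y x) ^ k" for k
        by (simp flip: exp_of_nat_mult)
      then show ?case using pol[of "exp (- Y x)"] elim by simp
    qed
  qed (simp add: ie)
  then show ?thesis by (simp add: ie)
qed

text \<open>Since exp (- Y) takes values in [0, 1] under every law, one polynomial approximates the
  integrand for all i at once. Only finitely many transforms enter for each accuracy, so no
  compactness argument along subsequences occurs.\<close>

lemma laplace_tendsto_integral:
  fixes g :: "real \<Rightarrow> real"
  assumes M: "\<And>i. prob_space (M i)" and L: "real_distribution L"
    and Y: "\<And>i. Y i \<in> borel_measurable (M i)" "\<And>i. AE x in M i. 0 \<le> Y i x"
    and L0: "AE u in L. 0 \<le> u"
    and lap: "\<And>k::nat. ((\<lambda>i. \<integral>x. exp (- (real k * Y i x)) \<partial>M i) \<longlongrightarrow> (\<integral>u. exp (- (real k * u)) \<partial>L)) F"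
    and g: "continuous_on UNIV g"
  shows "((\<lambda>i. \<integral>x. g (exp (- Y i x)) \<partial>M i) \<longlongrightarrow> (\<integral>u. g (exp (- u)) \<partial>L)) F"
proof (rule tendstoI)
  fix e :: real assume "e > 0"
  obtain h where h: "real_polynomial_function h" "\<And>s. s \<in> {0..1::real} \<Longrightarrow> \<bar>g s - h s\<bar> < e / 3"
    using Stone_Weierstrass_real_polynomial_function[of "{0..1::real}" g "e/3"] \<open>e > 0\<close> g
    by (metis compact_Icc continuous_on_subset divide_pos_pos top_greatest zero_less_numeral)
  obtain a n where an: "h = (\<lambda>s. \<Sum>k\<le>n. a k * s ^ k)"
    using h(1) real_polynomial_function_iff_sum by blast
  have pol: "\<bar>g s - (\<Sum>k\<le>n. a k * s ^ k)\<bar> \<le> e / 3" if "s \<in> {0..1}" for s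
    using h(2)[OF that] by (simp add: an)
  interpret L: real_distribution L by fact
  have 1: "\<bar>(\<integral>x. g (exp (- Y i x)) \<partial>M i) - (\<Sum>k\<le>n. a k * (\<integral>x. exp (- (real k * Y i x)) \<partial>M i))\<bar> \<le> e / 3" for i
    by (rule prob_space.integral_polynomial_approx[OF M g Y pol])
  have 2: "\<bar>(\<integral>u. g (exp (- u)) \<partial>L) - (\<Sum>k\<le>n. a k * (\<integral>u. exp (- (real k * u)) \<partial>L))\<bar> \<le> e / 3"
    by (rule L.integral_polynomial_approx[OF g _ L0 pol]) simp
  have "((\<lambda>i. \<Sum>k\<le>n. a k * (\<integral>x. exp (- (real k * Y i x)) \<partial>M i)) \<longlongrightarrow>
      (\<Sum>k\<le>n. a k * (\<integral>u. exp (- (real k * u)) \<partial>L))) F"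
    by (intro tendsto_intros lap)
  then have "\<forall>\<^sub>F i in F. dist (\<Sum>k\<le>n. a k * (\<integral>x. exp (- (real k * Y i x)) \<partial>M i))
      (\<Sum>k\<le>n. a k * (\<integral>u. exp (- (real k * u)) \<partial>L)) < e / 3"
    using \<open>e > 0\<close> by (intro tendstoD) auto
  then show "\<forall>\<^sub>F i in F. dist (\<integral>x. g (exp (- Y i x)) \<partial>M i) (\<integral>u. g (exp (- u)) \<partial>L) < e"
  proof eventually_elim
    case (elim i)
    then show ?case using 1[of i] 2 unfolding dist_real_def by linarith
  qed
qed

text \<open>A continuous substitute for the indicator of u \<le> t, falling to 0 between t and t +
  \<eta>, but written in the variable s = exp (- u) because the preceding limit concerns continuous
  functions of exp (- u).\<close>

definition ramp :: "real \<Rightarrow> real \<Rightarrow> real \<Rightarrow> real" where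
  "ramp t \<eta> s = min 1 (max 0 ((s - exp (- (t + \<eta>))) / (exp (- t) - exp (- (t + \<eta>)))))"

lemma ramp:
  assumes "\<eta> > 0"
  shows "continuous_on UNIV (ramp t \<eta>)" "0 \<le> ramp t \<eta> s" "ramp t \<eta> s \<le> 1"
    "u \<le> t \<Longrightarrow> ramp t \<eta> (exp (- u)) = 1" "t + \<eta> < u \<Longrightarrow> ramp t \<eta> (exp (- u)) = 0"
proof -
  have d: "exp (- (t + \<eta>)) < exp (- t)" using assms by simp
  show "continuous_on UNIV (ramp t \<eta>)"
    unfolding ramp_def using d by (intro continuous_intros) auto
  show "0 \<le> ramp t \<eta> s" "ramp t \<eta> s \<le> 1" by (auto simp: ramp_def)
  show "ramp t \<eta> (exp (- u)) = 1" if "u \<le> t"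
    using d that by (simp add: ramp_def min_def max_def divide_simps)
  show "ramp t \<eta> (exp (- u)) = 0" if "t + \<eta> < u"
    using d that by (simp add: ramp_def min_def max_def divide_simps)
qed

lemma (in prob_space) prob_le_ramp:
  assumes [measurable]: "Y \<in> borel_measurable M" and \<eta>: "\<eta> > 0"
  shows "prob {x \<in> space M. Y x \<le> t} \<le> (\<integral>x. ramp t \<eta> (exp (- Y x)) \<partial>M)"
    "(\<integral>x. ramp t \<eta> (exp (- Y x)) \<partial>M) \<le> prob {x \<in> space M. Y x \<le> t + \<eta>}"
proof -
  have [measurable]: "ramp t \<eta> \<in> borel_measurable borel"
    using ramp(1)[OF \<eta>] by (rule borel_measurable_continuous_onI)
  have ir: "integrable M (\<lambda>x. ramp t \<eta> (exp (- Y x)))"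
    by (rule integrable_bounded[where B = 1]) (use ramp[OF \<eta>] in auto)
  have p: "prob {x \<in> space M. Y x \<le> c} = (\<integral>x. indicator {x \<in> space M. Y x \<le> c} x \<partial>M)" for c
    by (subst Bochner_Integration.integral_indicator) (auto simp: measure_def intro!: arg_cong[where f = "\<lambda>A. enn2real (emeasure M A)"])
  show "prob {x \<in> space M. Y x \<le> t} \<le> (\<integral>x. ramp t \<eta> (exp (- Y x)) \<partial>M)"
    unfolding p
    by (intro integral_mono ir) (auto simp: indicator_def ramp[OF \<eta>] intro!: integrable_bounded[where B = 1])
  show "(\<integral>x. ramp t \<eta> (exp (- Y x)) \<partial>M) \<le> prob {x \<in> space M. Y x \<le> t + \<eta>}"
    unfolding p
  proof (intro integral_mono ir)
    show "ramp t \<eta> (exp (- Y x)) \<le> indicat_real {x \<in> space M. Y x \<le> t + \<eta>} x" if "x \<in> space M" for x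
      using that ramp(3)[OF \<eta>] ramp(5)[OF \<eta>, of t "Y x"] by (auto simp: indicator_def not_le)
  qed (auto intro!: integrable_bounded[where B = 1] simp: indicator_def)
qed

text \<open>A shift \<eta> is kept instead of a limit because \<open>cdf L\<close> may jump at t; it
  is removed at continuity points in \<open>cdf_limit_perturbed\<close>.\<close>

lemma laplace_cdf_sandwich:
  assumes M: "\<And>i. prob_space (M i)" and L: "real_distribution L"
    and Y: "\<And>i. Y i \<in> borel_measurable (M i)" "\<And>i. AE x in M i. 0 \<le> Y i x"
    and L0: "AE u in L. 0 \<le> u"
    and lap: "\<And>k::nat. ((\<lambda>i. \<integral>x. exp (- (real k * Y i x)) \<partial>M i) \<longlongrightarrow> (\<integral>u. exp (- (real k * u)) \<partial>L)) F"
    and \<eta>: "\<eta> > 0" and e: "e > 0"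
  shows "\<forall>\<^sub>F i in F. measure (M i) {x \<in> space (M i). Y i x \<le> t} \<le> cdf L (t + \<eta>) + e"
    "\<forall>\<^sub>F i in F. cdf L (t - \<eta>) - e \<le> measure (M i) {x \<in> space (M i). Y i x \<le> t}"
proof -
  interpret L: real_distribution L by fact
  have lim: "((\<lambda>i. \<integral>x. ramp s \<eta> (exp (- Y i x)) \<partial>M i) \<longlongrightarrow> (\<integral>u. ramp s \<eta> (exp (- u)) \<partial>L)) F" for s
    by (rule laplace_tendsto_integral[OF M L Y L0 lap ramp(1)[OF \<eta>]])
  have c: "cdf L s = L.prob {u \<in> space L. u \<le> s}" for s
    unfolding cdf_def by (intro arg_cong[where f = L.prob]) auto
  have "\<forall>\<^sub>F i in F. (\<integral>x. ramp t \<eta> (exp (- Y i x)) \<partial>M i) < cdf L (t + \<eta>) + e"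
    by (rule order_tendstoD(2)[OF lim]) (use L.prob_le_ramp(2)[of "\<lambda>u. u" \<eta> t] \<eta> e c in auto)
  then show "\<forall>\<^sub>F i in F. measure (M i) {x \<in> space (M i). Y i x \<le> t} \<le> cdf L (t + \<eta>) + e"
  proof eventually_elim
    case (elim i)
    then show ?case using prob_space.prob_le_ramp(1)[OF M Y(1) \<eta>, of i t] by linarith
  qed
  have "\<forall>\<^sub>F i in F. cdf L (t - \<eta>) - e < (\<integral>x. ramp (t - \<eta>) \<eta> (exp (- Y i x)) \<partial>M i)"
    by (rule order_tendstoD(1)[OF lim]) (use L.prob_le_ramp(1)[of "\<lambda>u. u" \<eta> "t - \<eta>"] \<eta> e c in auto)
  then show "\<forall>\<^sub>F i in F. cdf L (t - \<eta>) - e \<le> measure (M i) {x \<in> space (M i). Y i x \<le> t}"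
  proof eventually_elim
    case (elim i)
    then show ?case using prob_space.prob_le_ramp(2)[OF M Y(1) \<eta>, of i "t - \<eta>"] by simp
  qed
qed

subsection \<open>A quantitative central limit theorem for characteristic functions\<close>

text \<open>Both terms are compared with 1 - v / 2, where v is the variance. Taylor's remainder
  costs b^3 / 6 for the characteristic function, and v \<le> b^2 turns the quadratic remainder of
  the real exponential into at most b^4.\<close>

lemma (in prob_space) char_second_order:
  fixes Y :: "'a \<Rightarrow> real"
  assumes [measurable]: "Y \<in> borel_measurable M" and b: "\<And>x. x \<in> space M \<Longrightarrow> \<bar>Y x\<bar> \<le> b" and mean: "expectation Y = 0"
  shows "cmod ((\<integral>x. iexp (Y x) \<partial>M) - exp (- (expectation (\<lambda>x. (Y x)\<^sup>2) / 2))) \<le> b ^ 3 + b ^ 4"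
proof -
  obtain x0 where "x0 \<in> space M" using not_empty by blast
  then have b0: "0 \<le> b" using b by force
  define v where "v = expectation (\<lambda>x. (Y x)\<^sup>2)"
  have iY: "integrable M Y" by (rule integrable_bounded[where B = b]) (use b in auto)
  have Y2: "(Y x)\<^sup>2 \<le> b\<^sup>2" if "x \<in> space M" for x
    using power_mono[OF b[OF that], of 2] by simp
  have iY2: "integrable M (\<lambda>x. (Y x)\<^sup>2)" by (rule integrable_bounded[where B = "b\<^sup>2"]) (use Y2 in auto)
  have v: "0 \<le> v" "v \<le> b\<^sup>2"
    unfolding v_def using iY2 Y2 by (auto intro!: integral_nonneg_AE integral_le_const)
  define T2 where "T2 x = 1 + \<i> * of_real (Y x) - of_real ((Y x)\<^sup>2 / 2)" for x
  have iT: "integrable M T2"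
    unfolding T2_def
    by (intro Bochner_Integration.integrable_add Bochner_Integration.integrable_diff integrable_mult_right
        integrable_of_real integrable_divide iY iY2) simp
  have "(\<integral>x. T2 x \<partial>M) = 1 - of_real (v / 2)"
  proof -
    have "(\<integral>x. T2 x \<partial>M) = 1 + \<i> * of_real (expectation Y) - of_real (expectation (\<lambda>x. (Y x)\<^sup>2 / 2))"
      unfolding T2_def using iY iY2 by (simp add: prob_space del: of_real_divide of_real_power)
    then show ?thesis using mean by (simp add: v_def)
  qed
  moreover have "cmod ((\<integral>x. iexp (Y x) \<partial>M) - (\<integral>x. T2 x \<partial>M)) \<le> b ^ 3 / 6"
  proof (rule norm_integral_diff_le[OF _ iT])
    show "integrable M (\<lambda>x. iexp (Y x))" by (rule integrable_iexp) auto
    have "cmod (iexp (Y x) - T2 x) \<le> b ^ 3 / 6" if "x \<in> space M" for x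
    proof -
      have "T2 x = (\<Sum>k\<le>2. (\<i> * of_real (Y x)) ^ k / fact k)"
        by (simp add: T2_def numeral_2_eq_2 power2_eq_square algebra_simps)
      then have "cmod (iexp (Y x) - T2 x) \<le> \<bar>Y x\<bar> ^ 3 / 6"
        using iexp_approx1[of "Y x" 2] by (simp add: numeral_3_eq_3)
      also have "\<dots> \<le> b ^ 3 / 6" using b[OF that] by (simp add: power_mono)
      finally show ?thesis .
    qed
    then show "AE x in M. cmod (iexp (Y x) - T2 x) \<le> b ^ 3 / 6" by auto
  qed
  moreover have "cmod (1 - of_real (v / 2) - of_real (exp (- (v / 2)))) \<le> b ^ 4"
  proof -
    define y where "y = v / 2"
    have y: "0 \<le> y" "y \<le> b\<^sup>2" using v by (auto simp: y_def)
    have l: "1 - y \<le> exp (- y)" using exp_ge_add_one_self[of "- y"] by simp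
    \<comment> \<open>Multiplying 1 - y + y^2 by 1 + y gives 1 + y^3, which is at least 1, and 1 + y
      is at most exp y.\<close>
    have u: "exp (- y) \<le> 1 - y + y\<^sup>2"
    proof -
      have "1 + y \<le> exp y" by (rule exp_ge_add_one_self)
      moreover have "1 \<le> (1 - y + y\<^sup>2) * (1 + y)"
        using y by (simp add: algebra_simps power2_eq_square)
      moreover have "0 < 1 - y + y\<^sup>2"
      proof -
        have "1 - y + y\<^sup>2 = (y - 1/2)\<^sup>2 + 3/4" by (simp add: power2_eq_square algebra_simps)
        then show ?thesis by (smt (verit) zero_le_power2 divide_pos_pos)
      qed
      ultimately have "1 \<le> (1 - y + y\<^sup>2) * exp y"
        by (smt (verit) mult_left_mono)
      then show ?thesis by (simp add: exp_minus field_simps)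
    qed
    have "y\<^sup>2 \<le> (b\<^sup>2)\<^sup>2" using y by (intro power_mono)
    then have "\<bar>1 - y - exp (- y)\<bar> \<le> b ^ 4" using l u by (simp add: power4_eq_xxxx power2_eq_square mult_ac)
    moreover have "1 - of_real (v / 2) - of_real (exp (- (v / 2))) = complex_of_real (1 - y - exp (- y))"
      by (simp add: y_def)
    ultimately show ?thesis by (metis norm_of_real)
  qed
  ultimately have "cmod ((\<integral>x. iexp (Y x) \<partial>M) - of_real (exp (- (v / 2)))) \<le> b ^ 3 / 6 + b ^ 4"
    by (smt (verit) norm_triangle_le_diff norm_triangle_sub norm_diff_triangle_le)
  also have "\<dots> \<le> b ^ 3 + b ^ 4" using b0 by simp
  finally show ?thesis by (simp add: v_def)
qed

text \<open>Independence factorizes the characteristic function. All factors on both sides lie in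
  the unit disc, so the products differ by at most the sum of the differences of the
  factors.\<close>

lemma (in prob_space) char_sum_bound:
  fixes Y :: "'j \<Rightarrow> 'a \<Rightarrow> real"
  assumes J: "finite J" and ind: "indep_vars (\<lambda>_. borel) Y J"
    and b: "\<And>j x. j \<in> J \<Longrightarrow> x \<in> space M \<Longrightarrow> \<bar>Y j x\<bar> \<le> b j"
    and mean: "\<And>j. j \<in> J \<Longrightarrow> expectation (Y j) = 0"
  shows "cmod ((\<integral>x. iexp (\<Sum>j\<in>J. Y j x) \<partial>M) - exp (- ((\<Sum>j\<in>J. expectation (\<lambda>x. (Y j x)\<^sup>2)) / 2)))
    \<le> (\<Sum>j\<in>J. b j ^ 3 + b j ^ 4)"
proof -
  have m: "Y j \<in> borel_measurable M" if "j \<in> J" for j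
    using ind that by (auto simp: indep_vars_def)
  have "indep_vars (\<lambda>_. borel) (\<lambda>j x. iexp (Y j x)) J"
    by (rule indep_vars_compose2[OF ind]) simp
  then have "(\<integral>x. (\<Prod>j\<in>J. iexp (Y j x)) \<partial>M) = (\<Prod>j\<in>J. \<integral>x. iexp (Y j x) \<partial>M)"
    using J m by (intro indep_vars_lebesgue_integral) (auto intro!: integrable_iexp)
  moreover have "(\<Prod>j\<in>J. iexp (Y j x)) = iexp (\<Sum>j\<in>J. Y j x)" for x
    by (simp add: exp_sum[OF J] sum_distrib_left)
  moreover have "complex_of_real (exp (- ((\<Sum>j\<in>J. expectation (\<lambda>x. (Y j x)\<^sup>2)) / 2)))
      = (\<Prod>j\<in>J. of_real (exp (- (expectation (\<lambda>x. (Y j x)\<^sup>2) / 2))))"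
    by (simp add: exp_sum[OF J] sum_divide_distrib flip: sum_negf of_real_prod)
  moreover have "cmod ((\<Prod>j\<in>J. \<integral>x. iexp (Y j x) \<partial>M) - (\<Prod>j\<in>J. of_real (exp (- (expectation (\<lambda>x. (Y j x)\<^sup>2) / 2)))))
     \<le> (\<Sum>j\<in>J. cmod ((\<integral>x. iexp (Y j x) \<partial>M) - of_real (exp (- (expectation (\<lambda>x. (Y j x)\<^sup>2) / 2)))))"
  proof (rule norm_prod_diff)
    fix j assume "j \<in> J"
    have "cmod (\<integral>x. iexp (Y j x) \<partial>M) \<le> (\<integral>x. cmod (iexp (Y j x)) \<partial>M)" by (rule integral_norm_bound)
    then show "cmod (\<integral>x. iexp (Y j x) \<partial>M) \<le> 1" by (simp add: prob_space)
    have "0 \<le> expectation (\<lambda>x. (Y j x)\<^sup>2)" by simp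
    then show "cmod (of_real (exp (- (expectation (\<lambda>x. (Y j x)\<^sup>2) / 2)))) \<le> 1"
      unfolding norm_of_real by simp
  qed
  moreover have "\<dots> \<le> (\<Sum>j\<in>J. b j ^ 3 + b j ^ 4)"
    by (intro sum_mono char_second_order m b mean)
  ultimately show ?thesis by simp
qed

subsection \<open>Gaussian mixtures of characteristic functions\<close>

definition gauss :: "('n::finite \<Rightarrow> real) measure" where
  "gauss = Pi\<^sub>M UNIV (\<lambda>_. std_normal_distribution)"

lemma prob_space_std_normal: "prob_space std_normal_distribution"
  using real_dist_normal_dist real_distribution.axioms(1) by blast

interpretation std_normals: product_prob_space "\<lambda>_. std_normal_distribution" UNIV
  by (intro product_prob_spaceI prob_space_std_normal)

lemma prob_space_gauss: "prob_space gauss"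
  unfolding gauss_def by (intro prob_space_PiM prob_space_std_normal)

lemma sets_gauss [measurable_cong]: "sets gauss = sets (Pi\<^sub>M UNIV (\<lambda>_. borel))"
  unfolding gauss_def by (intro sets_PiM_cong) auto

lemma space_gauss [simp]: "space gauss = UNIV"
  by (simp add: gauss_def space_PiM)

lemma gauss_integral_prod:
  fixes h :: "'n::finite \<Rightarrow> real \<Rightarrow> 'b::{real_normed_field,banach,second_countable_topology}"
  assumes "\<And>a. integrable std_normal_distribution (h a)"
  shows "(\<integral>z. (\<Prod>a\<in>UNIV. h a (z a)) \<partial>gauss) = (\<Prod>a\<in>UNIV. \<integral>x. h a x \<partial>std_normal_distribution)"
    and "integrable gauss (\<lambda>z. \<Prod>a\<in>UNIV. h a (z a))"
  unfolding gauss_def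
  by (intro std_normals.product_integral_prod std_normals.product_integrable_prod; use assms in simp)+

lemma gauss_char:
  fixes y :: "'n::finite \<Rightarrow> real"
  shows "(\<integral>z. iexp (\<Sum>a\<in>UNIV. z a * y a) \<partial>gauss) = exp (- ((\<Sum>a\<in>UNIV. (y a)\<^sup>2) / 2))"
proof -
  have i: "integrable std_normal_distribution (\<lambda>x. iexp (x * y a))" for a
    by (rule prob_space.integrable_iexp[OF prob_space_std_normal]) auto
  have c: "(\<integral>x. iexp (x * y a) \<partial>std_normal_distribution) = exp (- ((y a)\<^sup>2 / 2))" for a
    using fun_cong[OF char_std_normal_distribution, of "y a"] by (simp add: char_def mult.commute)
  have "iexp (\<Sum>a\<in>UNIV. z a * y a) = (\<Prod>a\<in>UNIV. iexp (z a * y a))" for z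
    by (simp add: exp_sum sum_distrib_left)
  then have "(\<integral>z. iexp (\<Sum>a\<in>UNIV. z a * y a) \<partial>gauss) = (\<Prod>a\<in>UNIV. complex_of_real (exp (- ((y a)\<^sup>2 / 2))))"
    using gauss_integral_prod(1)[OF i] by (simp only: c)
  also have "\<dots> = exp (- ((\<Sum>a\<in>UNIV. (y a)\<^sup>2) / 2))"
    by (simp add: exp_sum sum_divide_distrib flip: sum_negf of_real_prod)
  finally show ?thesis .
qed

text \<open>Replacing \<open>exp (- \<bar>w\<bar>\<^sup>2 / 2)\<close> by a Gaussian average of \<open>exp (i z w)\<close> expresses Laplace
  transforms of quadratic forms by characteristic functions of linear forms.\<close>

lemma (in prob_space) laplace_eq_gauss_char:
  fixes W :: "'n::finite \<Rightarrow> 'a \<Rightarrow> real"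
  assumes [measurable]: "\<And>a. W a \<in> borel_measurable M"
  shows "complex_of_real (\<integral>x. exp (- ((\<Sum>a\<in>UNIV. (W a x)\<^sup>2) / 2)) \<partial>M)
      = (\<integral>z. (\<integral>x. iexp (\<Sum>a\<in>UNIV. z a * W a x) \<partial>M) \<partial>gauss)"
    and "(\<lambda>z. \<integral>x. iexp (\<Sum>a\<in>UNIV. z a * W a x) \<partial>M) \<in> borel_measurable gauss"
proof -
  interpret G: prob_space "gauss :: ('n \<Rightarrow> real) measure" by (rule prob_space_gauss)
  interpret P: pair_prob_space M "gauss :: ('n \<Rightarrow> real) measure" ..
  have [measurable]: "(\<lambda>z. z a) \<in> borel_measurable (gauss :: ('n \<Rightarrow> real) measure)" for a
    by measurable
  have m: "(\<lambda>(x, z). iexp (\<Sum>a\<in>UNIV. z a * W a x)) \<in> borel_measurable (M \<Otimes>\<^sub>M gauss)"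
    by measurable
  then have "integrable (M \<Otimes>\<^sub>M gauss) (\<lambda>(x, z). iexp (\<Sum>a\<in>UNIV. z a * W a x))"
    by (rule P.integrable_const_bound[where B = 1, rotated]) (auto simp: split_beta)
  from P.Fubini_integral[OF this]
  show "complex_of_real (\<integral>x. exp (- ((\<Sum>a\<in>UNIV. (W a x)\<^sup>2) / 2)) \<partial>M)
      = (\<integral>z. (\<integral>x. iexp (\<Sum>a\<in>UNIV. z a * W a x) \<partial>M) \<partial>gauss)"
    by (simp only: gauss_char integral_complex_of_real)
  show "(\<lambda>z. \<integral>x. iexp (\<Sum>a\<in>UNIV. z a * W a x) \<partial>M) \<in> borel_measurable gauss"
    by measurable
qed

lemma one_plus_sum_le_prod:
  fixes x :: "'a \<Rightarrow> real"
  assumes "finite A" "\<And>a. a \<in> A \<Longrightarrow> 0 \<le> x a"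
  shows "1 + (\<Sum>a\<in>A. x a) \<le> (\<Prod>a\<in>A. 1 + x a)"
  using assms
proof (induction A)
  case (insert b A)
  have "1 + (\<Sum>a\<in>insert b A. x a) \<le> (1 + x b) * (1 + (\<Sum>a\<in>A. x a))"
    using insert by (simp add: algebra_simps sum_nonneg)
  also have "\<dots> \<le> (1 + x b) * (\<Prod>a\<in>A. 1 + x a)"
    using insert by (intro mult_left_mono) auto
  finally show ?case using insert by simp
qed simp

text \<open>The norm is at most a multiple of the sum of the absolute coordinates, and 1 plus a sum
  of nonnegative terms is at most the product of the terms 1 + x. This majorant factorizes, so
  one-dimensional moments up to order four suffice.\<close>

lemma integrable_gauss_linear_power:
  fixes R :: "real ^ 'n::finite ^ 'm::finite"
  shows "integrable gauss (\<lambda>z. (1 + norm (transpose R *v (\<chi> a. z a))) ^ 4)"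
proof (rule Bochner_Integration.integrable_bound)
  define c where "c = onorm ((*v) (transpose R))"
  have c: "0 \<le> c" by (simp add: c_def matrix_vector_mul_bounded_linear onorm_pos_le)
  have "integrable std_normal_distribution (\<lambda>x. 1 + (4 * c) * \<bar>x\<bar> ^ 1 + (6 * c^2) * \<bar>x\<bar> ^ 2 + (4 * c^3) * \<bar>x\<bar> ^ 3 + c^4 * \<bar>x\<bar> ^ 4)"
  proof -
    have a: "integrable std_normal_distribution (\<lambda>x. \<bar>x\<bar> ^ k)" for k
      using integrable_abs[OF integrable_std_normal_distribution_moment[of k]] by (simp add: power_abs)
    have "integrable std_normal_distribution (\<lambda>x. 1::real)" using a[of 0] by (simp only: power_0)
    then show ?thesis
      by (intro Bochner_Integration.integrable_add integrable_mult_right a)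
  qed
  also have "(\<lambda>x. 1 + (4 * c) * \<bar>x\<bar> ^ 1 + (6 * c^2) * \<bar>x\<bar> ^ 2 + (4 * c^3) * \<bar>x\<bar> ^ 3 + c^4 * \<bar>x\<bar> ^ 4) = (\<lambda>x::real. (1 + c * \<bar>x\<bar>) ^ 4)"
    by (simp add: fun_eq_iff power4_eq_xxxx power3_eq_cube power2_eq_square algebra_simps)
  finally show "integrable gauss (\<lambda>z::'m \<Rightarrow> real. \<Prod>a\<in>UNIV. (1 + c * \<bar>z a\<bar>) ^ 4)"
    by (intro gauss_integral_prod(2))
  show "(\<lambda>z. (1 + norm (transpose R *v (\<chi> a. z a))) ^ 4) \<in> borel_measurable gauss"
    unfolding matrix_vector_mult_def norm_vec_def L2_set_def vec_lambda_beta by measurable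
  show "AE z in gauss. norm ((1 + norm (transpose R *v (\<chi> a. z a))) ^ 4) \<le> norm (\<Prod>a\<in>UNIV. (1 + c * \<bar>z a\<bar>) ^ 4)"
  proof (rule AE_I2)
    fix z :: "'m \<Rightarrow> real"
    have "norm (transpose R *v (\<chi> a. z a)) \<le> c * norm (\<chi> a. z a)"
      unfolding c_def by (intro onorm matrix_vector_mul_bounded_linear)
    also have "\<dots> \<le> c * (\<Sum>a\<in>UNIV. \<bar>(\<chi> a. z a) $ a\<bar>)"
      by (intro mult_left_mono norm_le_l1_cart c)
    finally have "1 + norm (transpose R *v (\<chi> a. z a)) \<le> 1 + (\<Sum>a\<in>UNIV. c * \<bar>z a\<bar>)"
      by (simp add: sum_distrib_left)
    also have "\<dots> \<le> (\<Prod>a\<in>UNIV. 1 + c * \<bar>z a\<bar>)"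
      by (rule one_plus_sum_le_prod) (auto simp: c)
    finally have "(1 + norm (transpose R *v (\<chi> a. z a))) ^ 4 \<le> (\<Prod>a\<in>UNIV. 1 + c * \<bar>z a\<bar>) ^ 4"
      by (intro power_mono) auto
    then show "norm ((1 + norm (transpose R *v (\<chi> a. z a))) ^ 4) \<le> norm (\<Prod>a\<in>UNIV. (1 + c * \<bar>z a\<bar>) ^ 4)"
      by (simp add: prod_power_distrib)
  qed
qed

lemma abs_exp_minus_diff_le:
  fixes u v :: real
  assumes "0 \<le> u" "0 \<le> v"
  shows "\<bar>exp (- (u / 2)) - exp (- (v / 2))\<bar> \<le> \<bar>u - v\<bar>"
proof -
  have *: "exp (- (a / 2)) - exp (- (b / 2)) \<le> b - a" if "0 \<le> a" "a \<le> b" for a b :: real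
  proof -
    have "exp (- (a / 2)) - exp (- (b / 2)) = exp (- (a / 2)) * (1 - exp (- ((b - a) / 2)))"
      by (simp add: algebra_simps diff_divide_distrib flip: exp_add)
    also have "\<dots> \<le> 1 * ((b - a) / 2)"
    proof (rule mult_mono)
      show "1 - exp (- ((b - a) / 2)) \<le> (b - a) / 2"
        using exp_ge_add_one_self[of "- ((b - a) / 2)"] by linarith
    qed (use that in auto)
    finally show ?thesis using that by simp
  qed
  have **: "exp (- (b / 2)) \<le> exp (- (a / 2))" if "a \<le> b" for a b :: real using that by simp
  show ?thesis
    using *[of u v] *[of v u] **[of u v] **[of v u] assms by (cases "u \<le> v") auto
qed

text \<open>The first integral is the Gaussian average over z of the characteristic function of the
  sum at the frequency \<open>\<tau> z\<close>, the second that of its normal approximation. The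
  factor in front depends on \<open>R\<close> only, hence the bound is uniform over all laws with
  the same \<open>b\<close>, \<open>s\<close> and \<open>V\<close>.\<close>

lemma (in prob_space) laplace_quadratic_bound:
  fixes \<zeta> :: "'j \<Rightarrow> 'a \<Rightarrow> real ^ 'n::finite" and V :: "real ^ 'n ^ 'n" and R :: "real ^ 'n ^ 'm::finite"
  assumes J: "finite J" and ind: "indep_vars (\<lambda>_. borel) \<zeta> J"
    and b: "\<And>j x. j \<in> J \<Longrightarrow> x \<in> space M \<Longrightarrow> norm (\<zeta> j x) \<le> b j" "\<And>j. j \<in> J \<Longrightarrow> 0 \<le> b j"
    and mean: "\<And>j t. j \<in> J \<Longrightarrow> expectation (\<lambda>x. t \<bullet> \<zeta> j x) = 0"
    and V: "psd V" and s: "\<And>t. \<bar>(\<Sum>j\<in>J. expectation (\<lambda>x. (t \<bullet> \<zeta> j x)\<^sup>2)) - t \<bullet> (V *v t)\<bar> \<le> s * (norm t)\<^sup>2" "0 \<le> s"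
  defines "\<tau> \<equiv> \<lambda>z::'m \<Rightarrow> real. transpose R *v (\<chi> a. z a)"
  shows "\<bar>(\<integral>x. exp (- ((norm (R *v (\<Sum>j\<in>J. \<zeta> j x)))\<^sup>2 / 2)) \<partial>M) - (\<integral>z. exp (- (\<tau> z \<bullet> (V *v \<tau> z) / 2)) \<partial>gauss)\<bar>
    \<le> (\<integral>z. (1 + norm (\<tau> z)) ^ 4 \<partial>gauss) * ((\<Sum>j\<in>J. b j ^ 3 + b j ^ 4) + s)"
proof -
  let ?e = "(\<Sum>j\<in>J. b j ^ 3 + b j ^ 4) + s"
  let ?\<phi> = "\<lambda>z. \<integral>x. iexp (\<tau> z \<bullet> (\<Sum>j\<in>J. \<zeta> j x)) \<partial>M"
  let ?\<psi> = "\<lambda>z. exp (- (\<tau> z \<bullet> (V *v \<tau> z) / 2))"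
  have m: "\<zeta> j \<in> borel_measurable M" if "j \<in> J" for j
    using ind that by (auto simp: indep_vars_def)
  interpret G: prob_space "gauss :: ('m \<Rightarrow> real) measure" by (rule prob_space_gauss)
  define W where "W a x = (R *v (\<Sum>j\<in>J. \<zeta> j x)) $ a" for a x
  have Wm: "W a \<in> borel_measurable M" for a
  proof -
    have "continuous_on UNIV (\<lambda>y. (R *v y) $ a)"
      by (intro continuous_intros matrix_vector_mult_linear_continuous_on)
    then show ?thesis
      unfolding W_def using m
      by (intro measurable_compose[OF borel_measurable_sum borel_measurable_continuous_onI])
  qed
  have W1: "(norm (R *v (\<Sum>j\<in>J. \<zeta> j x)))\<^sup>2 = (\<Sum>a\<in>UNIV. (W a x)\<^sup>2)" for x
    by (simp add: W_def norm_vec_def L2_set_def sum_nonneg)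
  have W2: "(\<Sum>a\<in>UNIV. z a * W a x) = \<tau> z \<bullet> (\<Sum>j\<in>J. \<zeta> j x)" for z x
    unfolding \<tau>_def inner_transpose by (simp add: W_def inner_vec_def)
  have point: "cmod (?\<phi> z - ?\<psi> z) \<le> (1 + norm (\<tau> z)) ^ 4 * ?e" for z
  proof -
    let ?t = "\<tau> z" and ?n = "norm (\<tau> z)"
    let ?v = "\<Sum>j\<in>J. expectation (\<lambda>x. (?t \<bullet> \<zeta> j x)\<^sup>2)"
    have "indep_vars (\<lambda>_. borel) (\<lambda>j x. ?t \<bullet> \<zeta> j x) J"
      by (rule indep_vars_compose2[OF ind]) simp
    then have "cmod ((\<integral>x. iexp (\<Sum>j\<in>J. ?t \<bullet> \<zeta> j x) \<partial>M) - exp (- (?v / 2))) \<le> (\<Sum>j\<in>J. (?n * b j) ^ 3 + (?n * b j) ^ 4)"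
    proof (rule char_sum_bound[OF J])
      show "\<bar>?t \<bullet> \<zeta> j x\<bar> \<le> ?n * b j" if "j \<in> J" "x \<in> space M" for j x
        using Cauchy_Schwarz_ineq2[of ?t "\<zeta> j x"] mult_left_mono[OF b(1)[OF that], of ?n] by simp
    qed (rule mean)
    moreover have "cmod (complex_of_real (exp (- (?v / 2))) - of_real (?\<psi> z)) \<le> s * ?n\<^sup>2"
    proof -
      have "\<bar>exp (- (?v / 2)) - ?\<psi> z\<bar> \<le> \<bar>?v - ?t \<bullet> (V *v ?t)\<bar>"
        using V by (intro abs_exp_minus_diff_le sum_nonneg) (auto simp: psd_def)
      also have "\<dots> \<le> s * ?n\<^sup>2" by (rule s)
      finally show ?thesis by (metis norm_of_real of_real_diff)
    qed
    ultimately have "cmod (?\<phi> z - ?\<psi> z) \<le> (\<Sum>j\<in>J. (?n * b j) ^ 3 + (?n * b j) ^ 4) + s * ?n\<^sup>2"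
      unfolding inner_sum_right by (rule norm_diff_triangle_le)
    also have "\<dots> \<le> (\<Sum>j\<in>J. (1 + ?n) ^ 4 * (b j ^ 3 + b j ^ 4)) + s * (1 + ?n) ^ 4"
    proof (intro add_mono sum_mono mult_left_mono s(2))
      \<comment> \<open>One majorant serves the powers 2, 3 and 4 of the frequency, and it has a
        finite Gaussian integral.\<close>
      have p: "?n ^ k \<le> (1 + ?n) ^ 4" if "k \<le> 4" for k
        using power_mono[of ?n "1 + ?n" k] power_increasing[OF that, of "1 + ?n"] by simp
      show "?n\<^sup>2 \<le> (1 + ?n) ^ 4" using p[of 2] by simp
      show "(?n * b j) ^ 3 + (?n * b j) ^ 4 \<le> (1 + ?n) ^ 4 * (b j ^ 3 + b j ^ 4)" if "j \<in> J" for j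
        unfolding power_mult_distrib distrib_left
        using b(2)[OF that] by (intro add_mono mult_right_mono p) auto
    qed
    also have "\<dots> = (1 + ?n) ^ 4 * ?e" by (simp add: sum_distrib_left distrib_left mult.commute)
    finally show ?thesis .
  qed
  have lap: "complex_of_real (\<integral>x. exp (- ((norm (R *v (\<Sum>j\<in>J. \<zeta> j x)))\<^sup>2 / 2)) \<partial>M) = (\<integral>z. ?\<phi> z \<partial>gauss)"
    using laplace_eq_gauss_char(1)[of W, OF Wm] unfolding W1 W2 .
  have i\<phi>: "integrable gauss ?\<phi>"
  proof (rule G.integrable_bounded[where B = 1])
    show "?\<phi> \<in> borel_measurable gauss"
      using laplace_eq_gauss_char(2)[of W, OF Wm] unfolding W2 .
    have "cmod (?\<phi> z) \<le> (\<integral>x. cmod (iexp (\<tau> z \<bullet> (\<Sum>j\<in>J. \<zeta> j x))) \<partial>M)" for z by (rule integral_norm_bound)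
    then show "AE z in gauss. cmod (?\<phi> z) \<le> 1" by (simp add: prob_space)
  qed
  have i\<psi>: "integrable gauss ?\<psi>"
  proof (rule G.integrable_bounded[where B = 1])
    show "?\<psi> \<in> borel_measurable gauss"
      unfolding \<tau>_def matrix_vector_mult_def inner_vec_def vec_lambda_beta inner_real_def by measurable
  qed (use V in \<open>auto simp: psd_def\<close>)
  have i4: "integrable gauss (\<lambda>z. (1 + norm (\<tau> z)) ^ 4)"
    unfolding \<tau>_def by (rule integrable_gauss_linear_power)
  have "\<bar>(\<integral>x. exp (- ((norm (R *v (\<Sum>j\<in>J. \<zeta> j x)))\<^sup>2 / 2)) \<partial>M) - (\<integral>z. ?\<psi> z \<partial>gauss)\<bar>
      = cmod ((\<integral>z. ?\<phi> z \<partial>gauss) - (\<integral>z. complex_of_real (?\<psi> z) \<partial>gauss))"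
    unfolding lap[symmetric] integral_complex_of_real by (simp flip: of_real_diff)
  also have "\<dots> = cmod (\<integral>z. ?\<phi> z - of_real (?\<psi> z) \<partial>gauss)"
    using i\<phi> i\<psi> by simp
  also have "\<dots> \<le> (\<integral>z. cmod (?\<phi> z - of_real (?\<psi> z)) \<partial>gauss)"
    by (rule integral_norm_bound)
  also have "\<dots> \<le> (\<integral>z. (1 + norm (\<tau> z)) ^ 4 * ?e \<partial>gauss)"
    using i\<phi> i\<psi> i4 point by (intro integral_mono) auto
  finally show ?thesis by simp
qed

subsection \<open>Weighted sums of chi-square variables\<close>

lemma prob_space_chi2_1: "prob_space chi2_1"
  unfolding chi2_1_def by (intro prob_space.prob_space_distr prob_space_std_normal) simp

interpretation chi2s: product_prob_space "\<lambda>_. chi2_1" UNIV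
  by (intro product_prob_spaceI prob_space_chi2_1)

lemma sets_chi2_1 [simp, measurable_cong]: "sets chi2_1 = sets borel" "space chi2_1 = UNIV"
  by (simp_all add: chi2_1_def)

lemma measurable_chi2_sum [measurable]:
  "(\<lambda>b. \<Sum>a\<in>UNIV. lam a * b a) \<in> borel_measurable (Pi\<^sub>M (UNIV :: 'n::finite set) (\<lambda>_. chi2_1))"
  by measurable

lemma real_distribution_chi2_mixture: "real_distribution (chi2_mixture lam)"
  unfolding chi2_mixture_def by (intro prob_space.real_distribution_distr prob_space_PiM prob_space_chi2_1) simp

lemma AE_chi2_mixture:
  fixes lam :: "'n::finite \<Rightarrow> real"
  assumes "\<And>a. 0 \<le> lam a"
  shows "AE u in chi2_mixture lam. 0 \<le> u"
proof -
  have "AE x in chi2_1. 0 \<le> x" unfolding chi2_1_def by (subst AE_distr_iff) auto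
  then have "AE b in Pi\<^sub>M (UNIV :: 'n set) (\<lambda>_. chi2_1). 0 \<le> b a" for a
    by (intro AE_PiM_component prob_space_chi2_1) auto
  then have "AE b in Pi\<^sub>M (UNIV :: 'n set) (\<lambda>_. chi2_1). \<forall>a. 0 \<le> b a"
    by (subst AE_all_countable) auto
  then have "AE b in Pi\<^sub>M (UNIV :: 'n set) (\<lambda>_. chi2_1). 0 \<le> (\<Sum>a\<in>UNIV. lam a * b a)"
    by eventually_elim (auto intro!: sum_nonneg mult_nonneg_nonneg assms)
  then show ?thesis unfolding chi2_mixture_def by (subst AE_distr_iff) auto
qed

lemma laplace_chi2_mixture:
  fixes lam :: "'n::finite \<Rightarrow> real"
  assumes lam: "\<And>a. 0 \<le> lam a" and k: "0 \<le> k"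
  shows "(\<integral>u. exp (- (k * u)) \<partial>chi2_mixture lam) = (\<integral>z. exp (- (k * (\<Sum>a\<in>UNIV. lam a * (z a)\<^sup>2))) \<partial>gauss)"
proof -
  have i: "integrable std_normal_distribution (\<lambda>x. exp (- (k * lam a * x\<^sup>2)))" for a
    by (rule prob_space.integrable_bounded[OF prob_space_std_normal, where B = 1]) (use lam k in auto)
  have i2: "integrable chi2_1 (\<lambda>x. exp (- (k * lam a * x)))" for a
    unfolding chi2_1_def using i by (subst integrable_distr_eq) auto
  have "(\<integral>u. exp (- (k * u)) \<partial>chi2_mixture lam) = (\<integral>b. exp (- (k * (\<Sum>a\<in>UNIV. lam a * b a))) \<partial>Pi\<^sub>M UNIV (\<lambda>_. chi2_1))"
    unfolding chi2_mixture_def by (subst integral_distr) auto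
  also have "\<dots> = (\<integral>b. (\<Prod>a\<in>UNIV. exp (- (k * lam a * b a))) \<partial>Pi\<^sub>M UNIV (\<lambda>_. chi2_1))"
    by (simp add: sum_distrib_left mult.assoc flip: exp_sum sum_negf)
  also have "\<dots> = (\<Prod>a\<in>UNIV. \<integral>x. exp (- (k * lam a * x)) \<partial>chi2_1)"
    by (rule chi2s.product_integral_prod) (use i2 in auto)
  also have "\<dots> = (\<Prod>a\<in>UNIV. \<integral>x. exp (- (k * lam a * x\<^sup>2)) \<partial>std_normal_distribution)"
    unfolding chi2_1_def by (subst integral_distr) auto
  also have "\<dots> = (\<integral>z. (\<Prod>a\<in>UNIV. exp (- (k * lam a * (z a)\<^sup>2))) \<partial>gauss)"
    by (rule gauss_integral_prod(1)[symmetric]) (rule i)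
  also have "\<dots> = (\<integral>z. exp (- (k * (\<Sum>a\<in>UNIV. lam a * (z a)\<^sup>2))) \<partial>gauss)"
    by (simp add: sum_distrib_left mult.assoc flip: exp_sum sum_negf)
  finally show ?thesis .
qed

text \<open>A single coordinate with nonzero weight is enough: with the other coordinates fixed,
  hitting x prescribes the value of that coordinate, and \<open>chi2_1\<close> has no atoms.\<close>

lemma continuous_cdf_chi2_mixture:
  fixes lam :: "'n::finite \<Rightarrow> real"
  assumes "lam c \<noteq> 0"
  shows "isCont (cdf (chi2_mixture lam)) x"
proof -
  interpret L: real_distribution "chi2_mixture lam" by (rule real_distribution_chi2_mixture)
  have null: "emeasure chi2_1 {y} = 0" for y
  proof -
    have "{z. z\<^sup>2 = y} \<subseteq> {sqrt y, - sqrt y}"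
      using real_sqrt_abs by (auto simp: abs_if split: if_splits)
    then have "finite {z. z\<^sup>2 = y}" using finite_subset by blast
    from AE_not_in[OF finite_imp_null_set_lborel[OF this]]
    have "AE z in lborel. z\<^sup>2 \<noteq> y" by simp
    then have "AE z in std_normal_distribution. z\<^sup>2 \<noteq> y"
      by (subst AE_density) auto
    then have "AE u in chi2_1. u \<noteq> y"
      unfolding chi2_1_def by (subst AE_distr_iff) auto
    then show ?thesis by (subst (asm) AE_iff_measurable[of "{y}"]) auto
  qed
  let ?I = "UNIV - {c}"
  have U: "(UNIV :: 'n set) = insert c ?I" by auto
  let ?f = "\<lambda>b. indicator {x} (\<Sum>a\<in>UNIV. lam a * b a) :: ennreal"
  have fm: "?f \<in> borel_measurable (Pi\<^sub>M (UNIV :: 'n set) (\<lambda>_. chi2_1))"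
    by measurable
  have "emeasure (chi2_mixture lam) {x} = (\<integral>\<^sup>+u. indicator {x} u \<partial>chi2_mixture lam)" by simp
  also have "\<dots> = (\<integral>\<^sup>+b. ?f b \<partial>Pi\<^sub>M (UNIV :: 'n set) (\<lambda>_. chi2_1))"
    unfolding chi2_mixture_def by (subst nn_integral_distr) auto
  also have "\<dots> = (\<integral>\<^sup>+b. ?f b \<partial>Pi\<^sub>M (insert c ?I) (\<lambda>_. chi2_1))" by (subst U) (rule refl)
  also have "\<dots> = (\<integral>\<^sup>+b. (\<integral>\<^sup>+y. ?f (b(c := y)) \<partial>chi2_1) \<partial>Pi\<^sub>M ?I (\<lambda>_. chi2_1))"
    by (rule chi2s.product_nn_integral_insert) (use fm U in auto)
  also have "\<dots> = (\<integral>\<^sup>+b. 0 \<partial>Pi\<^sub>M ?I (\<lambda>_. chi2_1))"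
  proof (intro nn_integral_cong)
    fix b
    let ?r = "\<Sum>a\<in>?I. lam a * b a"
    have "(\<Sum>a\<in>UNIV. lam a * (b(c := y)) a) = lam c * y + ?r" for y
      by (subst U, subst sum.insert) (auto intro!: sum.cong)
    then have "?f (b(c := y)) = indicator {(x - ?r) / lam c} y" for y
      using assms by (auto simp: indicator_def field_simps)
    then show "(\<integral>\<^sup>+y. ?f (b(c := y)) \<partial>chi2_1) = 0" using null by simp
  qed
  finally have "L.prob {x} = 0" by (simp add: measure_def)
  then show ?thesis by (simp add: L.isCont_cdf)
qed

theorem laplace_quadratic_form_tendsto:
  fixes \<zeta> :: "'i \<Rightarrow> 'j \<Rightarrow> 'b \<Rightarrow> real ^ 'n::finite" and V R :: "real ^ 'n ^ 'n"
  assumes M: "\<And>i. prob_space (M i)" and J: "\<And>i. finite (J i)"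
    and ind: "\<And>i. prob_space.indep_vars (M i) (\<lambda>_. borel) (\<zeta> i) (J i)"
    and b: "\<And>i j x. j \<in> J i \<Longrightarrow> x \<in> space (M i) \<Longrightarrow> norm (\<zeta> i j x) \<le> b i j" "\<And>i j. j \<in> J i \<Longrightarrow> 0 \<le> b i j"
    and mean: "\<And>i j t. j \<in> J i \<Longrightarrow> (\<integral>x. t \<bullet> \<zeta> i j x \<partial>M i) = 0"
    and V: "psd V"
    and s: "\<And>i t. \<bar>(\<Sum>j\<in>J i. \<integral>x. (t \<bullet> \<zeta> i j x)\<^sup>2 \<partial>M i) - t \<bullet> (V *v t)\<bar> \<le> s i * (norm t)\<^sup>2" "\<And>i. 0 \<le> s i"
    and lim: "(s \<longlongrightarrow> 0) F" "((\<lambda>i. \<Sum>j\<in>J i. b i j ^ 3 + b i j ^ 4) \<longlongrightarrow> 0) F"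
    and R: "R ** V ** transpose R = diagm lam" "\<And>a. 0 \<le> lam a" and k: "0 \<le> k"
  shows "((\<lambda>i. \<integral>x. exp (- (k * (norm (R *v (\<Sum>j\<in>J i. \<zeta> i j x)))\<^sup>2)) \<partial>M i)
     \<longlongrightarrow> (\<integral>u. exp (- (k * u)) \<partial>chi2_mixture lam)) F"
proof -
  \<comment> \<open>The general bound treats exp (- w^2 / 2); the factor sqrt (2 k) turns this into
    the Laplace transform at k.\<close>
  define R' where "R' = sqrt (2 * k) *\<^sub>R R"
  define \<tau> where "\<tau> z = transpose R' *v (\<chi> a. z a)" for z :: "'n \<Rightarrow> real"
  let ?C = "\<integral>z. (1 + norm (\<tau> z)) ^ 4 \<partial>gauss"
  have n: "(norm (R' *v y))\<^sup>2 / 2 = k * (norm (R *v y))\<^sup>2" for y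
    using k by (simp add: R'_def power_mult_distrib flip: scaleR_matrix_vector_assoc)
  have q: "\<tau> z \<bullet> (V *v \<tau> z) / 2 = k * (\<Sum>a\<in>UNIV. lam a * (z a)\<^sup>2)" for z
  proof -
    let ?z = "\<chi> a. z a"
    have "\<tau> z = sqrt (2 * k) *\<^sub>R (transpose R *v ?z)"
      by (simp add: \<tau>_def R'_def transpose_scalar del: transpose_matrix_vector flip: scaleR_matrix_vector_assoc)
    then have "\<tau> z \<bullet> (V *v \<tau> z) = 2 * k * ((transpose R *v ?z) \<bullet> (V *v (transpose R *v ?z)))"
      using k by (simp add: matrix_vector_mult_scaleR del: transpose_matrix_vector)
    also have "(transpose R *v ?z) \<bullet> (V *v (transpose R *v ?z)) = ?z \<bullet> ((R ** V ** transpose R) *v ?z)"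
      by (simp only: inner_transpose flip: matrix_vector_mul_assoc)
    also have "\<dots> = (\<Sum>a\<in>UNIV. lam a * (z a)\<^sup>2)"
      by (simp add: R(1) inner_vec_def diagm_vec power2_eq_square mult_ac)
    finally show ?thesis by simp
  qed
  have "((\<lambda>i. ?C * ((\<Sum>j\<in>J i. b i j ^ 3 + b i j ^ 4) + s i)) \<longlongrightarrow> ?C * (0 + 0)) F"
    by (intro tendsto_intros lim)
  then have z: "((\<lambda>i. ?C * ((\<Sum>j\<in>J i. b i j ^ 3 + b i j ^ 4) + s i)) \<longlongrightarrow> 0) F" by simp
  have "\<bar>(\<integral>x. exp (- (k * (norm (R *v (\<Sum>j\<in>J i. \<zeta> i j x)))\<^sup>2)) \<partial>M i) - (\<integral>u. exp (- (k * u)) \<partial>chi2_mixture lam)\<bar>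
     \<le> ?C * ((\<Sum>j\<in>J i. b i j ^ 3 + b i j ^ 4) + s i)" for i
    using prob_space.laplace_quadratic_bound[OF M J ind b mean V s, of i R']
    unfolding n \<tau>_def[symmetric] q laplace_chi2_mixture[OF R(2) k] .
  then have "((\<lambda>i. (\<integral>x. exp (- (k * (norm (R *v (\<Sum>j\<in>J i. \<zeta> i j x)))\<^sup>2)) \<partial>M i) - (\<integral>u. exp (- (k * u)) \<partial>chi2_mixture lam)) \<longlongrightarrow> 0) F"
    by (intro Lim_null_comparison[OF always_eventually z]) auto
  then show ?thesis by (rule LIM_zero_cancel)
qed

section \<open>Convergence in probability as convergence along a filter\<close>

subsection \<open>Stochastic convergence without measurability\<close>

text \<open>\<open>big n \<delta> P\<close> says that at stage \<open>n\<close> the property \<open>P\<close> holds outside a set of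
  probability at most \<open>\<delta>\<close>. The two instances are the law of the data (inner probability)
  and the conditional law of the bootstrap sample given the data (conditional probability at
  least \<open>1 - \<delta>\<close>, on a data event of inner probability at least \<open>1 - \<delta>\<close>). In both cases
  convergence in probability is convergence along a filter.\<close>

locale large_events =
  fixes big :: "nat \<Rightarrow> real \<Rightarrow> ('x \<Rightarrow> bool) \<Rightarrow> bool"
  assumes big_True: "0 < \<delta> \<Longrightarrow> big n \<delta> (\<lambda>_. True)"
    and big_mono: "big n \<delta> P \<Longrightarrow> (\<And>x. P x \<Longrightarrow> Q x) \<Longrightarrow> big n \<delta> Q"
    and big_conj: "big n \<delta> P \<Longrightarrow> big n \<epsilon> Q \<Longrightarrow> big n (\<delta> + \<epsilon>) (\<lambda>x. P x \<and> Q x)"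
begin

definition LF :: "(nat \<times> 'x) filter" where
  "LF = Abs_filter (\<lambda>P. \<forall>\<delta>>0. \<forall>\<^sub>F n in sequentially. big n \<delta> (\<lambda>x. P (n, x)))"

lemma eventually_LF: "eventually P LF \<longleftrightarrow> (\<forall>\<delta>>0. \<forall>\<^sub>F n in sequentially. big n \<delta> (\<lambda>x. P (n, x)))"
  unfolding LF_def
proof (rule eventually_Abs_filter, rule is_filter.intro)
  show "\<forall>\<delta>>0. \<forall>\<^sub>F n in sequentially. big n \<delta> (\<lambda>x. True)" by (simp add: big_True)
next
  fix P Q :: "nat \<times> 'x \<Rightarrow> bool"
  assume P: "\<forall>\<delta>>0. \<forall>\<^sub>F n in sequentially. big n \<delta> (\<lambda>x. P (n, x))"
    and Q: "\<forall>\<delta>>0. \<forall>\<^sub>F n in sequentially. big n \<delta> (\<lambda>x. Q (n, x))"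
  show "\<forall>\<delta>>0. \<forall>\<^sub>F n in sequentially. big n \<delta> (\<lambda>x. P (n, x) \<and> Q (n, x))"
  proof (intro allI impI)
    fix \<delta> :: real assume "\<delta> > 0"
    then have "\<forall>\<^sub>F n in sequentially. big n (\<delta>/2) (\<lambda>x. P (n, x))" "\<forall>\<^sub>F n in sequentially. big n (\<delta>/2) (\<lambda>x. Q (n, x))"
      using P[rule_format, of "\<delta>/2"] Q[rule_format, of "\<delta>/2"] by auto
    then show "\<forall>\<^sub>F n in sequentially. big n \<delta> (\<lambda>x. P (n, x) \<and> Q (n, x))"
    proof eventually_elim
      case (elim n)
      from big_conj[OF this] show ?case by simp
    qed
  qed
next
  fix P Q :: "nat \<times> 'x \<Rightarrow> bool"
  assume PQ: "\<forall>x. P x \<longrightarrow> Q x" and P: "\<forall>\<delta>>0. \<forall>\<^sub>F n in sequentially. big n \<delta> (\<lambda>x. P (n, x))"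
  show "\<forall>\<delta>>0. \<forall>\<^sub>F n in sequentially. big n \<delta> (\<lambda>x. Q (n, x))"
  proof (intro allI impI)
    fix \<delta> :: real assume "\<delta> > 0"
    with P have "\<forall>\<^sub>F n in sequentially. big n \<delta> (\<lambda>x. P (n, x))" by simp
    then show "\<forall>\<^sub>F n in sequentially. big n \<delta> (\<lambda>x. Q (n, x))"
      by (rule eventually_mono) (rule big_mono, assumption, use PQ in simp)
  qed
qed

lemma filterlim_fst_LF: "filterlim fst sequentially LF"
  unfolding filterlim_iff eventually_LF
proof (intro allI impI)
  fix P :: "nat \<Rightarrow> bool" and \<delta> :: real
  assume P: "eventually P sequentially" and \<delta>: "\<delta> > 0"
  show "\<forall>\<^sub>F n in sequentially. big n \<delta> (\<lambda>x. P (fst (n, x)))"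
    using P by (rule eventually_mono) (simp add: big_True \<delta>)
qed

lemma tendsto_LF_det: "(a \<longlonglongrightarrow> c) \<Longrightarrow> ((\<lambda>p. a (fst p)) \<longlongrightarrow> c) LF"
  by (rule filterlim_compose[OF _ filterlim_fst_LF])

lemma eventually_LF_det: "eventually P sequentially \<Longrightarrow> eventually (\<lambda>p. P (fst p)) LF"
  using filterlim_fst_LF by (simp add: filterlim_iff)

definition tight :: "(nat \<times> 'x \<Rightarrow> real) \<Rightarrow> bool" where
  "tight V \<longleftrightarrow> (\<forall>\<delta>>0. \<exists>K. \<forall>\<^sub>F n in sequentially. big n \<delta> (\<lambda>x. \<bar>V (n, x)\<bar> \<le> K))"

text \<open>Lets a property be proved under a bound \<open>K\<close> on \<open>V\<close>, for every
  \<open>K\<close> separately: half of the exceptional probability pays for the bound.\<close>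

lemma tight_LF:
  assumes "tight V" "\<And>K. eventually (\<lambda>p. \<bar>V p\<bar> \<le> K \<longrightarrow> P p) LF"
  shows "eventually P LF"
  unfolding eventually_LF
proof (intro allI impI)
  fix \<delta> :: real assume \<delta>: "\<delta> > 0"
  then obtain K where K: "\<forall>\<^sub>F n in sequentially. big n (\<delta>/2) (\<lambda>x. \<bar>V (n, x)\<bar> \<le> K)"
    using assms(1)[unfolded tight_def, rule_format, of "\<delta>/2"] \<delta> by auto
  have "\<forall>\<^sub>F n in sequentially. big n (\<delta>/2) (\<lambda>x. \<bar>V (n, x)\<bar> \<le> K \<longrightarrow> P (n, x))"
    using assms(2)[of K, unfolded eventually_LF, rule_format, of "\<delta>/2"] \<delta> by simp
  with K show "\<forall>\<^sub>F n in sequentially. big n \<delta> (\<lambda>x. P (n, x))"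
  proof eventually_elim
    case (elim n)
    from big_conj[OF this] have "big n \<delta> (\<lambda>x. \<bar>V (n, x)\<bar> \<le> K \<and> (\<bar>V (n, x)\<bar> \<le> K \<longrightarrow> P (n, x)))" by simp
    then show ?case by (rule big_mono) blast
  qed
qed

lemma tight_binary:
  assumes "tight U" "tight V" "\<And>K L. \<exists>B. \<forall>u v. \<bar>u\<bar> \<le> K \<longrightarrow> \<bar>v\<bar> \<le> L \<longrightarrow> \<bar>f u v\<bar> \<le> B"
  shows "tight (\<lambda>p. f (U p) (V p))"
  unfolding tight_def
proof (intro allI impI)
  fix \<delta> :: real assume \<delta>: "\<delta> > 0"
  obtain K where K: "\<forall>\<^sub>F n in sequentially. big n (\<delta>/2) (\<lambda>x. \<bar>U (n, x)\<bar> \<le> K)"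
    using assms(1)[unfolded tight_def, rule_format, of "\<delta>/2"] \<delta> by auto
  obtain L where L: "\<forall>\<^sub>F n in sequentially. big n (\<delta>/2) (\<lambda>x. \<bar>V (n, x)\<bar> \<le> L)"
    using assms(2)[unfolded tight_def, rule_format, of "\<delta>/2"] \<delta> by auto
  obtain B where B: "\<forall>u v. \<bar>u\<bar> \<le> K \<longrightarrow> \<bar>v\<bar> \<le> L \<longrightarrow> \<bar>f u v\<bar> \<le> B" using assms(3) by blast
  from K L have "\<forall>\<^sub>F n in sequentially. big n \<delta> (\<lambda>x. \<bar>f (U (n, x)) (V (n, x))\<bar> \<le> B)"
  proof eventually_elim
    case (elim n)
    from big_conj[OF this] have "big n \<delta> (\<lambda>x. \<bar>U (n, x)\<bar> \<le> K \<and> \<bar>V (n, x)\<bar> \<le> L)" by simp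
    then show ?case by (rule big_mono) (use B in blast)
  qed
  then show "\<exists>K. \<forall>\<^sub>F n in sequentially. big n \<delta> (\<lambda>x. \<bar>f (U (n, x)) (V (n, x))\<bar> \<le> K)" ..
qed

lemma tight_add:
  assumes "tight U" "tight V" shows "tight (\<lambda>p. U p + V p)"
  using assms
proof (rule tight_binary[where f = "(+)"])
  fix K L :: real
  have "\<bar>u + v\<bar> \<le> K + L" if "\<bar>u\<bar> \<le> K" "\<bar>v\<bar> \<le> L" for u v :: real
    using that by linarith
  then show "\<exists>B. \<forall>u v. \<bar>u\<bar> \<le> K \<longrightarrow> \<bar>v\<bar> \<le> L \<longrightarrow> \<bar>u + v\<bar> \<le> B" by blast
qed

lemma tight_mult:
  assumes "tight U" "tight V" shows "tight (\<lambda>p. U p * V p)"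
  using assms
proof (rule tight_binary[where f = "(*)"])
  fix K L :: real
  have "\<bar>u * v\<bar> \<le> \<bar>K\<bar> * \<bar>L\<bar>" if "\<bar>u\<bar> \<le> K" "\<bar>v\<bar> \<le> L" for u v :: real
    unfolding abs_mult using that by (intro mult_mono) auto
  then show "\<exists>B. \<forall>u v. \<bar>u\<bar> \<le> K \<longrightarrow> \<bar>v\<bar> \<le> L \<longrightarrow> \<bar>u * v\<bar> \<le> B" by blast
qed

lemma tendsto_imp_tight:
  assumes "(V \<longlongrightarrow> c) LF" shows "tight V"
  unfolding tight_def
proof (intro allI impI)
  fix \<delta> :: real assume \<delta>: "\<delta> > 0"
  have "eventually (\<lambda>p. dist (V p) c < 1) LF" using assms by (rule tendstoD) simp
  then have "\<forall>\<^sub>F n in sequentially. big n \<delta> (\<lambda>x. dist (V (n, x)) c < 1)"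
    using \<delta> by (simp add: eventually_LF)
  then show "\<exists>K. \<forall>\<^sub>F n in sequentially. big n \<delta> (\<lambda>x. \<bar>V (n, x)\<bar> \<le> K)"
    by (intro exI[of _ "\<bar>c\<bar> + 1"], elim eventually_mono big_mono) (auto simp: dist_real_def)
qed

lemma tight_mult_null:
  assumes U: "tight U" and V: "(V \<longlongrightarrow> 0) LF"
  shows "((\<lambda>p. U p * V p) \<longlongrightarrow> 0) LF"
proof (rule tendstoI)
  fix e :: real assume e: "e > 0"
  show "eventually (\<lambda>p. dist (U p * V p) 0 < e) LF"
  proof (rule tight_LF[OF U])
    fix K
    have "eventually (\<lambda>p. dist (V p) 0 < e / (\<bar>K\<bar> + 1)) LF"
      using V by (rule tendstoD) (use e in auto)
    then show "eventually (\<lambda>p. \<bar>U p\<bar> \<le> K \<longrightarrow> dist (U p * V p) 0 < e) LF"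
    proof eventually_elim
      case (elim p)
      show ?case
      proof
        assume "\<bar>U p\<bar> \<le> K"
        then have "\<bar>U p * V p\<bar> \<le> \<bar>K\<bar> * \<bar>V p\<bar>" unfolding abs_mult by (intro mult_right_mono) auto
        also have "\<dots> \<le> (\<bar>K\<bar> + 1) * \<bar>V p\<bar>" by (intro mult_right_mono) auto
        also have "\<dots> < e" using elim by (simp add: field_simps)
        finally show "dist (U p * V p) 0 < e" by simp
      qed
    qed
  qed
qed

lemma slutsky_quadratic_form:
  fixes Y Z :: "nat \<times> 'x \<Rightarrow> real ^ 'n::finite" and G :: "nat \<times> 'x \<Rightarrow> real ^ 'n ^ 'n"
  assumes YZ: "\<And>a. ((\<lambda>p. Y p $ a - Z p $ a) \<longlongrightarrow> 0) LF" and Z: "\<And>a. tight (\<lambda>p. Z p $ a)"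
    and G: "(G \<longlongrightarrow> \<Gamma>) LF"
  shows "((\<lambda>p. Y p \<bullet> (G p *v Y p) - Z p \<bullet> (\<Gamma> *v Z p)) \<longlongrightarrow> 0) LF"
proof -
  have Y: "tight (\<lambda>p. Y p $ a)" for a
    using tight_add[OF Z tendsto_imp_tight[OF YZ], of a a] by simp
  have Gc: "((\<lambda>p. G p $ a $ b) \<longlongrightarrow> \<Gamma> $ a $ b) LF" for a b
    by (intro tendsto_intros G)
  \<comment> \<open>A telescoping sum: the three factors are replaced one at a time, and each term
    is a tight factor times a null factor.\<close>
  have "((\<lambda>p. (G p $ a $ b * Y p $ b) * (Y p $ a - Z p $ a) + (Z p $ a * Y p $ b) * (G p $ a $ b - \<Gamma> $ a $ b)
      + (Z p $ a * \<Gamma> $ a $ b) * (Y p $ b - Z p $ b)) \<longlongrightarrow> 0) LF" for a b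
  proof (intro tendsto_add_zero tight_mult_null tight_mult Y Z YZ)
    show "tight (\<lambda>p. G p $ a $ b)" by (rule tendsto_imp_tight[OF Gc])
    show "((\<lambda>p. G p $ a $ b - \<Gamma> $ a $ b) \<longlongrightarrow> 0) LF" using Gc by (rule LIM_zero)
    show "tight (\<lambda>p. \<Gamma> $ a $ b)" by (rule tendsto_imp_tight[OF tendsto_const])
  qed
  moreover have "(G p $ a $ b * Y p $ b) * (Y p $ a - Z p $ a) + (Z p $ a * Y p $ b) * (G p $ a $ b - \<Gamma> $ a $ b)
      + (Z p $ a * \<Gamma> $ a $ b) * (Y p $ b - Z p $ b)
    = Y p $ a * (G p $ a $ b * Y p $ b) - Z p $ a * (\<Gamma> $ a $ b * Z p $ b)" for p a b
    by (simp add: algebra_simps)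
  ultimately have "((\<lambda>p. Y p $ a * (G p $ a $ b * Y p $ b) - Z p $ a * (\<Gamma> $ a $ b * Z p $ b)) \<longlongrightarrow> 0) LF" for a b
    by simp
  then have "((\<lambda>p. \<Sum>a\<in>UNIV. \<Sum>b\<in>UNIV. Y p $ a * (G p $ a $ b * Y p $ b) - Z p $ a * (\<Gamma> $ a $ b * Z p $ b)) \<longlongrightarrow> 0) LF"
    by (intro tendsto_null_sum)
  then show ?thesis
    by (simp add: inner_vec_def matrix_vector_mult_def sum_distrib_left sum_subtractf)
qed

text \<open>Here \<open>V\<close> will be a normalized empirical quantile, \<open>W\<close> its linearization and \<open>D y\<close> a
  normalized increment of the empirical distribution function.\<close>

lemma ghosh:
  assumes dual: "\<And>y. eventually (\<lambda>p. V p \<le> y \<longleftrightarrow> W p \<le> D y p) LF"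
    and D: "\<And>y. (D y \<longlongrightarrow> y) LF" and W: "tight W"
  shows "((\<lambda>p. V p - W p) \<longlongrightarrow> 0) LF"
proof (rule tendstoI)
  fix e' :: real assume "e' > 0"
  define e where "e = e' / 3"
  have e: "e > 0" using \<open>e' > 0\<close> by (simp add: e_def)
  show "eventually (\<lambda>p. dist (V p - W p) 0 < e') LF"
  proof (rule tight_LF[OF W])
    fix K
    \<comment> \<open>Whenever \<open>W\<close> is bounded by K, the grid of mesh e contains the
      points one step beyond the roundings of W / e. It is finite and independent of the outcome, so
      \<open>dual\<close> and \<open>D\<close> hold at all its points at once.\<close>
    define m where "m = \<lceil>K / e\<rceil> + 2"
    define Y where "Y = (\<lambda>i. of_int i * e) ` {-m..m}"
    have "finite Y" by (simp add: Y_def)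
    then have "eventually (\<lambda>p. \<forall>y\<in>Y. (V p \<le> y \<longleftrightarrow> W p \<le> D y p) \<and> dist (D y p) y < e) LF"
      by (intro eventually_ball_finite ballI eventually_conj dual tendstoD[OF D] e)
    then show "eventually (\<lambda>p. \<bar>W p\<bar> \<le> K \<longrightarrow> dist (V p - W p) 0 < e') LF"
    proof eventually_elim
      case (elim p)
      show ?case
      proof
        assume K: "\<bar>W p\<bar> \<le> K"
        define w where "w = W p / e"
        have w: "W p = w * e" using e by (simp add: w_def)
        have "\<bar>w\<bar> \<le> K / e" using K e by (simp add: w_def divide_right_mono abs_divide)
        then have r: "\<lceil>w\<rceil> + 1 \<in> {-m..m}" "\<lfloor>w\<rfloor> - 1 \<in> {-m..m}"
          unfolding m_def by (simp_all, linarith+)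
        \<comment> \<open>\<open>y1\<close> and \<open>y2\<close> lie between e and 2 e above and
          below \<open>W\<close>. The margin e absorbs the error of \<open>D\<close>, so V lies
          between them and differs from W by at most 2 e, which is less than e'.\<close>
        define y1 where "y1 = (of_int (\<lceil>w\<rceil> + 1) :: real) * e"
        define y2 where "y2 = (of_int (\<lfloor>w\<rfloor> - 1) :: real) * e"
        have "y1 \<in> Y" "y2 \<in> Y" using r unfolding Y_def y1_def y2_def by blast+
        then have d: "V p \<le> y1 \<longleftrightarrow> W p \<le> D y1 p" "\<bar>D y1 p - y1\<bar> < e" "V p \<le> y2 \<longleftrightarrow> W p \<le> D y2 p" "\<bar>D y2 p - y2\<bar> < e"
          using elim unfolding dist_real_def by blast+
        have "w + 1 \<le> of_int (\<lceil>w\<rceil> + 1)" "of_int (\<lceil>w\<rceil> + 1) \<le> w + 2"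
          "of_int (\<lfloor>w\<rfloor> - 1) \<le> w - 1" "w - 2 \<le> of_int (\<lfloor>w\<rfloor> - 1)" by linarith+
        then have "(w + 1) * e \<le> y1" "y1 \<le> (w + 2) * e" "y2 \<le> (w - 1) * e" "(w - 2) * e \<le> y2"
          unfolding y1_def y2_def using e by (simp_all only: mult_right_mono less_imp_le)
        then have y: "W p + e \<le> y1" "y1 \<le> W p + 2 * e" "y2 \<le> W p - e" "W p - 2 * e \<le> y2"
          unfolding w by (simp_all add: algebra_simps)
        have "V p \<le> y1" using d(1,2) y(1) by linarith
        moreover have "\<not> V p \<le> y2" using d(3,4) y(3) by linarith
        ultimately show "dist (V p - W p) 0 < e'" using y e unfolding e_def dist_real_def by linarith
      qed
    qed
  qed
qed

end

section \<open>Second moments of group means, for the data and the bootstrap alike\<close>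

subsection \<open>Means of independent observations\<close>

text \<open>\<open>v\<close> bounds the uncentred second moment, which dominates the variance. For a
  difference of two threshold indicators it is simply an increment of a distribution
  function.\<close>

lemma (in prob_space) variance_mean_le:
  fixes Z :: "'j \<Rightarrow> 'a \<Rightarrow> real"
  assumes J: "finite J" "J \<noteq> {}" and ind: "indep_vars (\<lambda>_. borel) Z J"
    and b: "\<And>j x. j \<in> J \<Longrightarrow> x \<in> space M \<Longrightarrow> \<bar>Z j x\<bar> \<le> B"
    and mean: "\<And>j. j \<in> J \<Longrightarrow> expectation (Z j) = c"
    and v: "\<And>j. j \<in> J \<Longrightarrow> expectation (\<lambda>x. (Z j x)\<^sup>2) \<le> v"
  shows "expectation (\<lambda>x. (\<Sum>j\<in>J. Z j x) / card J) = c"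
    and "expectation (\<lambda>x. ((\<Sum>j\<in>J. Z j x) / card J - c)\<^sup>2) \<le> v / card J"
proof -
  have n: "card J > 0" using J by (simp add: card_gt_0_iff)
  have m[measurable]: "Z j \<in> borel_measurable M" if "j \<in> J" for j
    using ind that by (auto simp: indep_vars_def)
  have iZ: "integrable M (Z j)" if "j \<in> J" for j
    by (rule integrable_bounded[where B = B]) (use b m that in auto)
  show "expectation (\<lambda>x. (\<Sum>j\<in>J. Z j x) / card J) = c"
    using n by (simp add: iZ mean)
  define U where "U j x = Z j x - c" for j x
  have indU: "indep_vars (\<lambda>_. borel) U J"
    unfolding U_def by (rule indep_vars_compose2[OF ind]) simp
  have bU: "\<bar>U j x\<bar> \<le> B + \<bar>c\<bar>" if "j \<in> J" "x \<in> space M" for j x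
    using b[OF that] by (simp add: U_def)
  have mU: "U j \<in> borel_measurable M" if "j \<in> J" for j using that by (simp add: U_def[abs_def])
  have iU: "integrable M (U j)" if "j \<in> J" for j
    by (rule integrable_bounded[where B = "B + \<bar>c\<bar>"]) (use bU mU that in auto)
  have eU: "expectation (U j) = 0" if "j \<in> J" for j
    using that by (simp add: U_def[abs_def] iZ mean prob_space)
  have iUU: "integrable M (\<lambda>x. U j x * U k x)" if "j \<in> J" "k \<in> J" for j k
  proof (rule integrable_bounded[where B = "(B + \<bar>c\<bar>) * (B + \<bar>c\<bar>)"])
    show "(\<lambda>x. U j x * U k x) \<in> borel_measurable M" using mU that by simp
    have "norm (U j x * U k x) \<le> (B + \<bar>c\<bar>) * (B + \<bar>c\<bar>)" if "x \<in> space M" for x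
      using bU[OF \<open>j \<in> J\<close> that] bU[OF \<open>k \<in> J\<close> that] unfolding real_norm_def abs_mult by (intro mult_mono) auto
    then show "AE x in M. norm (U j x * U k x) \<le> (B + \<bar>c\<bar>) * (B + \<bar>c\<bar>)" by auto
  qed
  have eUU: "expectation (\<lambda>x. U j x * U k x) = (if j = k then expectation (\<lambda>x. (U j x)\<^sup>2) else 0)"
    if "j \<in> J" "k \<in> J" for j k
  proof (cases "j = k")
    case False
    have "indep_vars (\<lambda>_. borel) U {j, k}" by (rule indep_vars_subset[OF indU]) (use that in auto)
    then have "expectation (\<lambda>x. \<Prod>i\<in>{j, k}. U i x) = (\<Prod>i\<in>{j, k}. expectation (U i))"
      by (intro indep_vars_lebesgue_integral) (use iU that in auto)
    then show ?thesis using False eU that by simp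
  qed (simp add: power2_eq_square)
  have vU: "expectation (\<lambda>x. (U j x)\<^sup>2) \<le> v" if "j \<in> J" for j
  proof -
    have "expectation (\<lambda>x. (U j x)\<^sup>2) = variance (Z j)" using mean[OF that] by (simp add: U_def)
    also have "\<dots> = expectation (\<lambda>x. (Z j x)\<^sup>2) - c\<^sup>2"
    proof (subst variance_eq)
      show "integrable M (\<lambda>x. (Z j x)\<^sup>2)"
      proof (rule integrable_bounded[where B = "B\<^sup>2"])
        show "(\<lambda>x. (Z j x)\<^sup>2) \<in> borel_measurable M" using m[OF that] by simp
        have "norm ((Z j x)\<^sup>2) \<le> B\<^sup>2" if "x \<in> space M" for x
          using power_mono[OF b[OF \<open>j \<in> J\<close> that] abs_ge_zero, of 2] by simp
        then show "AE x in M. norm ((Z j x)\<^sup>2) \<le> B\<^sup>2" by auto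
      qed
    qed (use iZ that mean in auto)
    also have "\<dots> \<le> v" using v[OF that] by (smt (verit) zero_le_power2)
    finally show ?thesis .
  qed
  have "(\<Sum>j\<in>J. Z j x) / card J - c = (\<Sum>j\<in>J. U j x) / card J" for x
    using n by (simp add: U_def sum_subtractf divide_simps)
  then have "expectation (\<lambda>x. ((\<Sum>j\<in>J. Z j x) / card J - c)\<^sup>2) = expectation (\<lambda>x. (\<Sum>j\<in>J. \<Sum>k\<in>J. U j x * U k x) / (card J)\<^sup>2)"
    by (simp add: power_divide power2_eq_square sum_product)
  also have "\<dots> = (\<Sum>j\<in>J. \<Sum>k\<in>J. expectation (\<lambda>x. U j x * U k x)) / (card J)\<^sup>2"
    by (simp add: iUU)
  also have "(\<Sum>j\<in>J. \<Sum>k\<in>J. expectation (\<lambda>x. U j x * U k x)) = (\<Sum>j\<in>J. expectation (\<lambda>x. (U j x)\<^sup>2))"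
    using J by (intro sum.cong refl) (simp add: eUU)
  also have "\<dots> / (card J)\<^sup>2 \<le> (card J * v) / (card J)\<^sup>2"
    by (intro divide_right_mono order_trans[OF sum_mono[OF vU]]) auto
  also have "\<dots> = v / card J" using n by (simp add: power2_eq_square)
  finally show "expectation (\<lambda>x. ((\<Sum>j\<in>J. Z j x) / card J - c)\<^sup>2) \<le> v / card J" .
qed

lemma obs_index_eq: "obs_index n = (SIGMA i:UNIV. {..<n i})"
  by (auto simp: obs_index_def)

lemma finite_obs_index [simp]: "finite (obs_index (n :: 'g::finite \<Rightarrow> nat))"
  by (simp add: obs_index_eq)

definition gmean :: "nat \<Rightarrow> (nat \<Rightarrow> 'b \<Rightarrow> 'v) \<Rightarrow> ('v \<Rightarrow> real) \<Rightarrow> 'b \<Rightarrow> real" where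
  "gmean m \<xi> g x = (\<Sum>j<m. g (\<xi> j x)) / real m"

text \<open>It is interpreted twice: with the observations under their joint law, where \<mu> is the
  family of population laws, and with the coordinates of the bootstrap sample under
  \<open>boot_pmf\<close>, where \<mu> is the family of empirical laws. Every estimate below
  therefore holds at both levels.\<close>

locale group_sample = prob_space M for M :: "'b measure" +
  fixes \<xi> :: "'g::finite \<Rightarrow> nat \<Rightarrow> 'b \<Rightarrow> real ^ 'c::finite" and n :: "'g \<Rightarrow> nat"
    and \<mu> :: "'g \<Rightarrow> (real ^ 'c) measure"
  assumes indep: "indep_vars (\<lambda>_. borel) (\<lambda>(i, j). \<xi> i j) (obs_index n)"
    and law: "\<And>i j. j < n i \<Longrightarrow> distr M borel (\<xi> i j) = \<mu> i"
    and n_pos: "\<And>i. 0 < n i"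
begin

lemma measurable_obs: "j < n i \<Longrightarrow> \<xi> i j \<in> borel_measurable M"
  using indep by (auto simp: indep_vars_def obs_index_def)

lemma law_prob_space: "prob_space (\<mu> i)"
  using prob_space_distr[OF measurable_obs[OF n_pos, of i]] unfolding law[OF n_pos] .

lemma sets_law: "sets (\<mu> i) = sets borel"
  using sets_distr[of M borel "\<xi> i 0"] unfolding law[OF n_pos] .

lemma expectation_obs:
  fixes g :: "real ^ 'c \<Rightarrow> real"
  assumes "j < n i" "g \<in> borel_measurable borel"
  shows "expectation (\<lambda>x. g (\<xi> i j x)) = (\<integral>y. g y \<partial>\<mu> i)"
  unfolding law[OF assms(1), symmetric] using assms measurable_obs by (subst integral_distr) auto

lemma gmean_moments:
  fixes g :: "real ^ 'c \<Rightarrow> real"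
  assumes g: "g \<in> borel_measurable borel" and B: "\<And>y. \<bar>g y\<bar> \<le> B"
  shows "expectation (gmean (n i) (\<xi> i) g) = (\<integral>y. g y \<partial>\<mu> i)"
    "expectation (\<lambda>x. (gmean (n i) (\<xi> i) g x - (\<integral>y. g y \<partial>\<mu> i))\<^sup>2) \<le> (\<integral>y. (g y)\<^sup>2 \<partial>\<mu> i) / n i"
proof -
  let ?J = "Pair i ` {..<n i}"
  have "indep_vars (\<lambda>_. borel) (\<lambda>p. case p of (i, j) \<Rightarrow> \<xi> i j) ?J"
    by (rule indep_vars_subset[OF indep]) (auto simp: obs_index_def)
  then have ind: "indep_vars (\<lambda>_. borel) (\<lambda>p x. g ((case p of (i, j) \<Rightarrow> \<xi> i j) x)) ?J"
    by (rule indep_vars_compose2) (use g in simp)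
  have sq: "(\<lambda>y. (g y)\<^sup>2) \<in> borel_measurable borel" using g by simp
  have inj: "inj_on (Pair i) {..<n i}" by (simp add: inj_on_def)
  have J: "finite ?J" "?J \<noteq> {}" using n_pos[of i] by (auto simp: lessThan_empty_iff)
  have "expectation (\<lambda>x. g ((case p of (i, j) \<Rightarrow> \<xi> i j) x)) = (\<integral>y. g y \<partial>\<mu> i)"
    "expectation (\<lambda>x. (g ((case p of (i, j) \<Rightarrow> \<xi> i j) x))\<^sup>2) \<le> (\<integral>y. (g y)\<^sup>2 \<partial>\<mu> i)" if "p \<in> ?J" for p
    using that by (auto simp: expectation_obs[OF _ g] expectation_obs[OF _ sq])
  from variance_mean_le[OF J ind B this]
  show "expectation (gmean (n i) (\<xi> i) g) = (\<integral>y. g y \<partial>\<mu> i)"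
    "expectation (\<lambda>x. (gmean (n i) (\<xi> i) g x - (\<integral>y. g y \<partial>\<mu> i))\<^sup>2) \<le> (\<integral>y. (g y)\<^sup>2 \<partial>\<mu> i) / n i"
    by (simp_all add: gmean_def[abs_def] sum.reindex[OF inj] card_image[OF inj])
qed

lemma measurable_gmean [measurable]:
  assumes "g \<in> borel_measurable borel"
  shows "gmean (n i) (\<xi> i) g \<in> borel_measurable M"
proof -
  have "(\<lambda>x. g (\<xi> i j x)) \<in> borel_measurable M" if "j < n i" for j
    using measurable_compose[OF measurable_obs[OF that] assms] .
  then show ?thesis by (simp add: gmean_def[abs_def])
qed

lemma gmean_bound: "(\<And>y. \<bar>g y\<bar> \<le> B) \<Longrightarrow> \<bar>gmean (n i) (\<xi> i) g x\<bar> \<le> B"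
proof -
  assume g: "\<And>y. \<bar>g y\<bar> \<le> B"
  have "\<bar>\<Sum>j<n i. g (\<xi> i j x)\<bar> \<le> (\<Sum>j<n i. B)" by (intro sum_abs[THEN order_trans] sum_mono g)
  then show ?thesis using n_pos[of i] by (simp add: gmean_def abs_divide divide_simps mult.commute)
qed

lemma prob_gmean_close:
  fixes g :: "real ^ 'c \<Rightarrow> real" and e :: real
  assumes g: "g \<in> borel_measurable borel" and B: "\<And>y. \<bar>g y\<bar> \<le> B" and e: "e > 0"
  shows "1 - (\<integral>y. (g y)\<^sup>2 \<partial>\<mu> i) / (n i * e\<^sup>2) \<le> prob {x \<in> space M. \<bar>gmean (n i) (\<xi> i) g x - (\<integral>y. g y \<partial>\<mu> i)\<bar> < e}"
proof -
  let ?G = "gmean (n i) (\<xi> i) g" and ?c = "\<integral>y. g y \<partial>\<mu> i"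
  have [measurable]: "?G \<in> borel_measurable M" using g by (rule measurable_gmean)
  have "integrable M (\<lambda>x. (?G x)\<^sup>2)"
  proof (rule integrable_bounded[where B = "B\<^sup>2"])
    have "\<bar>?G x\<bar> \<le> B" for x by (rule gmean_bound) (rule B)
    then have "norm ((?G x)\<^sup>2) \<le> B\<^sup>2" for x
      using power_mono[of "\<bar>?G x\<bar>" B 2] by simp
    then show "AE x in M. norm ((?G x)\<^sup>2) \<le> B\<^sup>2" by auto
  qed measurable
  then have "prob {x \<in> space M. \<bar>?G x - ?c\<bar> \<ge> e} \<le> variance ?G / e\<^sup>2"
    using Chebyshev_inequality[of ?G e] e unfolding gmean_moments(1)[OF g B] by simp
  also have "\<dots> \<le> (\<integral>y. (g y)\<^sup>2 \<partial>\<mu> i) / n i / e\<^sup>2"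
    unfolding gmean_moments(1)[OF g B] by (intro divide_right_mono gmean_moments(2)[OF g B]) auto
  finally have "prob {x \<in> space M. \<bar>?G x - ?c\<bar> \<ge> e} \<le> (\<integral>y. (g y)\<^sup>2 \<partial>\<mu> i) / (n i * e\<^sup>2)" by simp
  moreover have "prob {x \<in> space M. \<bar>?G x - ?c\<bar> < e} = 1 - prob {x \<in> space M. \<bar>?G x - ?c\<bar> \<ge> e}"
    by (subst prob_compl[symmetric]) (auto intro!: arg_cong[where f = prob])
  ultimately show ?thesis by simp
qed

end

subsection \<open>Convergence of distribution functions\<close>

text \<open>Replacing \<open>Z\<close> by \<open>Y\<close> costs one shift \<eta> and an exceptional
  probability, and \<open>sand\<close> costs a second shift. Continuity at t makes the resulting
  window from t - 2 \<eta> to t + 2 \<eta> harmless.\<close>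

lemma cdf_limit_perturbed:
  assumes M: "\<And>i. prob_space (M i)"
    and sand: "\<And>t \<eta> e. \<eta> > 0 \<Longrightarrow> e > 0 \<Longrightarrow> \<forall>\<^sub>F i in F. measure (M i) {x \<in> space (M i). Y i x \<le> t} \<le> cdf L (t + \<eta>) + e"
      "\<And>t \<eta> e. \<eta> > 0 \<Longrightarrow> e > 0 \<Longrightarrow> \<forall>\<^sub>F i in F. cdf L (t - \<eta>) - e \<le> measure (M i) {x \<in> space (M i). Y i x \<le> t}"
    and Y[measurable]: "\<And>i. Y i \<in> borel_measurable (M i)" and Z[measurable]: "\<And>i. Z i \<in> borel_measurable (M i)"
    and close: "\<And>\<eta> \<delta>. \<eta> > 0 \<Longrightarrow> \<delta> > 0 \<Longrightarrow>
      \<forall>\<^sub>F i in F. \<exists>B\<in>sets (M i). 1 - \<delta> \<le> measure (M i) B \<and> (\<forall>x\<in>B. \<bar>Z i x - Y i x\<bar> \<le> \<eta>)"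
    and cont: "isCont (cdf L) t"
  shows "((\<lambda>i. measure (M i) {x \<in> space (M i). Z i x \<le> t}) \<longlongrightarrow> cdf L t) F"
proof (rule tendstoI)
  fix e :: real assume e: "e > 0"
  have "(cdf L \<longlongrightarrow> cdf L t) (at t)" using cont by (simp add: isCont_def)
  then have "eventually (\<lambda>s. dist (cdf L s) (cdf L t) < e / 4) (at t)"
    using e by (intro tendstoD) auto
  then obtain d where d: "d > 0" "\<And>s. s \<noteq> t \<Longrightarrow> dist s t < d \<Longrightarrow> dist (cdf L s) (cdf L t) < e / 4"
    unfolding eventually_at by auto
  define \<eta> where "\<eta> = d / 4"
  have \<eta>: "\<eta> > 0" using d by (simp add: \<eta>_def)
  have c: "cdf L (t + \<eta> + \<eta>) < cdf L t + e / 4" "cdf L t - e / 4 < cdf L (t - \<eta> - \<eta>)"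
    using d(2)[of "t + \<eta> + \<eta>"] d(2)[of "t - \<eta> - \<eta>"] d(1) by (auto simp: \<eta>_def dist_real_def abs_if split: if_splits)
  have e4: "e / 4 > 0" using e by simp
  show "eventually (\<lambda>i. dist (measure (M i) {x \<in> space (M i). Z i x \<le> t}) (cdf L t) < e) F"
    using sand(1)[OF \<eta> e4, of "t + \<eta>"] sand(2)[OF \<eta> e4, of "t - \<eta>"] close[OF \<eta> e4]
  proof eventually_elim
    case (elim i)
    interpret prob_space "M i" by (rule M)
    obtain B where B: "B \<in> sets (M i)" "1 - e / 4 \<le> prob B" "\<And>x. x \<in> B \<Longrightarrow> \<bar>Z i x - Y i x\<bar> \<le> \<eta>"
      using elim(3) by blast
    have C: "prob (space (M i) - B) \<le> e / 4" using B by (simp add: prob_compl)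
    have sp: "B \<subseteq> space (M i)" using B(1) sets.sets_into_space by blast
    have "prob {x \<in> space (M i). Z i x \<le> t} \<le> prob ({x \<in> space (M i). Y i x \<le> t + \<eta>} \<union> (space (M i) - B))"
    proof (rule finite_measure_mono)
      show "{x \<in> space (M i). Z i x \<le> t} \<subseteq> {x \<in> space (M i). Y i x \<le> t + \<eta>} \<union> (space (M i) - B)"
        using B(3) by (fastforce simp: abs_le_iff)
    qed (use B(1) in auto)
    also have "\<dots> \<le> prob {x \<in> space (M i). Y i x \<le> t + \<eta>} + prob (space (M i) - B)"
      by (rule measure_Un_le) (use B(1) in auto)
    finally have up: "prob {x \<in> space (M i). Z i x \<le> t} \<le> prob {x \<in> space (M i). Y i x \<le> t + \<eta>} + e / 4"
      using C by simp
    have "prob {x \<in> space (M i). Y i x \<le> t - \<eta>} \<le> prob ({x \<in> space (M i). Z i x \<le> t} \<union> (space (M i) - B))"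
    proof (rule finite_measure_mono)
      show "{x \<in> space (M i). Y i x \<le> t - \<eta>} \<subseteq> {x \<in> space (M i). Z i x \<le> t} \<union> (space (M i) - B)"
        using B(3) by (fastforce simp: abs_le_iff)
    qed (use B(1) in auto)
    also have "\<dots> \<le> prob {x \<in> space (M i). Z i x \<le> t} + prob (space (M i) - B)"
      by (rule measure_Un_le) (use B(1) in auto)
    finally have lo: "prob {x \<in> space (M i). Y i x \<le> t - \<eta>} \<le> prob {x \<in> space (M i). Z i x \<le> t} + e / 4"
      using C by simp
    show ?case using up lo elim(1,2) c unfolding dist_real_def by linarith
  qed
qed

text \<open>Polya's argument needs only finitely many points, those where the continuous limit takes
  the levels k / m, and hence works along any filter. Monotonicity fills the gaps, and the range
  [0, 1] covers both ends.\<close>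

lemma polya:
  fixes G :: "'i \<Rightarrow> real \<Rightarrow> real"
  assumes L: "real_distribution L" and cont: "\<And>x. isCont (cdf L) x"
    and mono: "\<And>i. mono (G i)" and range: "\<And>i x. G i x \<in> {0..1}"
    and lim: "\<And>x. ((\<lambda>i. G i x) \<longlongrightarrow> cdf L x) F"
  shows "((\<lambda>i. SUP x. \<bar>G i x - cdf L x\<bar>) \<longlongrightarrow> 0) F"
proof (rule tendstoI)
  interpret L: real_distribution L by fact
  fix e' :: real assume "e' > 0"
  define e where "e = e' / 4"
  have e: "e > 0" using \<open>e' > 0\<close> by (simp add: e_def)
  define m where "m = nat \<lceil>1 / e\<rceil> + 1"
  have m: "1 / real m < e" "m > 0"
  proof -
    show m0: "m > 0" by (simp add: m_def)
    have "1 / e < real m" unfolding m_def by linarith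
    then have "1 < e * real m" using e by (simp add: divide_less_eq mult.commute)
    then show "1 / real m < e" using m0 by (simp add: divide_less_eq)
  qed
  have ex: "\<exists>x. cdf L x = real k / real m" if k: "0 < k" "k < m" for k
  proof -
    have k': "0 < real k / real m" "real k / real m < 1" using k by auto
    obtain a where a: "cdf L a < real k / real m"
      using order_tendstoD(2)[OF L.cdf_lim_at_bot k'(1)] by (auto simp: eventually_at_bot_linorder)
    obtain b where b: "real k / real m < cdf L b"
      using order_tendstoD(1)[OF L.cdf_lim_at_top_prob k'(2)] by (auto simp: eventually_at_top_linorder)
    have "a \<le> b" using a b L.cdf_nondecreasing[of b a] by linarith
    then show ?thesis using IVT[of "cdf L" a "real k / real m" b] a b cont by auto
  qed
  then obtain X where X: "\<And>k. 0 < k \<Longrightarrow> k < m \<Longrightarrow> cdf L (X k) = real k / real m" by metis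
  have "eventually (\<lambda>i. \<forall>k\<in>{0<..<m}. dist (G i (X k)) (cdf L (X k)) < e) F"
    by (intro eventually_ball_finite ballI tendstoD[OF lim] e) simp
  then show "eventually (\<lambda>i. dist (SUP x. \<bar>G i x - cdf L x\<bar>) 0 < e') F"
  proof eventually_elim
    case (elim i)
    have pt: "\<bar>G i x - cdf L x\<bar> \<le> 3 * e" for x
    proof -
      have c01: "0 \<le> cdf L x" "cdf L x \<le> 1" by (auto simp: L.cdf_nonneg L.cdf_bounded_prob)
      define k where "k = nat \<lfloor>cdf L x * m\<rfloor>"
      have k: "real k \<le> cdf L x * m" "cdf L x * m < real k + 1"
        using c01 m by (auto simp: k_def)
      then have kc: "real k / m \<le> cdf L x" "cdf L x < real (k + 1) / m" using m by (auto simp: field_simps)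
      have mk: "real (k + 1) / m = real k / m + 1 / m" by (simp add: add_divide_distrib)
      have g: "0 \<le> G i x" "G i x \<le> 1" using range[of i x] by auto
      have up: "G i x \<le> real (k + 1) / m + e"
      proof (cases "k + 1 < m")
        case True
        then have "x \<le> X (k + 1)" using X[of "k+1"] kc L.cdf_nondecreasing[of "X (k+1)" x] by fastforce
        then have "G i x \<le> G i (X (k + 1))" using mono by (simp add: monoD)
        then show ?thesis using elim[rule_format, of "k + 1"] True X[of "k + 1"] by (simp add: dist_real_def)
      next
        case False
        then have "1 \<le> real (k + 1) / m" using m by simp
        then show ?thesis using g e by linarith
      qed
      have lo: "real k / m - 1 / m - e \<le> G i x"
      proof (cases "k \<le> 1")
        case True
        then have "real k / m \<le> 1 / m" by (intro divide_right_mono) auto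
        then show ?thesis using g e by linarith
      next
        case False
        \<comment> \<open>The level k itself would not do: equality of the levels at
          \<open>X k\<close> and x does not order these points where \<open>cdf L\<close> is flat.
          The strictly smaller level k - 1 does, at the cost of one more 1 / m.\<close>
        let ?j = "k - 1"
        have "cdf L x * real m \<le> 1 * real m" by (intro mult_right_mono c01) simp
        then have "real k \<le> real m" using k by linarith
        then have j: "0 < ?j" "?j < m" using False by auto
        have rj: "real ?j / m = real k / m - 1 / m" using False by (simp add: diff_divide_distrib of_nat_diff)
        have "0 < 1 / real m" using m by simp
        then have "X ?j \<le> x" using X[OF j] rj kc(1) L.cdf_nondecreasing[of x "X ?j"] by linarith
        then have "G i (X ?j) \<le> G i x" using mono by (simp add: monoD)
        moreover have "dist (G i (X ?j)) (cdf L (X ?j)) < e" using elim j by auto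
        ultimately show ?thesis using X[OF j] rj unfolding dist_real_def by linarith
      qed
      show ?thesis using up lo kc mk m(1) by linarith
    qed
    have "(SUP x. \<bar>G i x - cdf L x\<bar>) \<le> 3 * e" by (rule cSUP_least) (use pt in auto)
    moreover have "0 \<le> (SUP x. \<bar>G i x - cdf L x\<bar>)"
      by (rule order_trans[OF abs_ge_zero cSUP_upper[of 0]]) (auto intro!: bdd_aboveI2 pt)
    ultimately show ?case using e by (simp add: e_def)
  qed
qed

section \<open>The linearized quantile statistic of a general group sample\<close>

subsection \<open>Linearized quantiles\<close>

definition below :: "real ^ ('g::finite \<times> 'c::finite) \<Rightarrow> 'g \<times> 'c \<Rightarrow> real ^ 'c \<Rightarrow> real" where
  "below \<theta> a = indicator {y. y $ snd a \<le> \<theta> $ a}"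

lemma measurable_below [measurable]: "below \<theta> a \<in> borel_measurable borel"
proof -
  have "closed {y. y $ snd a \<le> \<theta> $ a}"
    by (intro closed_Collect_le continuous_intros)
  then have "{y. y $ snd a \<le> \<theta> $ a} \<in> sets borel" by (rule borel_closed)
  then show ?thesis by (simp add: below_def)
qed

lemma below_bounds: "\<bar>below \<theta> a y\<bar> \<le> 1" "(below \<theta> a y)\<^sup>2 = below \<theta> a y" "0 \<le> below \<theta> a y" "below \<theta> a y \<le> 1"
  by (auto simp: below_def indicator_def)

context group_sample
begin

definition F0 :: "real ^ ('g \<times> 'c) \<Rightarrow> 'g \<times> 'c \<Rightarrow> real" where
  "F0 \<theta> a = (\<integral>y. below \<theta> a y \<partial>\<mu> (fst a))"

definition J0 :: "real ^ ('g \<times> 'c) \<Rightarrow> 'g \<times> 'c \<Rightarrow> 'g \<times> 'c \<Rightarrow> real" where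
  "J0 \<theta> a b = (\<integral>y. below \<theta> a y * below \<theta> b y \<partial>\<mu> (fst a))"

text \<open>Coordinates belonging to other groups are set to 0, so that the summands of all groups
  live in one stacked space and can be added there.\<close>

definition score :: "real ^ ('g \<times> 'c) \<Rightarrow> real ^ ('g \<times> 'c) \<Rightarrow> 'g \<Rightarrow> real ^ 'c \<Rightarrow> real ^ ('g \<times> 'c)" where
  "score \<theta> \<phi> i y = (\<chi> a. if fst a = i then (below \<theta> a y - F0 \<theta> a) / \<phi> $ a else 0)"

text \<open>The influence function of the quantile with its normalization. \<theta> and \<phi> are
  free: at both levels they are the true quantiles and the true densities, while the centring
  \<open>F0\<close> follows the law \<mu>.\<close>

definition infl :: "real ^ ('g \<times> 'c) \<Rightarrow> real ^ ('g \<times> 'c) \<Rightarrow> 'g \<times> nat \<Rightarrow> 'b \<Rightarrow> real ^ ('g \<times> 'c)" where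
  "infl \<theta> \<phi> p x = (- sqrt (total_size n) / n (fst p)) *\<^sub>R score \<theta> \<phi> (fst p) (\<xi> (fst p) (snd p) x)"

text \<open>The exact covariance matrix of the sum of all \<open>infl\<close>, before any limit is
  taken.\<close>

definition cov0 :: "real ^ ('g \<times> 'c) \<Rightarrow> real ^ ('g \<times> 'c) \<Rightarrow> real ^ ('g \<times> 'c) ^ ('g \<times> 'c)" where
  "cov0 \<theta> \<phi> = (\<chi> a b. if fst a = fst b
     then real (total_size n) / n (fst a) * ((J0 \<theta> a b - F0 \<theta> a * F0 \<theta> b) / (\<phi> $ a * \<phi> $ b)) else 0)"

lemma integrable_law:
  fixes g :: "real ^ 'c \<Rightarrow> real"
  assumes "g \<in> borel_measurable borel" "\<And>y. \<bar>g y\<bar> \<le> B"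
  shows "integrable (\<mu> i) g"
proof (rule prob_space.integrable_bounded[OF law_prob_space])
  show "g \<in> borel_measurable (\<mu> i)" using assms(1) by (simp add: measurable_cong_sets[OF sets_law refl])
qed (use assms(2) in auto)

lemma integrable_below: "integrable (\<mu> i) (below \<theta> a)" "integrable (\<mu> i) (\<lambda>y. below \<theta> a y * below \<theta> b y)"
proof -
  show "integrable (\<mu> i) (below \<theta> a)" by (rule integrable_law[where B = 1]) (auto simp: below_bounds)
  show "integrable (\<mu> i) (\<lambda>y. below \<theta> a y * below \<theta> b y)"
    by (rule integrable_law[where B = 1]) (auto simp: below_bounds abs_mult mult_le_one)
qed

lemma prob_law: "(\<integral>y. c \<partial>\<mu> i) = (c :: real)"
  using prob_space.prob_space[OF law_prob_space] by simp

lemma F0_bounds: "0 \<le> F0 \<theta> a" "F0 \<theta> a \<le> 1"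
proof -
  show "0 \<le> F0 \<theta> a" unfolding F0_def by (simp add: below_bounds)
  have "F0 \<theta> a \<le> (\<integral>y. 1 \<partial>\<mu> (fst a))"
    unfolding F0_def by (intro integral_mono integrable_below integrable_law[where B = 1]) (auto simp: below_bounds)
  then show "F0 \<theta> a \<le> 1" by (simp only: prob_law)
qed

lemma sum_infl:
  "(\<Sum>p\<in>obs_index n. infl \<theta> \<phi> p x) $ a
    = sqrt (total_size n) * (F0 \<theta> a - gmean (n (fst a)) (\<xi> (fst a)) (below \<theta> a) x) / \<phi> $ a"
proof -
  let ?i = "fst a" and ?s = "sqrt (total_size n)"
  have "(\<Sum>p\<in>obs_index n. infl \<theta> \<phi> p x) $ a = (\<Sum>i\<in>UNIV. \<Sum>j<n i. infl \<theta> \<phi> (i, j) x $ a)"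
    unfolding obs_index_eq sum_component by (subst sum.Sigma) (auto simp: split_def)
  also have "\<dots> = (\<Sum>i\<in>UNIV. if ?i = i then \<Sum>j<n i. infl \<theta> \<phi> (i, j) x $ a else 0)"
  proof (intro sum.cong refl)
    fix i
    show "(\<Sum>j<n i. infl \<theta> \<phi> (i, j) x $ a) = (if ?i = i then \<Sum>j<n i. infl \<theta> \<phi> (i, j) x $ a else 0)"
      by (cases "?i = i") (simp, simp add: infl_def score_def)
  qed
  also have "\<dots> = (\<Sum>j<n ?i. infl \<theta> \<phi> (?i, j) x $ a)" by simp
  also have "\<dots> = (\<Sum>j<n ?i. - ?s / n ?i * ((below \<theta> a (\<xi> ?i j x) - F0 \<theta> a) / \<phi> $ a))"
    by (intro sum.cong refl) (simp add: infl_def score_def)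
  also have "\<dots> = - ?s / n ?i * (((\<Sum>j<n ?i. below \<theta> a (\<xi> ?i j x)) - n ?i * F0 \<theta> a) / \<phi> $ a)"
    by (simp only: sum_distrib_left[symmetric] sum_divide_distrib[symmetric] sum_subtractf sum_constant card_lessThan)
  also have "\<dots> = ?s * (F0 \<theta> a - gmean (n ?i) (\<xi> ?i) (below \<theta> a) x) / \<phi> $ a"
    using n_pos[of ?i] by (cases "\<phi> $ a = 0") (simp_all add: gmean_def field_simps)
  finally show ?thesis .
qed

lemma norm_infl:
  assumes \<phi>: "\<And>a. 0 < \<phi> $ a"
  shows "norm (infl \<theta> \<phi> p x) \<le> sqrt (total_size n) / n (fst p) * (\<Sum>a\<in>UNIV. 1 / \<phi> $ a)"
proof -
  have "norm (score \<theta> \<phi> i y) \<le> (\<Sum>a\<in>UNIV. 1 / \<phi> $ a)" for i y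
  proof -
    have "norm (score \<theta> \<phi> i y) \<le> (\<Sum>a\<in>UNIV. \<bar>score \<theta> \<phi> i y $ a\<bar>)" by (rule norm_le_l1_cart)
    also have "\<dots> \<le> (\<Sum>a\<in>UNIV. 1 / \<phi> $ a)"
    proof (rule sum_mono)
      fix a
      have "\<bar>below \<theta> a y - F0 \<theta> a\<bar> \<le> 1"
        using below_bounds(3,4)[of \<theta> a y] F0_bounds[of \<theta> a] by linarith
      then show "\<bar>score \<theta> \<phi> i y $ a\<bar> \<le> 1 / \<phi> $ a"
        using \<phi>[of a] by (auto simp: score_def abs_divide intro!: divide_right_mono)
    qed
    finally show ?thesis .
  qed
  then have "sqrt (total_size n) / n (fst p) * norm (score \<theta> \<phi> (fst p) (\<xi> (fst p) (snd p) x))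
      \<le> sqrt (total_size n) / n (fst p) * (\<Sum>a\<in>UNIV. 1 / \<phi> $ a)"
    by (intro mult_left_mono) auto
  then show ?thesis by (simp add: infl_def)
qed

lemma measurable_score_nth [measurable]: "(\<lambda>y. score \<theta> \<phi> i y $ a) \<in> borel_measurable borel"
  unfolding score_def vec_lambda_beta by (cases "fst a = i") simp_all

lemma measurable_score [measurable]: "score \<theta> \<phi> i \<in> borel_measurable borel"
proof (subst borel_measurable_euclidean_space, rule ballI)
  fix e :: "real ^ ('g \<times> 'c)" assume "e \<in> Basis"
  then obtain a where "e = axis a 1" by (auto simp: Basis_vec_def)
  then show "(\<lambda>y. score \<theta> \<phi> i y \<bullet> e) \<in> borel_measurable borel"
    using measurable_score_nth[of \<theta> \<phi> i a] by (simp add: inner_axis)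
qed

lemma indep_infl: "indep_vars (\<lambda>_. borel) (infl \<theta> \<phi>) (obs_index n)"
proof -
  have "indep_vars (\<lambda>_. borel) (\<lambda>p x. (- sqrt (total_size n) / n (fst p)) *\<^sub>R score \<theta> \<phi> (fst p) ((case p of (i, j) \<Rightarrow> \<xi> i j) x)) (obs_index n)"
    by (rule indep_vars_compose2[OF indep]) simp
  then show ?thesis by (simp add: infl_def[abs_def] split_def)
qed

lemma measurable_infl: "p \<in> obs_index n \<Longrightarrow> infl \<theta> \<phi> p \<in> borel_measurable M"
  using indep_infl[of \<theta> \<phi>] unfolding indep_vars_def by blast

lemma score_moments:
  assumes "fst a = i" "fst b = i"
  shows "(\<integral>y. score \<theta> \<phi> i y $ a \<partial>\<mu> i) = 0"
    "(\<integral>y. score \<theta> \<phi> i y $ a * score \<theta> \<phi> i y $ b \<partial>\<mu> i) = (J0 \<theta> a b - F0 \<theta> a * F0 \<theta> b) / (\<phi> $ a * \<phi> $ b)"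
proof -
  have F: "(\<integral>y. below \<theta> a y \<partial>\<mu> i) = F0 \<theta> a" "(\<integral>y. below \<theta> b y \<partial>\<mu> i) = F0 \<theta> b"
    using assms by (simp_all add: F0_def)
  have c: "integrable (\<mu> i) (\<lambda>_. c :: real)" for c by (rule integrable_law[where B = "\<bar>c\<bar>"]) auto
  show "(\<integral>y. score \<theta> \<phi> i y $ a \<partial>\<mu> i) = 0"
    using assms by (simp add: score_def integrable_below c F prob_space.prob_space[OF law_prob_space])
  have "(\<integral>y. score \<theta> \<phi> i y $ a * score \<theta> \<phi> i y $ b \<partial>\<mu> i)
     = (\<integral>y. (below \<theta> a y * below \<theta> b y - F0 \<theta> b * below \<theta> a y - F0 \<theta> a * below \<theta> b y + F0 \<theta> a * F0 \<theta> b) / (\<phi> $ a * \<phi> $ b) \<partial>\<mu> i)"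
    using assms by (intro Bochner_Integration.integral_cong) (auto simp: score_def algebra_simps)
  also have "\<dots> = (J0 \<theta> a b - F0 \<theta> b * F0 \<theta> a - F0 \<theta> a * F0 \<theta> b + F0 \<theta> a * F0 \<theta> b) / (\<phi> $ a * \<phi> $ b)"
    using assms by (simp add: integrable_below c F prob_space.prob_space[OF law_prob_space] J0_def)
  finally show "(\<integral>y. score \<theta> \<phi> i y $ a * score \<theta> \<phi> i y $ b \<partial>\<mu> i) = (J0 \<theta> a b - F0 \<theta> a * F0 \<theta> b) / (\<phi> $ a * \<phi> $ b)"
    by (simp add: algebra_simps)
qed

lemma integrable_score: "integrable (\<mu> i) (\<lambda>y. score \<theta> \<phi> i y $ a)" "integrable (\<mu> i) (\<lambda>y. score \<theta> \<phi> i y $ a * score \<theta> \<phi> i y $ b)"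
proof -
  have m: "(\<lambda>y. score \<theta> \<phi> i y $ a) \<in> borel_measurable borel" for a by (rule measurable_score_nth)
  have b: "\<bar>score \<theta> \<phi> i y $ a\<bar> \<le> \<bar>1 / \<phi> $ a\<bar>" for y a
  proof -
    have "\<bar>below \<theta> a y - F0 \<theta> a\<bar> \<le> 1"
      using below_bounds(3,4)[of \<theta> a y] F0_bounds[of \<theta> a] by linarith
    then show ?thesis by (auto simp: score_def abs_divide intro!: divide_right_mono)
  qed
  show "integrable (\<mu> i) (\<lambda>y. score \<theta> \<phi> i y $ a)" by (rule integrable_law[OF m b])
  show "integrable (\<mu> i) (\<lambda>y. score \<theta> \<phi> i y $ a * score \<theta> \<phi> i y $ b)"
    by (rule integrable_law[where B = "\<bar>1 / \<phi> $ a\<bar> * \<bar>1 / \<phi> $ b\<bar>"]) (use m in simp, unfold abs_mult, intro mult_mono b, auto)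
qed

lemma mean_infl:
  assumes p: "p \<in> obs_index n"
  shows "expectation (\<lambda>x. t \<bullet> infl \<theta> \<phi> p x) = 0"
proof -
  obtain i j where ij: "p = (i, j)" "j < n i" using p by (auto simp: obs_index_def)
  have m: "(\<lambda>y. t \<bullet> score \<theta> \<phi> i y) \<in> borel_measurable borel" by measurable
  have z: "(\<integral>y. score \<theta> \<phi> i y $ a \<partial>\<mu> i) = 0" for a
    by (cases "fst a = i") (simp add: score_moments(1), simp add: score_def)
  have "expectation (\<lambda>x. t \<bullet> infl \<theta> \<phi> p x) = (- sqrt (total_size n) / n i) * expectation (\<lambda>x. t \<bullet> score \<theta> \<phi> i (\<xi> i j x))"
    by (simp add: infl_def ij)
  also have "expectation (\<lambda>x. t \<bullet> score \<theta> \<phi> i (\<xi> i j x)) = (\<integral>y. t \<bullet> score \<theta> \<phi> i y \<partial>\<mu> i)"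
    by (rule expectation_obs[OF ij(2) m])
  also have "\<dots> = 0" by (simp add: inner_vec_def integrable_score z)
  finally show ?thesis by simp
qed

text \<open>Adding n_i equal terms turns the squared normalization N / n_i^2 into N / n_i.
  Coordinates from different groups do not interact, because each score vanishes outside its own
  group.\<close>

lemma second_moment_infl:
  "(\<Sum>p\<in>obs_index n. expectation (\<lambda>x. (t \<bullet> infl \<theta> \<phi> p x)\<^sup>2)) = t \<bullet> (cov0 \<theta> \<phi> *v t)"
proof -
  define q where "q i = (\<Sum>a\<in>UNIV. \<Sum>b\<in>UNIV. t $ a * t $ b * (\<integral>y. score \<theta> \<phi> i y $ a * score \<theta> \<phi> i y $ b \<partial>\<mu> i))" for i
  have e: "expectation (\<lambda>x. (t \<bullet> infl \<theta> \<phi> (i, j) x)\<^sup>2) = real (total_size n) / (n i)\<^sup>2 * q i" if "j < n i" for i j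
  proof -
    have m: "(\<lambda>y. (t \<bullet> score \<theta> \<phi> i y)\<^sup>2) \<in> borel_measurable borel" by measurable
    have "expectation (\<lambda>x. (t \<bullet> infl \<theta> \<phi> (i, j) x)\<^sup>2) = expectation (\<lambda>x. real (total_size n) / (n i)\<^sup>2 * (t \<bullet> score \<theta> \<phi> i (\<xi> i j x))\<^sup>2)"
      by (simp add: infl_def power_mult_distrib power_divide)
    also have "\<dots> = real (total_size n) / (n i)\<^sup>2 * (\<integral>y. (t \<bullet> score \<theta> \<phi> i y)\<^sup>2 \<partial>\<mu> i)"
      by (simp add: expectation_obs[OF that m])
    also have "(\<integral>y. (t \<bullet> score \<theta> \<phi> i y)\<^sup>2 \<partial>\<mu> i) = (\<integral>y. (\<Sum>a\<in>UNIV. \<Sum>b\<in>UNIV. t $ a * t $ b * (score \<theta> \<phi> i y $ a * score \<theta> \<phi> i y $ b)) \<partial>\<mu> i)"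
      by (simp add: inner_vec_def power2_eq_square sum_product mult_ac)
    also have "\<dots> = q i" by (simp add: q_def integrable_score)
    finally show ?thesis .
  qed
  have s: "(\<integral>y. score \<theta> \<phi> i y $ a * score \<theta> \<phi> i y $ b \<partial>\<mu> i)
     = (if fst a = i then if fst b = i then (J0 \<theta> a b - F0 \<theta> a * F0 \<theta> b) / (\<phi> $ a * \<phi> $ b) else 0 else 0)" for i a b
    using score_moments(2)[of a i b \<theta> \<phi>] by (cases "fst a = i"; cases "fst b = i") (simp_all add: score_def)
  have "(\<Sum>p\<in>obs_index n. expectation (\<lambda>x. (t \<bullet> infl \<theta> \<phi> p x)\<^sup>2)) = (\<Sum>i\<in>UNIV. \<Sum>j<n i. expectation (\<lambda>x. (t \<bullet> infl \<theta> \<phi> (i, j) x)\<^sup>2))"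
    unfolding obs_index_eq by (subst sum.Sigma) (auto simp: split_def)
  also have "\<dots> = (\<Sum>i\<in>UNIV. real (total_size n) / n i * q i)"
  proof (intro sum.cong refl)
    fix i
    have "(\<Sum>j<n i. expectation (\<lambda>x. (t \<bullet> infl \<theta> \<phi> (i, j) x)\<^sup>2)) = (\<Sum>j<n i. real (total_size n) / (n i)\<^sup>2 * q i)"
      by (intro sum.cong refl) (simp add: e)
    also have "\<dots> = real (total_size n) / n i * q i"
      using n_pos[of i] by (simp add: power2_eq_square)
    finally show "(\<Sum>j<n i. expectation (\<lambda>x. (t \<bullet> infl \<theta> \<phi> (i, j) x)\<^sup>2)) = real (total_size n) / n i * q i" .
  qed
  also have "\<dots> = (\<Sum>a\<in>UNIV. \<Sum>b\<in>UNIV. \<Sum>i\<in>UNIV. real (total_size n) / n i * (t $ a * t $ b * (\<integral>y. score \<theta> \<phi> i y $ a * score \<theta> \<phi> i y $ b \<partial>\<mu> i)))"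
    unfolding q_def sum_distrib_left
    by (subst sum.swap, intro sum.cong refl, subst sum.swap) (rule refl)
  also have "\<dots> = (\<Sum>a\<in>UNIV. \<Sum>b\<in>UNIV. t $ a * (cov0 \<theta> \<phi> $ a $ b * t $ b))"
  proof (intro sum.cong refl)
    fix a b
    let ?g = "\<lambda>i. real (total_size n) / n i * (t $ a * t $ b * (\<integral>y. score \<theta> \<phi> i y $ a * score \<theta> \<phi> i y $ b \<partial>\<mu> i))"
    have "(\<Sum>i\<in>UNIV. ?g i) = (\<Sum>i\<in>UNIV. if fst a = i then ?g i else 0)"
      by (intro sum.cong refl) (simp add: s)
    also have "\<dots> = ?g (fst a)" by simp
    finally show "(\<Sum>i\<in>UNIV. ?g i) = t $ a * (cov0 \<theta> \<phi> $ a $ b * t $ b)"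
      by (cases "fst a = fst b") (simp_all add: s cov0_def mult_ac)
  qed
  also have "\<dots> = t \<bullet> (cov0 \<theta> \<phi> *v t)"
    by (simp add: inner_vec_def matrix_vector_mult_def sum_distrib_left)
  finally show ?thesis .
qed

lemma psd_cov0: "psd (cov0 \<theta> \<phi>)"
proof -
  have "0 \<le> t \<bullet> (cov0 \<theta> \<phi> *v t)" for t
    unfolding second_moment_infl[symmetric] by (intro sum_nonneg) simp
  moreover have "transpose (cov0 \<theta> \<phi>) = cov0 \<theta> \<phi>"
    by (auto simp: transpose_def cov0_def vec_eq_iff J0_def mult.commute)
  ultimately show ?thesis by (simp add: psd_def)
qed

end

text \<open>Each summand is bounded by a multiple of N^(-1/2) and there are N of them, so the sums
  of third and fourth powers are of order N^(-1/2) and 1 / N. The index i is a stage for the data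
  and a pair of a stage and an outcome for the conditional laws.\<close>

theorem laplace_linearized_tendsto:
  fixes M :: "'i \<Rightarrow> 'b measure" and \<xi> :: "'i \<Rightarrow> 'g::finite \<Rightarrow> nat \<Rightarrow> 'b \<Rightarrow> real ^ 'c::finite"
    and V R :: "real ^ ('g \<times> 'c) ^ ('g \<times> 'c)"
  assumes G: "\<And>i. group_sample (M i) (\<xi> i) (n i) (\<mu> i)"
    and \<phi>: "\<And>a. 0 < \<phi> $ a"
    and V: "psd V" and cov: "((\<lambda>i. group_sample.cov0 (n i) (\<mu> i) \<theta> \<phi>) \<longlongrightarrow> V) F"
    and size: "((\<lambda>i. 1 / real (total_size (n i))) \<longlongrightarrow> 0) F"
      "\<And>g. ((\<lambda>i. real (total_size (n i)) / n i g) \<longlongrightarrow> r g) F"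
    and R: "R ** V ** transpose R = diagm lam" "\<And>a. 0 \<le> lam a" and k: "0 \<le> k"
  shows "((\<lambda>i. \<integral>x. exp (- (k * (norm (R *v (\<Sum>p\<in>obs_index (n i). group_sample.infl (\<xi> i) (n i) (\<mu> i) \<theta> \<phi> p x)))\<^sup>2)) \<partial>M i)
     \<longlongrightarrow> (\<integral>u. exp (- (k * u)) \<partial>chi2_mixture lam)) F"
proof -
  define C where "C = (\<Sum>a\<in>UNIV. 1 / \<phi> $ a)"
  have C: "0 \<le> C" unfolding C_def using \<phi> by (intro sum_nonneg) (simp add: less_imp_le)
  define N where "N i = real (total_size (n i))" for i
  define b where "b i p = sqrt (N i) / n i (fst p) * C" for i and p :: "'g \<times> nat"
  \<comment> \<open>Each coordinate of t is at most its norm, so the entrywise distance of the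
    covariances controls the distance of their quadratic forms.\<close>
  define s where "s i = (\<Sum>a\<in>UNIV. \<Sum>b\<in>UNIV. \<bar>group_sample.cov0 (n i) (\<mu> i) \<theta> \<phi> $ a $ b - V $ a $ b\<bar>)" for i
  have N: "N i \<ge> 0" for i by (simp add: N_def)
  show ?thesis
  proof (rule laplace_quadratic_form_tendsto[where M = M and b = b and s = s and J = "\<lambda>i. obs_index (n i)"
        and \<zeta> = "\<lambda>i. group_sample.infl (\<xi> i) (n i) (\<mu> i) \<theta> \<phi>", OF _ _ _ _ _ _ V _ _ _ _ R k])
    fix i
    interpret group_sample "M i" "\<xi> i" "n i" "\<mu> i" by (rule G)
    show "prob_space (M i)" by (rule prob_space_axioms)
    show "indep_vars (\<lambda>_. borel) (infl \<theta> \<phi>) (obs_index (n i))" by (rule indep_infl)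
    show "norm (infl \<theta> \<phi> p x) \<le> b i p" for p x
      unfolding b_def C_def N_def by (rule norm_infl) (rule \<phi>)
    show "0 \<le> b i p" for p using C by (simp add: b_def N)
    show "expectation (\<lambda>x. t \<bullet> infl \<theta> \<phi> p x) = 0" if "p \<in> obs_index (n i)" for p t
      using that by (rule mean_infl)
    show "0 \<le> s i" by (simp add: s_def sum_nonneg)
    show "\<bar>(\<Sum>p\<in>obs_index (n i). expectation (\<lambda>x. (t \<bullet> infl \<theta> \<phi> p x)\<^sup>2)) - t \<bullet> (V *v t)\<bar> \<le> s i * (norm t)\<^sup>2" for t
    proof -
      have "(\<Sum>p\<in>obs_index (n i). expectation (\<lambda>x. (t \<bullet> infl \<theta> \<phi> p x)\<^sup>2)) - t \<bullet> (V *v t)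
         = (\<Sum>a\<in>UNIV. \<Sum>b\<in>UNIV. t $ a * ((cov0 \<theta> \<phi> $ a $ b - V $ a $ b) * t $ b))"
        unfolding second_moment_infl
        by (simp add: inner_vec_def matrix_vector_mult_def sum_distrib_left sum_subtractf algebra_simps)
      also have "\<bar>\<dots>\<bar> \<le> (\<Sum>a\<in>UNIV. \<Sum>b\<in>UNIV. \<bar>t $ a * ((cov0 \<theta> \<phi> $ a $ b - V $ a $ b) * t $ b)\<bar>)"
        by (intro order_trans[OF sum_abs] sum_mono sum_abs)
      also have "\<dots> \<le> (\<Sum>a\<in>UNIV. \<Sum>b\<in>UNIV. \<bar>cov0 \<theta> \<phi> $ a $ b - V $ a $ b\<bar> * (norm t)\<^sup>2)"
      proof (intro sum_mono)
        fix a b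
        have "\<bar>t $ a\<bar> * \<bar>t $ b\<bar> \<le> norm t * norm t" by (intro mult_mono component_le_norm_cart) auto
        then have "\<bar>cov0 \<theta> \<phi> $ a $ b - V $ a $ b\<bar> * (\<bar>t $ a\<bar> * \<bar>t $ b\<bar>) \<le> \<bar>cov0 \<theta> \<phi> $ a $ b - V $ a $ b\<bar> * (norm t)\<^sup>2"
          unfolding power2_eq_square by (intro mult_left_mono) auto
        then show "\<bar>t $ a * ((cov0 \<theta> \<phi> $ a $ b - V $ a $ b) * t $ b)\<bar> \<le> \<bar>cov0 \<theta> \<phi> $ a $ b - V $ a $ b\<bar> * (norm t)\<^sup>2"
          by (simp add: abs_mult mult_ac)
      qed
      also have "\<dots> = s i * (norm t)\<^sup>2" by (simp add: s_def sum_distrib_right)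
      finally show ?thesis .
    qed
  next
    have "((\<lambda>i. \<Sum>a\<in>UNIV. \<Sum>b\<in>UNIV. \<bar>group_sample.cov0 (n i) (\<mu> i) \<theta> \<phi> $ a $ b - V $ a $ b\<bar>) \<longlongrightarrow> (\<Sum>a\<in>(UNIV :: ('g \<times> 'c) set). \<Sum>b\<in>(UNIV :: ('g \<times> 'c) set). \<bar>V $ a $ b - V $ a $ b\<bar>)) F"
      by (intro tendsto_intros cov)
    then show "(s \<longlongrightarrow> 0) F" by (simp add: s_def[abs_def])
  next
    have eq: "(\<Sum>p\<in>obs_index (n i). b i p ^ 3 + b i p ^ 4)
       = (\<Sum>g\<in>UNIV. C ^ 3 * ((N i / n i g)\<^sup>2 * sqrt (1 / N i)) + C ^ 4 * ((N i / n i g) ^ 3 * (1 / N i)))" for i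
    proof -
      interpret group_sample "M i" "\<xi> i" "n i" "\<mu> i" by (rule G)
      have pos: "N i > 0"
        unfolding N_def total_size_def of_nat_sum by (rule sum_pos) (use n_pos in auto)
      have sq: "sqrt (N i) ^ 3 = N i * sqrt (N i)" "sqrt (N i) ^ 4 = N i * N i"
        using pos by (simp_all add: power3_eq_cube power4_eq_xxxx)
      have t: "real (n i g) * (b i (g, j) ^ 3 + b i (g, j) ^ 4)
         = C ^ 3 * ((N i / n i g)\<^sup>2 * sqrt (1 / N i)) + C ^ 4 * ((N i / n i g) ^ 3 * (1 / N i))" for g j
      proof -
        have rs: "sqrt (1 / N i) = sqrt (N i) / N i" using pos by (simp add: real_sqrt_divide real_div_sqrt field_simps)
        have m: "real (n i g) > 0" using n_pos by simp
        have "real (n i g) * (b i (g, j) ^ 3 + b i (g, j) ^ 4) = real (n i g) * (N i * sqrt (N i) / n i g ^ 3 * C ^ 3 + N i * N i / n i g ^ 4 * C ^ 4)"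
          by (simp add: b_def power_mult_distrib power_divide sq)
        also have "\<dots> = C ^ 3 * ((N i / n i g)\<^sup>2 * sqrt (1 / N i)) + C ^ 4 * ((N i / n i g) ^ 3 * (1 / N i))"
          unfolding rs using m pos by (simp add: field_simps power2_eq_square power3_eq_cube power4_eq_xxxx)
        finally show ?thesis .
      qed
      have "(\<Sum>p\<in>obs_index (n i). b i p ^ 3 + b i p ^ 4) = (\<Sum>g\<in>UNIV. \<Sum>j<n i g. b i (g, j) ^ 3 + b i (g, j) ^ 4)"
        unfolding obs_index_eq by (subst sum.Sigma) (auto simp: split_def)
      also have "\<dots> = (\<Sum>g\<in>UNIV. real (n i g) * (b i (g, 0) ^ 3 + b i (g, 0) ^ 4))"
        by (simp add: b_def)
      finally show ?thesis by (simp only: t)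
    qed
    have "((\<lambda>i. \<Sum>g\<in>UNIV. C ^ 3 * ((N i / n i g)\<^sup>2 * sqrt (1 / N i)) + C ^ 4 * ((N i / n i g) ^ 3 * (1 / N i)))
       \<longlongrightarrow> (\<Sum>g\<in>UNIV. C ^ 3 * ((r g)\<^sup>2 * sqrt 0) + C ^ 4 * ((r g) ^ 3 * 0))) F"
      unfolding N_def by (intro tendsto_intros size)
    then show "((\<lambda>i. \<Sum>p\<in>obs_index (n i). b i p ^ 3 + b i p ^ 4) \<longlongrightarrow> 0) F" by (simp add: eq)
  qed simp
qed

subsection \<open>Quantiles and distribution functions\<close>

text \<open>Right continuity shows that the infimum is attained; monotonicity gives the rest. This
  equivalence is the only access to quantiles in the linearization, and it serves the empirical
  quantiles too, because \<open>ecdf\<close> is the distribution function of a probability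
  law.\<close>

lemma quantile_le_iff:
  assumes D: "real_distribution D" and p: "0 < p" "p < 1"
  shows "quantile p (cdf D) \<le> y \<longleftrightarrow> p \<le> cdf D y"
proof -
  interpret real_distribution D by fact
  let ?S = "{t. p \<le> cdf D t}"
  obtain b where b: "p < cdf D b"
    using order_tendstoD(1)[OF cdf_lim_at_top_prob p(2)] by (auto simp: eventually_at_top_linorder)
  obtain a where a: "cdf D a < p"
    using order_tendstoD(2)[OF cdf_lim_at_bot p(1)] by (auto simp: eventually_at_bot_linorder)
  have ne: "?S \<noteq> {}" using b less_imp_le by blast
  have lb: "a \<le> t" if "t \<in> ?S" for t
    using that a cdf_nondecreasing[of t a] by (cases "a \<le> t") auto
  have bdd: "bdd_below ?S" using lb by (rule bdd_belowI)
  let ?q = "Inf ?S"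
  have q: "p \<le> cdf D ?q"
  proof (rule ccontr)
    assume "\<not> ?thesis"
    then have "eventually (\<lambda>t. cdf D t < p) (at_right ?q)"
      using cdf_is_right_cont[of ?q] by (intro order_tendstoD(2)[of _ "cdf D ?q"]) (auto simp: continuous_within)
    then obtain c where c: "?q < c" "\<And>t. ?q < t \<Longrightarrow> t < c \<Longrightarrow> cdf D t < p"
      unfolding eventually_at_right_field by auto
    have "c \<le> t" if t: "t \<in> ?S" for t
    proof (rule ccontr)
      assume "\<not> c \<le> t"
      moreover have "?q \<le> t" using t bdd by (rule cInf_lower)
      moreover have "t \<noteq> ?q" using t \<open>\<not> p \<le> cdf D ?q\<close> by auto
      ultimately have "cdf D t < p" using c(2)[of t] by simp
      then show False using t by simp
    qed
    then have "c \<le> ?q" using ne by (intro cInf_greatest) auto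
    then show False using c by simp
  qed
  show ?thesis unfolding quantile_def
  proof
    assume "?q \<le> y"
    then show "p \<le> cdf D y" using q cdf_nondecreasing order_trans by blast
  next
    assume "p \<le> cdf D y"
    then show "?q \<le> y" using bdd by (intro cInf_lower) auto
  qed
qed

lemma cdf_quantile:
  assumes D: "real_distribution D" and p: "0 < p" "p < 1" and cont: "isCont (cdf D) (quantile p (cdf D))"
  shows "cdf D (quantile p (cdf D)) = p"
proof -
  let ?q = "quantile p (cdf D)"
  have "p \<le> cdf D ?q" using quantile_le_iff[OF D p, of ?q] by simp
  moreover have "cdf D ?q \<le> p"
  proof (rule tendsto_upperbound)
    show "(cdf D \<longlongrightarrow> cdf D ?q) (at_left ?q)"
      using cont by (simp add: isCont_def filterlim_at_split)
    have "cdf D t \<le> p" if "t < ?q" for t using quantile_le_iff[OF D p, of t] that by linarith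
    then show "eventually (\<lambda>t. cdf D t \<le> p) (at_left ?q)"
      unfolding eventually_at_left_field by (auto intro!: exI[of _ "?q - 1"])
  qed simp
  ultimately show ?thesis by simp
qed

text \<open>The conditional law of one bootstrap draw. The uniform law is put on the observation
  numbers, so tied observations keep their multiplicity.\<close>

definition emp_law :: "('g \<Rightarrow> nat) \<Rightarrow> ('g, 'c::finite) sample \<Rightarrow> 'g \<Rightarrow> (real ^ 'c) measure" where
  "emp_law n s i = distr (measure_pmf (pmf_of_set {..<n i})) borel (\<lambda>j. s (i, j))"

lemma integral_emp_law:
  fixes g :: "real ^ 'c::finite \<Rightarrow> real"
  assumes "0 < n i" "g \<in> borel_measurable borel"
  shows "(\<integral>y. g y \<partial>emp_law n s i) = (\<Sum>j<n i. g (s (i, j))) / n i"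
proof -
  have "(\<integral>y. g y \<partial>emp_law n s i) = (\<integral>j. g (s (i, j)) \<partial>measure_pmf (pmf_of_set {..<n i}))"
    unfolding emp_law_def using assms(2) by (subst integral_distr) auto
  also have "\<dots> = (\<Sum>j<n i. g (s (i, j))) / card {..<n i}"
    using assms(1) by (intro integral_pmf_of_set) (auto simp: lessThan_empty_iff)
  finally show ?thesis by simp
qed

lemma ecdf_eq_cdf:
  assumes "0 < n i"
  shows "ecdf n s i l = cdf (distr (measure_pmf (pmf_of_set {..<n i})) borel (\<lambda>j. s (i, j) $ l))"
proof
  fix t
  have "{..<n i} \<inter> (\<lambda>j. s (i, j) $ l) -` {..t} = {j. j < n i \<and> s (i, j) $ l \<le> t}" by auto
  then show "ecdf n s i l t = cdf (distr (measure_pmf (pmf_of_set {..<n i})) borel (\<lambda>j. s (i, j) $ l)) t"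
    using assms by (simp add: ecdf_def cdf_def measure_distr measure_pmf_of_set lessThan_empty_iff)
qed

lemma ecdf_quantile_le_iff:
  assumes "0 < n i" "0 < p" "p < 1"
  shows "quantile p (ecdf n s i l) \<le> y \<longleftrightarrow> p \<le> ecdf n s i l y"
  unfolding ecdf_eq_cdf[where n = n and i = i, OF assms(1)]
  by (intro quantile_le_iff assms prob_space.real_distribution_distr measure_pmf.prob_space_axioms) simp

lemma gmean_below:
  "gmean m \<xi> (below \<theta> a) x = real (card {j. j < m \<and> \<xi> j x $ snd a \<le> \<theta> $ a}) / real m"
proof -
  have "(\<Sum>j<m. below \<theta> a (\<xi> j x)) = (\<Sum>j\<in>{..<m}. if \<xi> j x $ snd a \<le> \<theta> $ a then 1 else 0)"
    by (intro sum.cong) (auto simp: below_def)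
  also have "\<dots> = real (card {j. j < m \<and> \<xi> j x $ snd a \<le> \<theta> $ a})"
    by (simp add: sum.If_cases Int_def)
  finally show ?thesis by (simp add: gmean_def)
qed

lemma total_size_pos: "(\<And>i. 0 < n i) \<Longrightarrow> 0 < total_size n"
  unfolding total_size_def by (rule sum_pos) auto

context group_sample
begin

lemma prob_sum_infl_bounded:
  assumes \<phi>: "0 < \<phi> $ a" and K: "0 < K"
  shows "1 - real (total_size n) / n (fst a) / (K * \<phi> $ a)\<^sup>2 \<le> prob {x \<in> space M. \<bar>(\<Sum>p\<in>obs_index n. infl \<theta> \<phi> p x) $ a\<bar> < K}"
proof -
  let ?i = "fst a" and ?N = "real (total_size n)"
  let ?e = "K * \<phi> $ a / sqrt ?N"
  have N: "?N > 0" using total_size_pos[OF n_pos] by simp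
  have e: "?e > 0" using \<phi> K N by simp
  have eq: "\<bar>(\<Sum>p\<in>obs_index n. infl \<theta> \<phi> p x) $ a\<bar> < K \<longleftrightarrow> \<bar>gmean (n ?i) (\<xi> ?i) (below \<theta> a) x - (\<integral>y. below \<theta> a y \<partial>\<mu> ?i)\<bar> < ?e" for x
  proof -
    have H: "\<bar>(\<Sum>p\<in>obs_index n. infl \<theta> \<phi> p x) $ a\<bar> = sqrt ?N * \<bar>gmean (n ?i) (\<xi> ?i) (below \<theta> a) x - F0 \<theta> a\<bar> / \<phi> $ a"
      unfolding sum_infl using \<phi> by (simp add: abs_mult abs_divide abs_minus_commute)
    show ?thesis unfolding H using \<phi> N by (simp add: F0_def divide_less_eq less_divide_eq mult.commute)
  qed
  have "1 - (\<integral>y. (below \<theta> a y)\<^sup>2 \<partial>\<mu> ?i) / (n ?i * ?e\<^sup>2) \<le> prob {x \<in> space M. \<bar>(\<Sum>p\<in>obs_index n. infl \<theta> \<phi> p x) $ a\<bar> < K}"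
    unfolding eq by (rule prob_gmean_close[OF _ _ e, where B = 1]) (auto simp: below_bounds)
  moreover have "(\<integral>y. (below \<theta> a y)\<^sup>2 \<partial>\<mu> ?i) / (n ?i * ?e\<^sup>2) \<le> 1 / (n ?i * ?e\<^sup>2)"
    using F0_bounds(2)[of \<theta> a] by (intro divide_right_mono) (auto simp: below_bounds F0_def)
  moreover have "1 / (n ?i * ?e\<^sup>2) = ?N / n ?i / (K * \<phi> $ a)\<^sup>2"
    using N by (simp add: power_divide)
  ultimately show ?thesis by linarith
qed

text \<open>For a constant threshold vector, \<open>F0 (vec t) a\<close> is the marginal distribution function
  with index \<open>a\<close> at \<open>t\<close>.\<close>

lemma prob_increment_close:
  fixes a :: "'g \<times> 'c"
  assumes e: "0 < e"
  defines "G \<equiv> \<lambda>t x. gmean (n (fst a)) (\<xi> (fst a)) (below (vec t) a) x"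
  shows "1 - real (total_size n) / n (fst a) * \<bar>F0 (vec t) a - F0 (vec u) a\<bar> / e\<^sup>2
    \<le> prob {x \<in> space M. \<bar>sqrt (total_size n) * ((G t x - G u x) - (F0 (vec t) a - F0 (vec u) a))\<bar> < e}"
proof -
  let ?i = "fst a" and ?N = "real (total_size n)"
  define g where "g y = below (vec t) a y - below (vec u) a y" for y
  have N: "?N > 0" using total_size_pos[OF n_pos] by simp
  have g: "g \<in> borel_measurable borel" unfolding g_def by measurable
  have b: "\<bar>g y\<bar> \<le> 1" for y by (auto simp: g_def below_def indicator_def)
  have F: "(\<integral>y. below (vec s) a y \<partial>\<mu> ?i) = F0 (vec s) a" for s by (simp add: F0_def)
  have ig: "(\<integral>y. g y \<partial>\<mu> ?i) = F0 (vec t) a - F0 (vec u) a"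
    unfolding g_def by (simp add: integrable_below F)
  \<comment> \<open>The half-lines below t and u are nested, so the difference of their indicators
    is an indicator up to sign and its square integrates to the increment itself.\<close>
  have sq: "(\<integral>y. (g y)\<^sup>2 \<partial>\<mu> ?i) = \<bar>F0 (vec t) a - F0 (vec u) a\<bar>"
  proof (cases "u \<le> t")
    case True
    then have "(g y)\<^sup>2 = g y" "0 \<le> g y" for y by (auto simp: g_def below_def indicator_def)
    then have h: "(g y)\<^sup>2 = g y" "0 \<le> g y" for y by auto
    then have "0 \<le> (\<integral>y. g y \<partial>\<mu> ?i)" by (intro integral_nonneg_AE) auto
    then show ?thesis using ig h(1) by simp
  next
    case False
    then have h: "(g y)\<^sup>2 = - g y" "0 \<le> - g y" for y by (auto simp: g_def below_def indicator_def)
    then have "0 \<le> (\<integral>y. - g y \<partial>\<mu> ?i)" by (intro integral_nonneg_AE) auto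
    then show ?thesis using ig h(1) by simp
  qed
  let ?e = "e / sqrt ?N"
  have e': "?e > 0" using e N by simp
  have gm: "gmean (n ?i) (\<xi> ?i) g x = G t x - G u x" for x
    by (simp add: gmean_def G_def g_def sum_subtractf diff_divide_distrib)
  have sc: "\<bar>sqrt ?N * z\<bar> < e \<longleftrightarrow> \<bar>z\<bar> < ?e" for z
    using N by (simp add: abs_mult less_divide_eq mult.commute)
  have eq: "\<bar>sqrt ?N * ((G t x - G u x) - (F0 (vec t) a - F0 (vec u) a))\<bar> < e \<longleftrightarrow> \<bar>gmean (n ?i) (\<xi> ?i) g x - (\<integral>y. g y \<partial>\<mu> ?i)\<bar> < ?e" for x
    unfolding gm ig by (rule sc)
  have "1 - (\<integral>y. (g y)\<^sup>2 \<partial>\<mu> ?i) / (n ?i * ?e\<^sup>2) \<le> prob {x \<in> space M. \<bar>sqrt ?N * ((G t x - G u x) - (F0 (vec t) a - F0 (vec u) a))\<bar> < e}"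
    unfolding eq by (rule prob_gmean_close[OF g b e'])
  moreover have "(\<integral>y. (g y)\<^sup>2 \<partial>\<mu> ?i) / (n ?i * ?e\<^sup>2) = ?N / n ?i * \<bar>F0 (vec t) a - F0 (vec u) a\<bar> / e\<^sup>2"
    using N by (simp add: sq power_divide)
  ultimately show ?thesis by simp
qed

end

lemma group_sample_boot:
  fixes s :: "('g::finite, 'c::finite) sample"
  assumes n: "\<And>i. 0 < n i"
  shows "group_sample (measure_pmf (boot_pmf n s)) (\<lambda>i j s'. s' (i, j)) n (emp_law n s)"
proof -
  let ?p = "\<lambda>(i, j). map_pmf (\<lambda>j'. s (i, j')) (pmf_of_set {..<n i})"
  let ?B = "measure_pmf (boot_pmf n s)"
  show ?thesis
  proof
    have "prob_space.indep_vars ?B (\<lambda>_. count_space UNIV) (\<lambda>p s'. s' p) (obs_index n)"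
      unfolding boot_pmf_def by (rule indep_vars_Pi_pmf) simp
    then have "prob_space.indep_vars ?B (\<lambda>_. borel) (\<lambda>p s'. (\<lambda>y. y) (s' p)) (obs_index n)"
      by (rule prob_space.indep_vars_compose2[OF measure_pmf.prob_space_axioms]) simp
    then show "prob_space.indep_vars ?B (\<lambda>_. borel) (\<lambda>(i, j) s'. s' (i, j)) (obs_index n)"
      by (simp add: split_def)
  next
    fix i j assume j: "j < n i"
    have "map_pmf (\<lambda>s'. s' (i, j)) (boot_pmf n s) = map_pmf (\<lambda>j'. s (i, j')) (pmf_of_set {..<n i})"
      unfolding boot_pmf_def using j by (subst Pi_pmf_component) (auto simp: obs_index_eq)
    then have "measure_pmf (map_pmf (\<lambda>s'. s' (i, j)) (boot_pmf n s)) = measure_pmf (map_pmf (\<lambda>j'. s (i, j')) (pmf_of_set {..<n i}))"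
      by simp
    then have *: "distr (measure_pmf (boot_pmf n s)) (count_space UNIV) (\<lambda>s'. s' (i, j))
        = distr (measure_pmf (pmf_of_set {..<n i})) (count_space UNIV) (\<lambda>j'. s (i, j'))"
      by (simp add: map_pmf_rep_eq)
    \<comment> \<open>The identity between the pmfs concerns the discrete sigma-algebra; pushing
      both laws forward along the identity map transfers it to \<open>borel\<close>.\<close>
    have d: "distr (distr (measure_pmf q) (count_space UNIV) h) borel (\<lambda>y. y) = distr (measure_pmf q) borel h" for q and h :: "'x \<Rightarrow> real ^ 'c"
      by (subst distr_distr) (auto simp: comp_def)
    show "distr (measure_pmf (boot_pmf n s)) borel (\<lambda>s'. s' (i, j)) = emp_law n s i"
      using arg_cong[OF *, of "\<lambda>D. distr D borel (\<lambda>y. y)"] unfolding d emp_law_def .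
  qed (rule n)
qed

lemma derivative_at_scaled_points:
  fixes F :: "real \<Rightarrow> real"
  assumes D: "(F has_real_derivative c) (at q)" and a: "filterlim a at_top G"
  shows "((\<lambda>n. a n * (F (q + y / a n) - F q)) \<longlongrightarrow> c * y) G"
proof (cases "y = 0")
  case False
  have lim: "((\<lambda>h. (F (q + h) - F q) / h) \<longlongrightarrow> c) (at 0)" using D by (simp add: DERIV_def)
  have "((\<lambda>n. y / a n) \<longlongrightarrow> 0) G"
    by (intro tendsto_divide_0[OF tendsto_const] filterlim_at_top_imp_at_infinity a)
  moreover have ev: "eventually (\<lambda>n. a n > 0) G" using a by (simp add: filterlim_at_top_dense)
  ultimately have "filterlim (\<lambda>n. y / a n) (at 0) G"
    unfolding filterlim_at using False by (auto elim: eventually_mono)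
  from filterlim_compose[OF lim this]
  have "((\<lambda>n. y * ((F (q + y / a n) - F q) / (y / a n))) \<longlongrightarrow> y * c) G" by (intro tendsto_intros)
  then have "((\<lambda>n. a n * (F (q + y / a n) - F q)) \<longlongrightarrow> y * c) G"
    by (rule Lim_transform_eventually) (use ev False in \<open>auto elim!: eventually_mono\<close>)
  then show ?thesis by (simp add: mult.commute)
qed simp

context large_events
begin

text \<open>Q \<le> q + y / a holds iff p \<le> Fn (q + y / a). Subtracting Fn q and multiplying by
  a / c gives the equivalence that \<open>ghosh\<close> asks for, and \<open>inc\<close> together
  with the derivative of F at q makes the scaled increments converge to y.\<close>

lemma bahadur:
  fixes Fn :: "nat \<times> 'x \<Rightarrow> real \<Rightarrow> real"
  assumes dual: "\<And>r y. Q r \<le> y \<longleftrightarrow> p \<le> Fn r y"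
    and a: "filterlim a at_top sequentially" and c: "0 < c"
    and D: "(F has_real_derivative c) (at q)"
    and inc: "\<And>y. ((\<lambda>r. a (fst r) * ((Fn r (q + y / a (fst r)) - Fn r q) - (F (q + y / a (fst r)) - F q))) \<longlongrightarrow> 0) LF"
    and W: "tight (\<lambda>r. a (fst r) * (p - Fn r q) / c)"
  shows "((\<lambda>r. a (fst r) * (Q r - q) - a (fst r) * (p - Fn r q) / c) \<longlongrightarrow> 0) LF"
proof (rule ghosh[OF _ _ W, where D = "\<lambda>y r. a (fst r) * (Fn r (q + y / a (fst r)) - Fn r q) / c"])
  fix y
  have "eventually (\<lambda>n. a n > 0) sequentially" using a by (simp add: filterlim_at_top_dense)
  then have "eventually (\<lambda>r. a (fst r) > 0) LF" by (rule eventually_LF_det)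
  then show "eventually (\<lambda>r. a (fst r) * (Q r - q) \<le> y \<longleftrightarrow> a (fst r) * (p - Fn r q) / c \<le> a (fst r) * (Fn r (q + y / a (fst r)) - Fn r q) / c) LF"
  proof eventually_elim
    case (elim r)
    have "a (fst r) * (Q r - q) \<le> y \<longleftrightarrow> Q r \<le> q + y / a (fst r)" using elim by (simp add: field_simps)
    also have "\<dots> \<longleftrightarrow> p - Fn r q \<le> Fn r (q + y / a (fst r)) - Fn r q" by (simp add: dual)
    also have "\<dots> \<longleftrightarrow> a (fst r) * (p - Fn r q) / c \<le> a (fst r) * (Fn r (q + y / a (fst r)) - Fn r q) / c"
      using elim c by (simp add: divide_le_cancel mult_le_cancel_left)
    finally show ?case .
  qed
  have "((\<lambda>r. a (fst r) * (F (q + y / a (fst r)) - F q)) \<longlongrightarrow> c * y) LF"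
    using tendsto_LF_det[OF derivative_at_scaled_points[OF D a]] .
  from tendsto_add[OF inc[of y] this]
  have "((\<lambda>r. a (fst r) * (Fn r (q + y / a (fst r)) - Fn r q)) \<longlongrightarrow> 0 + c * y) LF"
    by (simp add: algebra_simps)
  then have "((\<lambda>r. a (fst r) * (Fn r (q + y / a (fst r)) - Fn r q) / c) \<longlongrightarrow> (0 + c * y) / c) LF"
    by (rule tendsto_divide[OF _ tendsto_const]) (use c in simp)
  then show "((\<lambda>r. a (fst r) * (Fn r (q + y / a (fst r)) - Fn r q) / c) \<longlongrightarrow> y) LF"
    using c by simp
qed

end

section \<open>The data and the bootstrap sample as two instances\<close>

subsection \<open>The bootstrap model\<close>

lemma below_vec: "below \<theta> a = below (vec (\<theta> $ a)) a"
  by (simp add: below_def)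

locale quantile_model = prob_space M for M :: "'a measure" +
  fixes X :: "'g::finite \<Rightarrow> nat \<Rightarrow> 'a \<Rightarrow> real ^ 'c::finite" and P :: "'g \<Rightarrow> (real ^ 'c) measure"
    and f :: "'g \<Rightarrow> 'c \<Rightarrow> real \<Rightarrow> real" and p :: real and N :: "nat \<Rightarrow> 'g \<Rightarrow> nat"
    and \<kappa> :: "'g \<Rightarrow> real" and q :: "real ^ ('g \<times> 'c)"
  assumes p: "0 < p" "p < 1"
    and indep: "indep_vars (\<lambda>_. borel) (\<lambda>(i, j). X i j) UNIV"
    and law: "\<And>i j. distr M borel (X i j) = P i"
    and sizes: "\<And>\<nu> i. 0 < N \<nu> i" "filterlim (\<lambda>\<nu>. total_size (N \<nu>)) at_top sequentially"
    and A1: "\<And>i. (\<lambda>\<nu>. real (N \<nu> i) / real (total_size (N \<nu>))) \<longlonglongrightarrow> \<kappa> i" "\<And>i. 0 < \<kappa> i"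
    and q_eq: "q = quantiles p P"
    and deriv: "\<And>i l. (marginal_cdf (P i) l has_real_derivative f i l (q $ (i, l))) (at (q $ (i, l)))"
    and f_pos: "\<And>i l. 0 < f i l (q $ (i, l))"
begin

text \<open>Arguments of type \<open>nat \<times> 'a\<close> consist of a stage and an outcome; for bootstrap quantities
  the bootstrap sample is a third component. \<open>Fh\<close> and \<open>Fb\<close> are the empirical distribution
  functions of the data and of the bootstrap sample.\<close>

definition tot :: "nat \<Rightarrow> real" where "tot \<nu> = real (total_size (N \<nu>))"
definition \<phi> :: "real ^ ('g \<times> 'c)" where "\<phi> = (\<chi> a. f (fst a) (snd a) (q $ a))"
definition F :: "'g \<times> 'c \<Rightarrow> real \<Rightarrow> real" where "F a = marginal_cdf (P (fst a)) (snd a)"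
definition dat :: "nat \<times> 'a \<Rightarrow> ('g, 'c) sample" where "dat r = data (N (fst r)) X (snd r)"
definition Fh :: "nat \<times> 'a \<Rightarrow> 'g \<times> 'c \<Rightarrow> real \<Rightarrow> real" where
  "Fh r a = ecdf (N (fst r)) (dat r) (fst a) (snd a)"
definition proj :: "nat \<times> 'a \<times> ('g, 'c) sample \<Rightarrow> nat \<times> 'a" where "proj r = (fst r, fst (snd r))"
definition Fb :: "nat \<times> 'a \<times> ('g, 'c) sample \<Rightarrow> 'g \<times> 'c \<Rightarrow> real \<Rightarrow> real" where
  "Fb r a = ecdf (N (fst r)) (snd (snd r)) (fst a) (snd a)"

definition big1 :: "nat \<Rightarrow> real \<Rightarrow> ('a \<Rightarrow> bool) \<Rightarrow> bool" where
  "big1 \<nu> \<delta> Q \<longleftrightarrow> (\<exists>B\<in>events. 1 - \<delta> \<le> prob B \<and> (\<forall>\<omega>\<in>B. Q \<omega>))"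

definition big2 :: "nat \<Rightarrow> real \<Rightarrow> ('a \<times> ('g, 'c) sample \<Rightarrow> bool) \<Rightarrow> bool" where
  "big2 \<nu> \<delta> Q \<longleftrightarrow> big1 \<nu> \<delta> (\<lambda>\<omega>. 1 - \<delta> \<le> boot_prob (N \<nu>) (dat (\<nu>, \<omega>)) (\<lambda>s'. Q (\<omega>, s')))"

lemma boot_prob_mono: "(\<And>s'. Q s' \<Longrightarrow> R s') \<Longrightarrow> boot_prob n s Q \<le> boot_prob n s R"
  unfolding boot_prob_def by (intro measure_pmf.finite_measure_mono) auto

lemma boot_prob_True: "boot_prob n s (\<lambda>_. True) = 1"
  by (simp add: boot_prob_def)

lemma prob_Int_ge:
  assumes "prob_space K" "A \<in> sets K" "B \<in> sets K" "1 - \<delta> \<le> measure K A" "1 - \<epsilon> \<le> measure K B"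
  shows "1 - (\<delta> + \<epsilon>) \<le> measure K (A \<inter> B)"
proof -
  interpret K: prob_space K by fact
  have "K.prob (space K - A \<inter> B) \<le> K.prob ((space K - A) \<union> (space K - B))"
    using assms by (intro K.finite_measure_mono) auto
  also have "\<dots> \<le> K.prob (space K - A) + K.prob (space K - B)"
    using assms by (intro measure_Un_le) auto
  finally show ?thesis using assms by (simp add: K.prob_compl)
qed

lemma boot_prob_conj:
  assumes "1 - \<delta> \<le> boot_prob n s Q" "1 - \<epsilon> \<le> boot_prob n s R"
  shows "1 - (\<delta> + \<epsilon>) \<le> boot_prob n s (\<lambda>s'. Q s' \<and> R s')"
  using prob_Int_ge[OF measure_pmf.prob_space_axioms, of "{s'. Q s'}" _ "{s'. R s'}"] assms
  unfolding boot_prob_def Collect_conj_eq by simp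

lemma big1_mono: "big1 \<nu> \<delta> Q \<Longrightarrow> (\<And>\<omega>. Q \<omega> \<Longrightarrow> R \<omega>) \<Longrightarrow> big1 \<nu> \<delta> R"
  unfolding big1_def by blast

lemma big1_weaken: "big1 \<nu> \<delta> Q \<Longrightarrow> \<delta> \<le> \<epsilon> \<Longrightarrow> big1 \<nu> \<epsilon> Q"
  unfolding big1_def by force

lemma big1_all: "0 < \<delta> \<Longrightarrow> (\<And>\<omega>. Q \<omega>) \<Longrightarrow> big1 \<nu> \<delta> Q"
  unfolding big1_def by (intro bexI[of _ "space M"]) (auto simp: prob_space)

lemma big1_conj:
  assumes "big1 \<nu> \<delta> Q" "big1 \<nu> \<epsilon> R" shows "big1 \<nu> (\<delta> + \<epsilon>) (\<lambda>\<omega>. Q \<omega> \<and> R \<omega>)"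
proof -
  obtain A B where "A \<in> events" "1 - \<delta> \<le> prob A" "\<forall>\<omega>\<in>A. Q \<omega>" "B \<in> events" "1 - \<epsilon> \<le> prob B" "\<forall>\<omega>\<in>B. R \<omega>"
    using assms unfolding big1_def by auto
  then show ?thesis
    unfolding big1_def by (intro bexI[of _ "A \<inter> B"]) (auto intro!: prob_Int_ge[OF prob_space_axioms])
qed

sublocale L1: large_events big1
proof
  show "big1 n \<delta> (\<lambda>_. True)" if "0 < \<delta>" for n \<delta> by (rule big1_all[OF that]) simp
qed (blast intro: big1_mono big1_conj)+

sublocale L2: large_events big2
proof
  show "big2 n \<delta> (\<lambda>_. True)" if "0 < \<delta>" for n \<delta>
    unfolding big2_def using that by (intro big1_all) (auto simp: boot_prob_True)
  show "big2 n \<delta> R" if "big2 n \<delta> Q" "\<And>x. Q x \<Longrightarrow> R x" for n \<delta> Q R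
    using that(1) unfolding big2_def
    by (rule big1_mono) (blast intro: order_trans boot_prob_mono that(2))
  show "big2 n (\<delta> + \<epsilon>) (\<lambda>x. Q x \<and> R x)" if "big2 n \<delta> Q" "big2 n \<epsilon> R" for n \<delta> \<epsilon> Q R
    using big1_conj[OF that[unfolded big2_def]] unfolding big2_def
    by (rule big1_mono) (elim conjE, rule boot_prob_conj)
qed

text \<open>A property of the data alone has conditional probability 0 or 1, so limits for the data
  may be used inside limits for the bootstrap.\<close>

lemma filterlim_proj: "filterlim proj L1.LF L2.LF"
  unfolding filterlim_iff
proof (intro allI impI)
  fix Q assume Q: "eventually Q L1.LF"
  show "eventually (\<lambda>r. Q (proj r)) L2.LF"
    unfolding L2.eventually_LF
  proof (intro allI impI)
    fix \<delta> :: real assume \<delta>: "\<delta> > 0"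
    have "\<forall>\<^sub>F n in sequentially. big1 n \<delta> (\<lambda>x. Q (n, x))" using Q \<delta> by (simp add: L1.eventually_LF)
    then show "\<forall>\<^sub>F n in sequentially. big2 n \<delta> (\<lambda>x. Q (proj (n, x)))"
      by (rule eventually_mono)
        (use \<delta> in \<open>auto simp: big2_def proj_def boot_prob_True elim!: big1_mono\<close>)
  qed
qed

lemma eventually_L2_boot:
  assumes "eventually Q L2.LF" "\<delta> > 0"
  shows "eventually (\<lambda>r. 1 - \<delta> \<le> boot_prob (N (fst r)) (dat r) (\<lambda>s'. Q (fst r, snd r, s'))) L1.LF"
  unfolding L1.eventually_LF
proof (intro allI impI)
  fix \<epsilon> :: real assume \<epsilon>: "\<epsilon> > 0"
  \<comment> \<open>\<open>big2\<close> uses one number for the conditional probability and for the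
    data event; the minimum serves both tolerances.\<close>
  let ?m = "min \<delta> \<epsilon>"
  have "\<forall>\<^sub>F n in sequentially. big2 n ?m (\<lambda>x. Q (n, x))"
    using assms \<epsilon> by (simp add: L2.eventually_LF)
  then show "\<forall>\<^sub>F n in sequentially. big1 n \<epsilon> (\<lambda>x. 1 - \<delta> \<le> boot_prob (N (fst (n, x))) (dat (n, x)) (\<lambda>s'. Q (fst (n, x), snd (n, x), s')))"
  proof eventually_elim
    case (elim n)
    then have "big1 n \<epsilon> (\<lambda>\<omega>. 1 - ?m \<le> boot_prob (N n) (dat (n, \<omega>)) (\<lambda>s'. Q (n, \<omega>, s')))"
      unfolding big2_def by (rule big1_weaken) simp
    then show ?case
    proof (rule big1_mono)
      fix \<omega> assume "1 - ?m \<le> boot_prob (N n) (dat (n, \<omega>)) (\<lambda>s'. Q (n, \<omega>, s'))"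
      moreover have "1 - \<delta> \<le> 1 - ?m" by simp
      ultimately show "1 - \<delta> \<le> boot_prob (N (fst (n, \<omega>))) (dat (n, \<omega>)) (\<lambda>s'. Q (fst (n, \<omega>), snd (n, \<omega>), s'))"
        by simp
    qed
  qed
qed

lemma boot_eventually_L2:
  assumes "\<And>\<delta>. \<delta> > 0 \<Longrightarrow> eventually (\<lambda>r. 1 - \<delta> \<le> boot_prob (N (fst r)) (dat r) (\<lambda>s'. Q (fst r, snd r, s'))) L1.LF"
  shows "eventually Q L2.LF"
  unfolding L2.eventually_LF big2_def using assms by (simp add: L1.eventually_LF)

lemma tendsto_L1_zeroI:
  fixes Z :: "nat \<times> 'a \<Rightarrow> real"
  assumes m: "\<And>\<nu>. (\<lambda>\<omega>. Z (\<nu>, \<omega>)) \<in> borel_measurable M"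
    and v: "\<And>\<epsilon>. \<epsilon> > 0 \<Longrightarrow> v \<epsilon> \<longlonglongrightarrow> 0"
    and Z: "\<And>\<epsilon> \<nu>. \<epsilon> > 0 \<Longrightarrow> 1 - v \<epsilon> \<nu> \<le> prob {\<omega> \<in> space M. \<bar>Z (\<nu>, \<omega>)\<bar> < \<epsilon>}"
  shows "(Z \<longlongrightarrow> 0) L1.LF"
proof (rule tendstoI)
  fix \<epsilon> :: real assume \<epsilon>: "\<epsilon> > 0"
  show "eventually (\<lambda>r. dist (Z r) 0 < \<epsilon>) L1.LF"
    unfolding L1.eventually_LF
  proof (intro allI impI)
    fix \<delta> :: real assume "\<delta> > 0"
    then have "\<forall>\<^sub>F \<nu> in sequentially. v \<epsilon> \<nu> < \<delta>" by (rule order_tendstoD(2)[OF v[OF \<epsilon>]])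
    then show "\<forall>\<^sub>F \<nu> in sequentially. big1 \<nu> \<delta> (\<lambda>\<omega>. dist (Z (\<nu>, \<omega>)) 0 < \<epsilon>)"
    proof eventually_elim
      case (elim \<nu>)
      have "{\<omega> \<in> space M. \<bar>Z (\<nu>, \<omega>)\<bar> < \<epsilon>} \<in> events" using m[of \<nu>] by measurable
      then show ?case unfolding big1_def
        using Z[OF \<epsilon>, of \<nu>] elim by (intro bexI[of _ "{\<omega> \<in> space M. \<bar>Z (\<nu>, \<omega>)\<bar> < \<epsilon>}"]) auto
    qed
  qed
qed

text \<open>Here the exceptional probability \<open>v\<close> is itself random: a conditional
  Chebyshev bound that vanishes in probability.\<close>

lemma tendsto_L2_zeroI:
  fixes Z :: "nat \<times> 'a \<times> ('g, 'c) sample \<Rightarrow> real"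
  assumes v: "\<And>\<epsilon>. \<epsilon> > 0 \<Longrightarrow> (v \<epsilon> \<longlongrightarrow> 0) L1.LF"
    and Z: "\<And>\<epsilon> r. \<epsilon> > 0 \<Longrightarrow> 1 - v \<epsilon> r \<le> boot_prob (N (fst r)) (dat r) (\<lambda>s'. \<bar>Z (fst r, snd r, s')\<bar> < \<epsilon>)"
  shows "(Z \<longlongrightarrow> 0) L2.LF"
proof (rule tendstoI)
  fix \<epsilon> :: real assume \<epsilon>: "\<epsilon> > 0"
  show "eventually (\<lambda>r. dist (Z r) 0 < \<epsilon>) L2.LF"
  proof (rule boot_eventually_L2)
    fix \<delta> :: real assume "\<delta> > 0"
    then have "eventually (\<lambda>r. v \<epsilon> r < \<delta>) L1.LF" by (rule order_tendstoD(2)[OF v[OF \<epsilon>]])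
    then show "eventually (\<lambda>r. 1 - \<delta> \<le> boot_prob (N (fst r)) (dat r) (\<lambda>s'. dist (Z (fst r, snd r, s')) 0 < \<epsilon>)) L1.LF"
    proof eventually_elim
      case (elim r)
      then show ?case using Z[OF \<epsilon>, of r] by simp
    qed
  qed
qed

lemma gs: "group_sample M X (N \<nu>) P"
proof
  show "indep_vars (\<lambda>_. borel) (\<lambda>(i, j). X i j) (obs_index (N \<nu>))"
    by (rule indep_vars_subset[OF indep]) simp
qed (auto simp: law sizes)

lemma gs_boot: "group_sample (measure_pmf (boot_pmf (N \<nu>) s)) (\<lambda>i j s'. s' (i, j)) (N \<nu>) (emp_law (N \<nu>) s)"
  by (rule group_sample_boot) (rule sizes)

lemma tot_pos: "0 < tot \<nu>"
  using total_size_pos[of "N \<nu>"] sizes by (simp add: tot_def)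

lemma tot_at_top: "filterlim tot at_top sequentially"
  unfolding tot_def[abs_def] using sizes(2) by (rule filterlim_compose[OF filterlim_real_sequentially])

lemma sqrt_tot_at_top: "filterlim (\<lambda>\<nu>. sqrt (tot \<nu>)) at_top sequentially"
  by (rule filterlim_compose[OF sqrt_at_top tot_at_top])

lemma inverse_tot: "(\<lambda>\<nu>. 1 / tot \<nu>) \<longlonglongrightarrow> 0"
  using tendsto_inverse_0_at_top[OF tot_at_top] by (simp add: inverse_eq_divide)

lemma tot_ratio: "(\<lambda>\<nu>. tot \<nu> / N \<nu> i) \<longlonglongrightarrow> inverse (\<kappa> i)"
proof -
  have "(\<lambda>\<nu>. inverse (real (N \<nu> i) / tot \<nu>)) \<longlonglongrightarrow> inverse (\<kappa> i)"
    unfolding tot_def using A1[of i] by (intro tendsto_inverse) auto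
  then show ?thesis by simp
qed

lemma \<phi>_pos: "0 < \<phi> $ a"
  using f_pos[of "fst a" "snd a"] by (simp add: \<phi>_def)

lemma law_real_distribution: "real_distribution (distr (P i) borel (\<lambda>x. x $ l))"
proof -
  interpret group_sample M X "N 0" P by (rule gs)
  show ?thesis
    by (intro prob_space.real_distribution_distr law_prob_space) (simp add: measurable_cong_sets[OF sets_law refl])
qed

lemma F_deriv: "(F a has_real_derivative \<phi> $ a) (at (q $ a))"
  using deriv[of "fst a" "snd a"] by (simp add: F_def \<phi>_def)

lemma F_q: "F a (q $ a) = p"
proof -
  have "q $ a = quantile p (F a)" by (simp add: q_eq quantiles_def F_def)
  then show ?thesis
    using cdf_quantile[OF law_real_distribution p, of "fst a" "snd a"] DERIV_isCont[OF F_deriv, of a]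
    by (simp add: F_def marginal_cdf_def)
qed

lemma F0_eq: "group_sample.F0 P \<theta> a = F a (\<theta> $ a)"
proof -
  interpret group_sample M X "N 0" P by (rule gs)
  have m: "(\<lambda>x. x $ snd a) \<in> P (fst a) \<rightarrow>\<^sub>M borel" by (simp add: measurable_cong_sets[OF sets_law refl])
  have "below \<theta> a = (\<lambda>y. indicator {..\<theta> $ a} (y $ snd a))" by (auto simp: below_def indicator_def)
  then have "F0 \<theta> a = (\<integral>t. indicator {..\<theta> $ a} t \<partial>distr (P (fst a)) borel (\<lambda>x. x $ snd a))"
    unfolding F0_def using m by (subst integral_distr) auto
  then show ?thesis by (simp add: F_def marginal_cdf_def cdf_def)
qed

lemma J0_eq: "fst a = fst b \<Longrightarrow> group_sample.J0 P q a b = joint_cdf (P (fst a)) (snd a) (snd b) (q $ a) (q $ b)"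
proof -
  interpret group_sample M X "N 0" P by (rule gs)
  let ?A = "{x. x $ snd a \<le> q $ a \<and> x $ snd b \<le> q $ b}"
  have "(\<lambda>y. below q a y * below q b y) = indicator ?A" by (auto simp: below_def indicator_def)
  moreover have "space (P (fst a)) = UNIV" using sets_eq_imp_space_eq[OF sets_law] by simp
  ultimately show ?thesis by (simp add: J0_def joint_cdf_def)
qed

lemma F0_boot_eq: "group_sample.F0 (emp_law (N (fst r)) (dat r)) \<theta> a = Fh r a (\<theta> $ a)"
proof -
  interpret group_sample "measure_pmf (boot_pmf (N (fst r)) (dat r))" "\<lambda>i j s'. s' (i, j)" "N (fst r)" "emp_law (N (fst r)) (dat r)"
    by (rule gs_boot)
  have "F0 \<theta> a = gmean (N (fst r) (fst a)) (\<lambda>j _. dat r (fst a, j)) (below \<theta> a) ()"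
    unfolding F0_def by (subst integral_emp_law) (auto simp: sizes gmean_def)
  then show ?thesis unfolding gmean_below Fh_def ecdf_def by simp
qed

lemma dat_obs: "j < N (fst r) i \<Longrightarrow> dat r (i, j) = X i j (snd r)"
  by (simp add: dat_def data_def obs_index_def)

lemma gmean_data: "gmean (N \<nu> (fst a)) (X (fst a)) (below \<theta> a) \<omega> = Fh (\<nu>, \<omega>) a (\<theta> $ a)"
proof -
  have "{j. j < N \<nu> (fst a) \<and> X (fst a) j \<omega> $ snd a \<le> \<theta> $ a} = {j. j < N \<nu> (fst a) \<and> dat (\<nu>, \<omega>) (fst a, j) $ snd a \<le> \<theta> $ a}"
    using dat_obs[of _ "(\<nu>, \<omega>)"] by auto
  then show ?thesis by (simp add: gmean_below Fh_def ecdf_def)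
qed

lemma gmean_boot: "gmean (N \<nu> (fst a)) (\<lambda>j s'. s' (fst a, j)) (below \<theta> a) s' = Fb (\<nu>, \<omega>, s') a (\<theta> $ a)"
  by (simp add: gmean_below Fb_def ecdf_def)

lemma measurable_Fh: "(\<lambda>\<omega>. Fh (\<nu>, \<omega>) a t) \<in> borel_measurable M"
proof -
  interpret group_sample M X "N \<nu>" P by (rule gs)
  have "gmean (N \<nu> (fst a)) (X (fst a)) (below (vec t) a) \<in> borel_measurable M"
    by (rule measurable_gmean) simp
  then show ?thesis unfolding gmean_data[abs_def] by simp
qed

definition step :: "nat \<Rightarrow> 'g \<times> 'c \<Rightarrow> real \<Rightarrow> real" where "step \<nu> a y = q $ a + y / sqrt (tot \<nu>)"

lemma increment_data:
  "((\<lambda>r. sqrt (tot (fst r)) * ((Fh r a (step (fst r) a y) - Fh r a (q $ a)) - (F a (step (fst r) a y) - F a (q $ a)))) \<longlongrightarrow> 0) L1.LF"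
proof (rule tendsto_L1_zeroI[where v = "\<lambda>\<epsilon> \<nu>. tot \<nu> / N \<nu> (fst a) * \<bar>F a (step \<nu> a y) - F a (q $ a)\<bar> / \<epsilon>\<^sup>2"])
  fix \<epsilon> :: real assume "\<epsilon> > 0"
  have "(\<lambda>\<nu>. y / sqrt (tot \<nu>)) \<longlonglongrightarrow> 0"
    by (intro tendsto_divide_0[OF tendsto_const] filterlim_at_top_imp_at_infinity sqrt_tot_at_top)
  then have "(\<lambda>\<nu>. step \<nu> a y) \<longlonglongrightarrow> q $ a + 0" unfolding step_def by (intro tendsto_add tendsto_const)
  then have "(\<lambda>\<nu>. step \<nu> a y) \<longlonglongrightarrow> q $ a" by simp
  then have lim: "(\<lambda>\<nu>. F a (step \<nu> a y)) \<longlonglongrightarrow> F a (q $ a)"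
    by (rule isCont_tendsto_compose[OF DERIV_isCont[OF F_deriv]])
  have "(\<lambda>\<nu>. tot \<nu> / N \<nu> (fst a) * \<bar>F a (step \<nu> a y) - F a (q $ a)\<bar> / \<epsilon>\<^sup>2) \<longlonglongrightarrow> inverse (\<kappa> (fst a)) * \<bar>F a (q $ a) - F a (q $ a)\<bar> / \<epsilon>\<^sup>2"
    using \<open>\<epsilon> > 0\<close> by (intro tendsto_divide tendsto_mult tendsto_rabs tendsto_diff tendsto_const tot_ratio lim) simp
  then show "(\<lambda>\<nu>. tot \<nu> / N \<nu> (fst a) * \<bar>F a (step \<nu> a y) - F a (q $ a)\<bar> / \<epsilon>\<^sup>2) \<longlonglongrightarrow> 0" by simp
next
  fix \<epsilon> :: real and \<nu> assume "\<epsilon> > 0"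
  then show "1 - tot \<nu> / N \<nu> (fst a) * \<bar>F a (step \<nu> a y) - F a (q $ a)\<bar> / \<epsilon>\<^sup>2
    \<le> prob {\<omega> \<in> space M. \<bar>sqrt (tot (fst (\<nu>, \<omega>))) * ((Fh (\<nu>, \<omega>) a (step (fst (\<nu>, \<omega>)) a y) - Fh (\<nu>, \<omega>) a (q $ a)) - (F a (step (fst (\<nu>, \<omega>)) a y) - F a (q $ a)))\<bar> < \<epsilon>}"
    using group_sample.prob_increment_close[OF gs, of \<epsilon> \<nu> a "step \<nu> a y" "q $ a"]
    by (simp add: F0_eq gmean_data tot_def)
next
  fix \<nu>
  show "(\<lambda>\<omega>. sqrt (tot (fst (\<nu>, \<omega>))) * ((Fh (\<nu>, \<omega>) a (step (fst (\<nu>, \<omega>)) a y) - Fh (\<nu>, \<omega>) a (q $ a)) - (F a (step (fst (\<nu>, \<omega>)) a y) - F a (q $ a)))) \<in> borel_measurable M"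
    using measurable_Fh by simp
qed

text \<open>Given the data, the increment of \<open>Fb\<close> fluctuates around that of
  \<open>Fh\<close>, with conditional second moment bounded through the increment of
  \<open>Fh\<close>. That increment vanishes in probability, and \<open>increment_data\<close> then
  exchanges the centre \<open>Fh\<close> for \<open>F\<close>.\<close>

lemma increment_boot:
  "((\<lambda>r. sqrt (tot (fst r)) * ((Fb r a (step (fst r) a y) - Fb r a (q $ a)) - (F a (step (fst r) a y) - F a (q $ a)))) \<longlongrightarrow> 0) L2.LF"
proof -
  let ?d = "\<lambda>r. Fh r a (step (fst r) a y) - Fh r a (q $ a)"
  let ?dF = "\<lambda>r. F a (step (fst r) a y) - F a (q $ a)"
  have rt: "((\<lambda>r. 1 / sqrt (tot (fst r))) \<longlongrightarrow> 0) L1.LF"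
  proof -
    have "(\<lambda>\<nu>. 1 / sqrt (tot \<nu>)) \<longlonglongrightarrow> 0"
      by (intro tendsto_divide_0[OF tendsto_const] filterlim_at_top_imp_at_infinity sqrt_tot_at_top)
    then show ?thesis by (rule L1.tendsto_LF_det)
  qed
  have dF: "((\<lambda>r. sqrt (tot (fst r)) * ?dF r) \<longlongrightarrow> \<phi> $ a * y) L1.LF"
    using L1.tendsto_LF_det[OF derivative_at_scaled_points[OF F_deriv sqrt_tot_at_top, of a y]] by (simp add: step_def)
  \<comment> \<open>The scaled increment of \<open>Fh\<close> converges to \<phi> y; dividing by the
    square root of the total size shows that the unscaled one vanishes.\<close>
  have "((\<lambda>r. (1 / sqrt (tot (fst r))) * (sqrt (tot (fst r)) * (?d r - ?dF r) + sqrt (tot (fst r)) * ?dF r)) \<longlongrightarrow> 0 * (0 + \<phi> $ a * y)) L1.LF"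
    by (intro tendsto_intros rt increment_data dF)
  moreover have "(1 / sqrt (tot \<nu>)) * (sqrt (tot \<nu>) * (u - v) + sqrt (tot \<nu>) * v) = u" for u v \<nu>
    using tot_pos[of \<nu>] by (simp add: field_simps)
  ultimately have d0: "(?d \<longlongrightarrow> 0) L1.LF" by simp
  have "((\<lambda>r. sqrt (tot (fst r)) * ((Fb r a (step (fst r) a y) - Fb r a (q $ a)) - ?d (proj r))) \<longlongrightarrow> 0) L2.LF"
  proof (rule tendsto_L2_zeroI[where v = "\<lambda>\<epsilon> r. tot (fst r) / N (fst r) (fst a) * \<bar>?d r\<bar> / \<epsilon>\<^sup>2"])
    fix \<epsilon> :: real assume \<epsilon>: "\<epsilon> > 0"
    have "((\<lambda>r. tot (fst r) / N (fst r) (fst a) * \<bar>?d r\<bar> / \<epsilon>\<^sup>2) \<longlongrightarrow> inverse (\<kappa> (fst a)) * \<bar>0\<bar> / \<epsilon>\<^sup>2) L1.LF"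
      using \<epsilon> by (intro tendsto_divide tendsto_mult tendsto_rabs tendsto_const d0 L1.tendsto_LF_det[OF tot_ratio]) simp
    then show "((\<lambda>r. tot (fst r) / N (fst r) (fst a) * \<bar>?d r\<bar> / \<epsilon>\<^sup>2) \<longlongrightarrow> 0) L1.LF" by simp
  next
    fix \<epsilon> :: real and r assume \<epsilon>: "\<epsilon> > 0"
    show "1 - tot (fst r) / N (fst r) (fst a) * \<bar>?d r\<bar> / \<epsilon>\<^sup>2
      \<le> boot_prob (N (fst r)) (dat r) (\<lambda>s'. \<bar>sqrt (tot (fst (fst r, snd r, s'))) * ((Fb (fst r, snd r, s') a (step (fst (fst r, snd r, s')) a y) - Fb (fst r, snd r, s') a (q $ a)) - ?d (proj (fst r, snd r, s')))\<bar> < \<epsilon>)"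
      using group_sample.prob_increment_close[OF gs_boot, of \<epsilon> "fst r" a "dat r" "step (fst r) a y" "q $ a"] \<epsilon>
      by (simp add: F0_boot_eq gmean_boot[of "fst r" a _ _ "snd r"] tot_def boot_prob_def proj_def)
  qed
  from tendsto_add[OF this filterlim_compose[OF increment_data filterlim_proj, of a y]]
  show ?thesis by (simp add: proj_def algebra_simps)
qed

end

context quantile_model
begin

text \<open>\<open>Y1\<close> is the normalized deviation of the empirical quantiles from the true ones, \<open>Y2\<close> that of
  the bootstrap quantiles from the empirical ones; \<open>Z1\<close> and \<open>Z2\<close> are their linearizations.\<close>

definition Z1 :: "nat \<times> 'a \<Rightarrow> real ^ ('g \<times> 'c)" where
  "Z1 r = (\<Sum>k\<in>obs_index (N (fst r)). group_sample.infl X (N (fst r)) P q \<phi> k (snd r))"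

definition Z2 :: "nat \<times> 'a \<times> ('g, 'c) sample \<Rightarrow> real ^ ('g \<times> 'c)" where
  "Z2 r = (\<Sum>k\<in>obs_index (N (fst r)). group_sample.infl (\<lambda>i j s'. s' (i, j)) (N (fst r))
      (emp_law (N (fst r)) (dat (proj r))) q \<phi> k (snd (snd r)))"

definition Y1 :: "nat \<times> 'a \<Rightarrow> real ^ ('g \<times> 'c)" where
  "Y1 r = sqrt (tot (fst r)) *\<^sub>R (emp_quantiles p (N (fst r)) (dat r) - q)"

definition Y2 :: "nat \<times> 'a \<times> ('g, 'c) sample \<Rightarrow> real ^ ('g \<times> 'c)" where
  "Y2 r = sqrt (tot (fst r)) *\<^sub>R (emp_quantiles p (N (fst r)) (snd (snd r)) - emp_quantiles p (N (fst r)) (dat (proj r)))"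

lemma Z1_nth: "Z1 r $ a = sqrt (tot (fst r)) * (p - Fh r a (q $ a)) / \<phi> $ a"
  using group_sample.sum_infl[OF gs, of "fst r" q \<phi> "snd r" a]
  unfolding Z1_def gmean_data F0_eq F_q tot_def by simp

lemma Z2_nth: "Z2 r $ a = sqrt (tot (fst r)) * (Fh (proj r) a (q $ a) - Fb r a (q $ a)) / \<phi> $ a"
  using group_sample.sum_infl[OF gs_boot, of "fst r" "dat (proj r)" q \<phi> "snd (snd r)" a]
    gmean_boot[of "fst r" a q "snd (snd r)" "fst (snd r)"] F0_boot_eq[of "proj r" q a]
  unfolding Z2_def tot_def by (simp add: proj_def)

lemma bounding_radius:
  assumes \<delta>: "0 < \<delta>"
  obtains K where "0 < K" "\<forall>\<^sub>F \<nu> in sequentially. tot \<nu> / N \<nu> (fst a) / (K * \<phi> $ a)\<^sup>2 \<le> \<delta>"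
proof -
  define c where "c = inverse (\<kappa> (fst a)) + 1"
  have c: "c > 0" using A1(2)[of "fst a"] by (simp add: c_def add_pos_pos)
  \<comment> \<open>Chosen so that the Chebyshev bound is at most \<delta> once N / n_i has fallen
    below c, which exceeds its limit 1 / \<kappa>.\<close>
  define K where "K = sqrt (c / \<delta>) / \<phi> $ a"
  have K: "K > 0" using c \<delta> \<phi>_pos[of a] by (simp add: K_def)
  have Kp: "(K * \<phi> $ a)\<^sup>2 = c / \<delta>" using c \<delta> \<phi>_pos[of a] by (simp add: K_def)
  have "\<forall>\<^sub>F \<nu> in sequentially. tot \<nu> / N \<nu> (fst a) < c"
    by (rule order_tendstoD(2)[OF tot_ratio]) (simp add: c_def)
  then have "\<forall>\<^sub>F \<nu> in sequentially. tot \<nu> / N \<nu> (fst a) / (K * \<phi> $ a)\<^sup>2 \<le> \<delta>"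
  proof eventually_elim
    case (elim \<nu>)
    then have "tot \<nu> / N \<nu> (fst a) / (c / \<delta>) \<le> c / (c / \<delta>)" using c \<delta> by (intro divide_right_mono) auto
    then show ?case unfolding Kp using c by simp
  qed
  with K show ?thesis using that by blast
qed

lemma tight_Z1: "L1.tight (\<lambda>r. Z1 r $ a)"
  unfolding L1.tight_def
proof (intro allI impI)
  fix \<delta> :: real assume "\<delta> > 0"
  then obtain K where K: "0 < K" "\<forall>\<^sub>F \<nu> in sequentially. tot \<nu> / N \<nu> (fst a) / (K * \<phi> $ a)\<^sup>2 \<le> \<delta>"
    by (rule bounding_radius)
  from K(2) have "\<forall>\<^sub>F \<nu> in sequentially. big1 \<nu> \<delta> (\<lambda>\<omega>. \<bar>Z1 (\<nu>, \<omega>) $ a\<bar> \<le> K)"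
  proof eventually_elim
    case (elim \<nu>)
    interpret G: group_sample M X "N \<nu>" P by (rule gs)
    let ?B = "{\<omega> \<in> space M. \<bar>Z1 (\<nu>, \<omega>) $ a\<bar> < K}"
    have "(\<lambda>\<omega>. Z1 (\<nu>, \<omega>) $ a) \<in> borel_measurable M" unfolding Z1_nth using measurable_Fh by simp
    then have B: "?B \<in> events" by measurable
    have "1 - tot \<nu> / N \<nu> (fst a) / (K * \<phi> $ a)\<^sup>2 \<le> prob ?B"
      using G.prob_sum_infl_bounded[OF \<phi>_pos K(1), of a q] by (simp add: Z1_def tot_def)
    then show ?case unfolding big1_def using B elim by (intro bexI[of _ ?B]) auto
  qed
  then show "\<exists>K. \<forall>\<^sub>F \<nu> in sequentially. big1 \<nu> \<delta> (\<lambda>\<omega>. \<bar>Z1 (\<nu>, \<omega>) $ a\<bar> \<le> K)" ..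
qed

lemma tight_Z2: "L2.tight (\<lambda>r. Z2 r $ a)"
  unfolding L2.tight_def
proof (intro allI impI)
  fix \<delta> :: real assume \<delta>: "\<delta> > 0"
  then obtain K where K: "0 < K" "\<forall>\<^sub>F \<nu> in sequentially. tot \<nu> / N \<nu> (fst a) / (K * \<phi> $ a)\<^sup>2 \<le> \<delta>"
    by (rule bounding_radius)
  from K(2) have "\<forall>\<^sub>F \<nu> in sequentially. big2 \<nu> \<delta> (\<lambda>x. \<bar>Z2 (\<nu>, x) $ a\<bar> \<le> K)"
  proof eventually_elim
    case (elim \<nu>)
    have "1 - \<delta> \<le> boot_prob (N \<nu>) (dat (\<nu>, \<omega>)) (\<lambda>s'. \<bar>Z2 (\<nu>, \<omega>, s') $ a\<bar> \<le> K)" for \<omega>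
    proof -
      have "1 - tot \<nu> / N \<nu> (fst a) / (K * \<phi> $ a)\<^sup>2 \<le> boot_prob (N \<nu>) (dat (\<nu>, \<omega>)) (\<lambda>s'. \<bar>Z2 (\<nu>, \<omega>, s') $ a\<bar> < K)"
        using group_sample.prob_sum_infl_bounded[OF gs_boot[of \<nu> "dat (\<nu>, \<omega>)"] \<phi>_pos K(1), of a q]
        by (simp add: Z2_def tot_def boot_prob_def proj_def)
      also have "\<dots> \<le> boot_prob (N \<nu>) (dat (\<nu>, \<omega>)) (\<lambda>s'. \<bar>Z2 (\<nu>, \<omega>, s') $ a\<bar> \<le> K)"
        by (rule boot_prob_mono) simp
      finally show ?thesis using elim by simp
    qed
    then show ?case unfolding big2_def by (intro big1_all \<delta>)
  qed
  then show "\<exists>K. \<forall>\<^sub>F \<nu> in sequentially. big2 \<nu> \<delta> (\<lambda>x. \<bar>Z2 (\<nu>, x) $ a\<bar> \<le> K)" ..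
qed

lemma tight_lift:
  assumes "L1.tight V" shows "L2.tight (\<lambda>r. V (proj r))"
  unfolding L2.tight_def
proof (intro allI impI)
  fix \<delta> :: real assume \<delta>: "\<delta> > 0"
  then obtain K where "\<forall>\<^sub>F n in sequentially. big1 n \<delta> (\<lambda>x. \<bar>V (n, x)\<bar> \<le> K)"
    using assms unfolding L1.tight_def by blast
  then have "\<forall>\<^sub>F n in sequentially. big2 n \<delta> (\<lambda>x. \<bar>V (proj (n, x))\<bar> \<le> K)"
  proof eventually_elim
    case (elim n)
    then show ?case unfolding big2_def
      by (rule big1_mono) (use \<delta> in \<open>simp add: proj_def boot_prob_True\<close>)
  qed
  then show "\<exists>K. \<forall>\<^sub>F n in sequentially. big2 n \<delta> (\<lambda>x. \<bar>V (proj (n, x))\<bar> \<le> K)" ..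
qed

lemma bahadur_data: "((\<lambda>r. Y1 r $ a - Z1 r $ a) \<longlongrightarrow> 0) L1.LF"
proof -
  have "((\<lambda>r. sqrt (tot (fst r)) * (emp_quantiles p (N (fst r)) (dat r) $ a - q $ a) - sqrt (tot (fst r)) * (p - Fh r a (q $ a)) / \<phi> $ a) \<longlongrightarrow> 0) L1.LF"
  proof (rule L1.bahadur[OF _ sqrt_tot_at_top \<phi>_pos F_deriv])
    show "emp_quantiles p (N (fst r)) (dat r) $ a \<le> y \<longleftrightarrow> p \<le> Fh r a y" for r y
      unfolding emp_quantiles_def Fh_def by (simp add: ecdf_quantile_le_iff sizes p)
    show "L1.tight (\<lambda>r. sqrt (tot (fst r)) * (p - Fh r a (q $ a)) / \<phi> $ a)"
      using tight_Z1[of a] by (simp add: Z1_nth)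
  qed (use increment_data[of a] in \<open>simp add: step_def\<close>)
  then show ?thesis by (simp add: Y1_def Z1_nth)
qed

lemma bahadur_boot: "((\<lambda>r. Y2 r $ a - Z2 r $ a) \<longlongrightarrow> 0) L2.LF"
proof -
  let ?W = "\<lambda>r. sqrt (tot (fst r)) * (p - Fb r a (q $ a)) / \<phi> $ a"
  \<comment> \<open>Splitting p - Fb into (Fh - Fb) + (p - Fh) gives tightness, and the second part
    is exactly what the expansion of the empirical quantile removes.\<close>
  have W: "?W r = Z2 r $ a + Z1 (proj r) $ a" for r
    by (simp add: Z2_nth Z1_nth proj_def add_divide_distrib[symmetric] distrib_left[symmetric])
  have "((\<lambda>r. sqrt (tot (fst r)) * (emp_quantiles p (N (fst r)) (snd (snd r)) $ a - q $ a) - ?W r) \<longlongrightarrow> 0) L2.LF"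
  proof (rule L2.bahadur[OF _ sqrt_tot_at_top \<phi>_pos F_deriv])
    show "emp_quantiles p (N (fst r)) (snd (snd r)) $ a \<le> y \<longleftrightarrow> p \<le> Fb r a y" for r :: "nat \<times> 'a \<times> ('g, 'c) sample" and y
      unfolding emp_quantiles_def Fb_def by (simp add: ecdf_quantile_le_iff sizes p)
    show "L2.tight ?W"
      unfolding W by (intro L2.tight_add tight_Z2 tight_lift tight_Z1)
  qed (use increment_boot[of a] in \<open>simp add: step_def\<close>)
  from tendsto_diff[OF this filterlim_compose[OF bahadur_data filterlim_proj, of a]]
  show ?thesis
    unfolding W by (simp add: Y2_def Y1_def proj_def algebra_simps)
qed

subsection \<open>Convergence of the covariance matrices\<close>

lemma law_of_large_numbers:
  fixes g :: "real ^ 'c \<Rightarrow> real"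
  assumes g: "g \<in> borel_measurable borel" "\<And>y. \<bar>g y\<bar> \<le> 1"
  shows "((\<lambda>r. gmean (N (fst r) i) (X i) g (snd r)) \<longlongrightarrow> (\<integral>y. g y \<partial>P i)) L1.LF"
proof -
  have "((\<lambda>r. gmean (N (fst r) i) (X i) g (snd r) - (\<integral>y. g y \<partial>P i)) \<longlongrightarrow> 0) L1.LF"
  \<comment> \<open>Chebyshev's bound 1 / (n_i \<epsilon>^2), written with the convergent ratio N /
    n_i.\<close>
  proof (rule tendsto_L1_zeroI[where v = "\<lambda>\<epsilon> \<nu>. tot \<nu> / N \<nu> i * (1 / tot \<nu>) / \<epsilon>\<^sup>2"])
    fix \<epsilon> :: real assume \<epsilon>: "\<epsilon> > 0"
    have "(\<lambda>\<nu>. tot \<nu> / N \<nu> i * (1 / tot \<nu>) / \<epsilon>\<^sup>2) \<longlonglongrightarrow> inverse (\<kappa> i) * 0 / \<epsilon>\<^sup>2"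
      using \<epsilon> by (intro tendsto_divide tendsto_mult tendsto_const tot_ratio inverse_tot) simp
    then show "(\<lambda>\<nu>. tot \<nu> / N \<nu> i * (1 / tot \<nu>) / \<epsilon>\<^sup>2) \<longlonglongrightarrow> 0" by simp
  next
    fix \<epsilon> :: real and \<nu> assume \<epsilon>: "\<epsilon> > 0"
    interpret G: group_sample M X "N \<nu>" P by (rule gs)
    have sq: "(g y)\<^sup>2 \<le> 1" for y using power_mono[OF g(2)[of y], of 2] by simp
    have "(\<integral>y. (g y)\<^sup>2 \<partial>P i) \<le> (\<integral>y. 1 \<partial>P i)"
      using g sq by (intro integral_mono G.integrable_law[where B = 1]) auto
    then have "(\<integral>y. (g y)\<^sup>2 \<partial>P i) \<le> 1" by (simp only: G.prob_law)
    then have "(\<integral>y. (g y)\<^sup>2 \<partial>P i) / (N \<nu> i * \<epsilon>\<^sup>2) \<le> 1 / (N \<nu> i * \<epsilon>\<^sup>2)" by (intro divide_right_mono) auto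
    moreover have "tot \<nu> / N \<nu> i * (1 / tot \<nu>) / \<epsilon>\<^sup>2 = 1 / (N \<nu> i * \<epsilon>\<^sup>2)" using tot_pos[of \<nu>] by simp
    ultimately show "1 - tot \<nu> / N \<nu> i * (1 / tot \<nu>) / \<epsilon>\<^sup>2 \<le> prob {\<omega> \<in> space M. \<bar>gmean (N (fst (\<nu>, \<omega>)) i) (X i) g (snd (\<nu>, \<omega>)) - (\<integral>y. g y \<partial>P i)\<bar> < \<epsilon>}"
      using G.prob_gmean_close[OF g \<epsilon>, of i] by simp
  next
    fix \<nu>
    interpret G: group_sample M X "N \<nu>" P by (rule gs)
    have "gmean (N \<nu> i) (X i) g \<in> borel_measurable M" by (rule G.measurable_gmean) (rule g)
    then show "(\<lambda>\<omega>. gmean (N (fst (\<nu>, \<omega>)) i) (X i) g (snd (\<nu>, \<omega>)) - (\<integral>y. g y \<partial>P i)) \<in> borel_measurable M"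
      by simp
  qed
  then show ?thesis by (rule LIM_zero_cancel)
qed

abbreviation "\<Sigma> \<equiv> quantile_cov p \<kappa> P f"

lemma J0_diag: "group_sample.J0 P q a a = p"
proof -
  interpret G: group_sample M X "N 0" P by (rule gs)
  have "G.J0 q a a = G.F0 q a" by (simp add: G.J0_def G.F0_def below_bounds flip: power2_eq_square)
  then show ?thesis by (simp add: F0_eq F_q)
qed

text \<open>The diagonal case falls under the same formula because the joint distribution function
  of a coordinate with itself equals p at the quantile.\<close>

lemma Sigma_nth:
  "\<Sigma> $ a $ b = (if fst a = fst b
     then inverse (\<kappa> (fst a)) * ((group_sample.J0 P q a b - p * p) / (\<phi> $ a * \<phi> $ b)) else 0)"
proof (cases "fst a = fst b")
  case True
  show ?thesis
  proof (cases "snd a = snd b")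
    case s: True
    then have "b = a" using True by (simp add: prod_eq_iff)
    then show ?thesis
      by (simp add: quantile_cov_def Let_def J0_diag \<phi>_def power2_eq_square divide_inverse mult_ac flip: q_eq)
  next
    case False
    moreover have "(fst b, snd a) = a" using True by (simp add: prod_eq_iff)
    ultimately show ?thesis using True J0_eq[OF True]
      by (simp add: quantile_cov_def Let_def \<phi>_def power2_eq_square divide_inverse mult_ac flip: q_eq)
  qed
qed (simp add: quantile_cov_def Let_def)

lemma Sigma_diag_pos: "0 < \<Sigma> $ a $ a"
proof -
  have "p * p < p * 1" using p by (intro mult_strict_left_mono) auto
  then show ?thesis using A1(2)[of "fst a"] \<phi>_pos[of a] by (simp add: Sigma_nth J0_diag)
qed

lemma cov_data: "(\<lambda>\<nu>. group_sample.cov0 (N \<nu>) P q \<phi>) \<longlonglongrightarrow> \<Sigma>"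
proof (intro vec_tendstoI)
  fix a b
  have e: "group_sample.cov0 (N \<nu>) P q \<phi> $ a $ b = (if fst a = fst b
     then tot \<nu> / N \<nu> (fst a) * ((group_sample.J0 P q a b - p * p) / (\<phi> $ a * \<phi> $ b)) else 0)" for \<nu>
    unfolding group_sample.cov0_def[OF gs] by (simp add: F0_eq F_q tot_def)
  show "(\<lambda>\<nu>. group_sample.cov0 (N \<nu>) P q \<phi> $ a $ b) \<longlonglongrightarrow> \<Sigma> $ a $ b"
  proof (cases "fst a = fst b")
    case True
    show ?thesis unfolding e Sigma_nth if_P[OF True] by (intro tendsto_mult tendsto_const tot_ratio)
  qed (simp add: e Sigma_nth)
qed

lemma psd_Sigma: "psd \<Sigma>"
proof -
  have "0 \<le> t \<bullet> (\<Sigma> *v t)" for t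
  proof (rule tendsto_lowerbound)
    show "(\<lambda>\<nu>. t \<bullet> (group_sample.cov0 (N \<nu>) P q \<phi> *v t)) \<longlonglongrightarrow> t \<bullet> (\<Sigma> *v t)"
      unfolding inner_vec_def matrix_vector_mult_def
      by (simp, intro tendsto_sum tendsto_mult tendsto_const tendsto_vec_nth cov_data)
    show "\<forall>\<^sub>F \<nu> in sequentially. 0 \<le> t \<bullet> (group_sample.cov0 (N \<nu>) P q \<phi> *v t)"
      using group_sample.psd_cov0[OF gs] by (simp add: psd_def)
  qed simp
  moreover have "transpose \<Sigma> = \<Sigma>"
  proof -
    interpret G: group_sample M X "N 0" P by (rule gs)
    have "\<Sigma> $ b $ a = \<Sigma> $ a $ b" for a b by (auto simp: Sigma_nth G.J0_def mult.commute)
    then show ?thesis by (simp add: transpose_def vec_eq_iff)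
  qed
  ultimately show ?thesis by (simp add: psd_def)
qed

text \<open>All indicators are evaluated at the fixed point \<open>q\<close>, so the law of large
  numbers for finitely many bounded functions suffices, without uniformity in the threshold.\<close>

lemma cov_boot:
  "((\<lambda>r. group_sample.cov0 (N (fst r)) (emp_law (N (fst r)) (dat r)) q \<phi>) \<longlongrightarrow> \<Sigma>) L1.LF"
proof (intro vec_tendstoI)
  fix a b
  interpret G: group_sample M X "N 0" P by (rule gs)
  have F: "((\<lambda>r. Fh r c (q $ c)) \<longlongrightarrow> p) L1.LF" for c
    using law_of_large_numbers[of "below q c" "fst c"] F0_eq[of q c]
    by (simp add: below_bounds gmean_data G.F0_def F_q)
  have e: "group_sample.cov0 (N (fst r)) (emp_law (N (fst r)) (dat r)) q \<phi> $ a $ b = (if fst a = fst b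
     then tot (fst r) / N (fst r) (fst a) * ((gmean (N (fst r) (fst a)) (X (fst a)) (\<lambda>y. below q a y * below q b y) (snd r)
        - Fh r a (q $ a) * Fh r b (q $ b)) / (\<phi> $ a * \<phi> $ b)) else 0)" for r
  proof -
    interpret B: group_sample "measure_pmf (boot_pmf (N (fst r)) (dat r))" "\<lambda>i j s'. s' (i, j)" "N (fst r)" "emp_law (N (fst r)) (dat r)"
      by (rule gs_boot)
    have "B.J0 q a b = (\<Sum>j<N (fst r) (fst a). below q a (dat r (fst a, j)) * below q b (dat r (fst a, j))) / N (fst r) (fst a)"
      unfolding B.J0_def by (rule integral_emp_law) (auto simp: sizes)
    also have "\<dots> = gmean (N (fst r) (fst a)) (X (fst a)) (\<lambda>y. below q a y * below q b y) (snd r)"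
      by (simp add: gmean_def dat_obs)
    finally show ?thesis by (simp add: B.cov0_def F0_boot_eq tot_def)
  qed
  have J: "((\<lambda>r. gmean (N (fst r) (fst a)) (X (fst a)) (\<lambda>y. below q a y * below q b y) (snd r)) \<longlongrightarrow> G.J0 q a b) L1.LF"
    unfolding G.J0_def by (rule law_of_large_numbers) (auto simp: below_bounds abs_mult mult_le_one)
  show "((\<lambda>r. group_sample.cov0 (N (fst r)) (emp_law (N (fst r)) (dat r)) q \<phi> $ a $ b) \<longlongrightarrow> \<Sigma> $ a $ b) L1.LF"
  proof (cases "fst a = fst b")
    case True
    show ?thesis unfolding e Sigma_nth if_P[OF True]
      using \<phi>_pos[of a] \<phi>_pos[of b]
      by (intro tendsto_mult tendsto_divide[OF tendsto_diff tendsto_const] F J L1.tendsto_LF_det[OF tot_ratio]) simp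
  qed (simp add: e Sigma_nth)
qed

subsection \<open>Limit laws\<close>

context
  fixes \<Gamma> R :: "real ^ ('g \<times> 'c) ^ ('g \<times> 'c)" and lam :: "'g \<times> 'c \<Rightarrow> real"
  assumes \<Gamma>: "\<Gamma> = transpose R ** R" and R: "R ** \<Sigma> ** transpose R = diagm lam" and lam: "\<And>a. 0 \<le> lam a"
begin

lemma quadratic_form_norm: "z \<bullet> (\<Gamma> *v z) = (norm (R *v z))\<^sup>2"
proof -
  have "z \<bullet> (\<Gamma> *v z) = (R *v z) \<bullet> (R *v z)"
    unfolding \<Gamma> by (metis inner_commute inner_transpose matrix_vector_mul_assoc)
  then show ?thesis by (simp add: dot_square_norm)
qed

lemma borel_measurable_norm_linear: "(\<lambda>z :: real ^ ('g \<times> 'c). (norm (R *v z))\<^sup>2) \<in> borel_measurable borel"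
  by (intro borel_measurable_continuous_onI continuous_intros matrix_vector_mult_linear_continuous_on)

text \<open>The Laplace transforms determine the limit for the linearized form |R Z1|^2; Slutsky's
  lemma bounds its distance to the form in \<open>Y1\<close> with the random weight.\<close>

lemma data_limit:
  assumes G: "(G \<longlongrightarrow> \<Gamma>) L1.LF"
    and m: "\<And>\<nu>. (\<lambda>\<omega>. Y1 (\<nu>, \<omega>) \<bullet> (G (\<nu>, \<omega>) *v Y1 (\<nu>, \<omega>))) \<in> borel_measurable M"
    and cont: "isCont (cdf (chi2_mixture lam)) t"
  shows "(\<lambda>\<nu>. prob {\<omega> \<in> space M. Y1 (\<nu>, \<omega>) \<bullet> (G (\<nu>, \<omega>) *v Y1 (\<nu>, \<omega>)) \<le> t}) \<longlonglongrightarrow> cdf (chi2_mixture lam) t"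
proof -
  let ?L = "chi2_mixture lam" and ?Q = "\<lambda>\<nu> \<omega>. (norm (R *v Z1 (\<nu>, \<omega>)))\<^sup>2"
  have mQ: "?Q \<nu> \<in> borel_measurable M" for \<nu>
  proof -
    have "(\<lambda>\<omega>. Z1 (\<nu>, \<omega>)) \<in> borel_measurable M"
      unfolding Z1_def by simp (intro borel_measurable_sum group_sample.measurable_infl[OF gs])
    then show ?thesis by (rule measurable_compose[OF _ borel_measurable_norm_linear])
  qed
  have lap: "(\<lambda>\<nu>. \<integral>\<omega>. exp (- (real k * ?Q \<nu> \<omega>)) \<partial>M) \<longlonglongrightarrow> (\<integral>u. exp (- (real k * u)) \<partial>?L)" for k
    unfolding Z1_def fst_conv snd_conv
    by (rule laplace_linearized_tendsto[OF gs \<phi>_pos psd_Sigma cov_data _ _ R lam])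
      (use inverse_tot tot_ratio in \<open>auto simp: tot_def\<close>)
  note sand = laplace_cdf_sandwich[OF prob_space_axioms real_distribution_chi2_mixture mQ _ AE_chi2_mixture[OF lam] lap]
  show ?thesis
  proof (rule cdf_limit_perturbed[OF prob_space_axioms _ _ mQ m _ cont])
    fix \<eta> \<delta> :: real assume \<eta>: "\<eta> > 0" and \<delta>: "\<delta> > 0"
    have "((\<lambda>r. Y1 r \<bullet> (G r *v Y1 r) - Z1 r \<bullet> (\<Gamma> *v Z1 r)) \<longlongrightarrow> 0) L1.LF"
      by (rule L1.slutsky_quadratic_form[OF bahadur_data tight_Z1 G])
    from tendstoD[OF this \<eta>]
    have "\<forall>\<^sub>F \<nu> in sequentially. big1 \<nu> \<delta> (\<lambda>\<omega>. dist (Y1 (\<nu>, \<omega>) \<bullet> (G (\<nu>, \<omega>) *v Y1 (\<nu>, \<omega>)) - Z1 (\<nu>, \<omega>) \<bullet> (\<Gamma> *v Z1 (\<nu>, \<omega>))) 0 < \<eta>)"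
      using \<delta> unfolding L1.eventually_LF by simp
    then show "\<forall>\<^sub>F \<nu> in sequentially. \<exists>B\<in>events. 1 - \<delta> \<le> prob B \<and> (\<forall>\<omega>\<in>B. \<bar>Y1 (\<nu>, \<omega>) \<bullet> (G (\<nu>, \<omega>) *v Y1 (\<nu>, \<omega>)) - ?Q \<nu> \<omega>\<bar> \<le> \<eta>)"
      unfolding quadratic_form_norm big1_def dist_real_def
      by (rule eventually_mono) (fastforce intro: less_imp_le)
  qed (rule sand; simp)+
qed

text \<open>The conditional laws are ordinary measures indexed by stage and outcome, and the
  abstract limit theorems are applied along the filter of the data. The covariance they require
  converges only in probability, which is convergence along this filter.\<close>

lemma boot_limit:
  assumes G: "(G \<longlongrightarrow> \<Gamma>) L2.LF" and cont: "isCont (cdf (chi2_mixture lam)) t"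
  shows "((\<lambda>r. boot_prob (N (fst r)) (dat r) (\<lambda>s'. Y2 (fst r, snd r, s') \<bullet> (G (fst r, snd r, s') *v Y2 (fst r, snd r, s')) \<le> t))
     \<longlongrightarrow> cdf (chi2_mixture lam) t) L1.LF"
proof -
  let ?L = "chi2_mixture lam" and ?Q = "\<lambda>r s'. (norm (R *v Z2 (fst r, snd r, s')))\<^sup>2"
  let ?M = "\<lambda>r. measure_pmf (boot_pmf (N (fst r)) (dat r))"
  have lap: "((\<lambda>r. \<integral>s'. exp (- (real k * ?Q r s')) \<partial>?M r) \<longlongrightarrow> (\<integral>u. exp (- (real k * u)) \<partial>?L)) L1.LF" for k
    unfolding Z2_def fst_conv snd_conv proj_def prod.collapse
    by (rule laplace_linearized_tendsto[OF gs_boot \<phi>_pos psd_Sigma cov_boot _ _ R lam])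
      (use L1.tendsto_LF_det[OF inverse_tot] L1.tendsto_LF_det[OF tot_ratio] in \<open>auto simp: tot_def\<close>)
  note sand = laplace_cdf_sandwich[where M = ?M and Y = ?Q, OF measure_pmf.prob_space_axioms real_distribution_chi2_mixture _ _ AE_chi2_mixture[OF lam] lap]
  have "((\<lambda>r. measure (?M r) {s' \<in> space (?M r). Y2 (fst r, snd r, s') \<bullet> (G (fst r, snd r, s') *v Y2 (fst r, snd r, s')) \<le> t})
     \<longlongrightarrow> cdf ?L t) L1.LF"
  proof (rule cdf_limit_perturbed[where M = ?M and Y = ?Q, OF measure_pmf.prob_space_axioms _ _ _ _ _ cont])
    fix \<eta> \<delta> :: real assume \<eta>: "\<eta> > 0" and \<delta>: "\<delta> > 0"
    have "((\<lambda>r. Y2 r \<bullet> (G r *v Y2 r) - Z2 r \<bullet> (\<Gamma> *v Z2 r)) \<longlongrightarrow> 0) L2.LF"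
      by (rule L2.slutsky_quadratic_form[OF bahadur_boot tight_Z2 G])
    from eventually_L2_boot[OF tendstoD[OF this \<eta>] \<delta>]
    show "\<forall>\<^sub>F r in L1.LF. \<exists>B\<in>sets (?M r). 1 - \<delta> \<le> measure (?M r) B \<and> (\<forall>s'\<in>B. \<bar>Y2 (fst r, snd r, s') \<bullet> (G (fst r, snd r, s') *v Y2 (fst r, snd r, s')) - ?Q r s'\<bar> \<le> \<eta>)"
      unfolding quadratic_form_norm boot_prob_def dist_real_def
    proof (rule eventually_mono)
      fix r
      let ?B = "{s'. \<bar>Y2 (fst r, snd r, s') \<bullet> (G (fst r, snd r, s') *v Y2 (fst r, snd r, s')) - ?Q r s' - 0\<bar> < \<eta>}"
      assume "1 - \<delta> \<le> measure (?M r) ?B"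
      then show "\<exists>B\<in>sets (?M r). 1 - \<delta> \<le> measure (?M r) B \<and> (\<forall>s'\<in>B. \<bar>Y2 (fst r, snd r, s') \<bullet> (G (fst r, snd r, s') *v Y2 (fst r, snd r, s')) - ?Q r s'\<bar> \<le> \<eta>)"
        by (intro bexI[of _ ?B]) auto
    qed
  qed ((rule sand; simp) | simp)+
  then show ?thesis by (simp add: boot_prob_def)
qed

end

end

section \<open>Measurability of conditional probabilities and of their supremum\<close>

subsection \<open>Measurability\<close>

text \<open>Drawing indices with a law that does not depend on the data turns bootstrap probabilities
  into finite averages of measurable functions of the data.\<close>

definition resample :: "('g \<Rightarrow> nat) \<Rightarrow> ('g, 'c::finite) sample \<Rightarrow> ('g \<times> nat \<Rightarrow> nat) \<Rightarrow> ('g, 'c) sample" where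
  "resample n s \<sigma> = (\<lambda>x. if x \<in> obs_index n then s (fst x, \<sigma> x) else undefined)"

definition index_pmf :: "('g::finite \<Rightarrow> nat) \<Rightarrow> ('g \<times> nat \<Rightarrow> nat) pmf" where
  "index_pmf n = Pi_pmf (obs_index n) 0 (\<lambda>x. pmf_of_set {..<n (fst x)})"

lemma boot_pmf_eq_resample:
  fixes n :: "'g::finite \<Rightarrow> nat"
  shows "boot_pmf n s = map_pmf (resample n s) (index_pmf n)"
proof -
  have "boot_pmf n s = Pi_pmf (obs_index n) undefined (\<lambda>x. bind_pmf (pmf_of_set {..<n (fst x)}) (\<lambda>j. return_pmf (s (fst x, j))))"
    by (simp add: boot_pmf_def map_pmf_def split_def)
  also have "\<dots> = bind_pmf (index_pmf n) (\<lambda>\<sigma>. Pi_pmf (obs_index n) undefined (\<lambda>x. return_pmf (s (fst x, \<sigma> x))))"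
    unfolding index_pmf_def by (rule Pi_pmf_bind) simp
  also have "\<dots> = map_pmf (resample n s) (index_pmf n)"
    by (simp add: map_pmf_def resample_def[abs_def])
  finally show ?thesis .
qed

lemma finite_index_pmf:
  assumes "\<And>i. 0 < n i" shows "finite (set_pmf (index_pmf n))"
  unfolding index_pmf_def using assms
  by (subst set_Pi_pmf) (auto intro!: finite_PiE_dflt simp: lessThan_empty_iff)

lemma index_pmf_less:
  assumes "\<And>i. 0 < n i" "\<sigma> \<in> set_pmf (index_pmf n)" "x \<in> obs_index n"
  shows "\<sigma> x < n (fst x)"
  using assms unfolding index_pmf_def
  by (cases x, subst (asm) set_Pi_pmf) (auto simp: PiE_dflt_def lessThan_empty_iff)

lemma boot_prob_eq_sum:
  assumes "\<And>i. 0 < n i"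
  shows "boot_prob n s Q = (\<Sum>\<sigma>\<in>set_pmf (index_pmf n). (if Q (resample n s \<sigma>) then 1 else 0) * pmf (index_pmf n) \<sigma>)"
proof -
  have "boot_prob n s Q = measure_pmf.prob (index_pmf n) {\<sigma>. Q (resample n s \<sigma>)}"
    unfolding boot_prob_def boot_pmf_eq_resample by (simp add: vimage_def)
  also have "\<dots> = (\<integral>\<sigma>. indicator {\<sigma>. Q (resample n s \<sigma>)} \<sigma> \<partial>measure_pmf (index_pmf n))" by simp
  also have "\<dots> = (\<Sum>\<sigma>\<in>set_pmf (index_pmf n). pmf (index_pmf n) \<sigma> *\<^sub>R indicator {\<sigma>. Q (resample n s \<sigma>)} \<sigma>)"
    by (rule integral_measure_pmf) (auto simp: finite_index_pmf assms)
  finally show ?thesis by (simp add: indicator_def of_bool_def mult.commute)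
qed

lemma measurable_boot_prob:
  assumes n: "\<And>i. 0 < n i"
    and m: "\<And>\<sigma>. \<sigma> \<in> set_pmf (index_pmf n) \<Longrightarrow> {\<omega> \<in> space M. Q \<omega> (resample n (D \<omega>) \<sigma>)} \<in> sets M"
  shows "(\<lambda>\<omega>. boot_prob n (D \<omega>) (Q \<omega>)) \<in> borel_measurable M"
  unfolding boot_prob_eq_sum[OF n]
proof (intro borel_measurable_sum borel_measurable_times borel_measurable_const)
  fix \<sigma> assume "\<sigma> \<in> set_pmf (index_pmf n)"
  then show "(\<lambda>\<omega>. if Q \<omega> (resample n (D \<omega>) \<sigma>) then 1 else 0 :: real) \<in> borel_measurable M"
    by (intro measurable_If m) auto
qed

text \<open>The quantile equivalence turns sublevel sets of an empirical quantile into superlevel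
  sets of \<open>ecdf\<close> at a fixed point.\<close>

lemma measurable_emp_quantiles:
  assumes "\<And>i. 0 < n i" "0 < p" "p < 1"
  shows "emp_quantiles p n \<in> borel_measurable (Pi\<^sub>M (obs_index n) (\<lambda>_. borel :: (real ^ 'c::finite) measure))"
proof -
  let ?\<Pi> = "Pi\<^sub>M (obs_index n) (\<lambda>_. borel :: (real ^ 'c) measure)"
  have e: "(\<lambda>s. ecdf n s i l y) \<in> borel_measurable ?\<Pi>" for i l y
  proof -
    have m: "(\<lambda>s. s (i, j) $ l) \<in> borel_measurable ?\<Pi>" if "j < n i" for j
    proof -
      have "(\<lambda>s. s (i, j)) \<in> borel_measurable ?\<Pi>"
        by (rule measurable_component_singleton) (use that in \<open>simp add: obs_index_def\<close>)
      from measurable_compose[OF this borel_measurable_nth] show ?thesis .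
    qed
    have "ecdf n s i l y = (\<Sum>j<n i. if s (i, j) $ l \<le> y then 1 else 0) / n i" for s
      by (simp add: ecdf_def sum.If_cases Int_def)
    moreover have "(\<lambda>s. (\<Sum>j<n i. if s (i, j) $ l \<le> y then 1 else 0) / n i) \<in> borel_measurable ?\<Pi>"
      using m by (intro borel_measurable_divide borel_measurable_sum measurable_If borel_measurable_const borel_measurable_le) auto
    ultimately show ?thesis by simp
  qed
  have "(\<lambda>s. emp_quantiles p n s $ a) \<in> borel_measurable ?\<Pi>" for a
    unfolding borel_measurable_iff_le
  proof
    fix y
    have "{s \<in> space ?\<Pi>. emp_quantiles p n s $ a \<le> y} = {s \<in> space ?\<Pi>. p \<le> ecdf n s (fst a) (snd a) y}"
      by (simp add: emp_quantiles_def ecdf_quantile_le_iff assms)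
    also have "\<dots> \<in> sets ?\<Pi>" using e[of "fst a" "snd a" y] by measurable
    finally show "{s \<in> space ?\<Pi>. emp_quantiles p n s $ a \<le> y} \<in> sets ?\<Pi>" .
  qed
  then show ?thesis
    by (subst borel_measurable_euclidean_space) (auto simp: Basis_vec_def inner_axis)
qed

lemma borel_measurable_matrix_nth: "(\<lambda>A :: real ^ 'n::finite ^ 'm::finite. A $ i $ j) \<in> borel_measurable borel"
  by (intro borel_measurable_continuous_onI continuous_intros)

lemma measurable_quad_stat:
  assumes E: "E T \<in> borel_measurable borel" and A: "A \<in> borel_measurable M" and v: "v \<in> borel_measurable M"
  shows "(\<lambda>\<omega>. quad_stat E n T (A \<omega>) (v \<omega>)) \<in> borel_measurable M"
proof -
  have e: "(\<lambda>\<omega>. E T (A \<omega>) $ i $ j) \<in> borel_measurable M" for i j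
    by (rule measurable_compose[OF measurable_compose[OF A E] borel_measurable_matrix_nth])
  have w: "(\<lambda>\<omega>. v \<omega> $ i) \<in> borel_measurable M" for i
    by (rule measurable_compose[OF v borel_measurable_nth])
  show ?thesis
    unfolding quad_stat_def inner_vec_def matrix_vector_mult_def vec_lambda_beta inner_real_def
    by (intro borel_measurable_times borel_measurable_sum borel_measurable_const e w)
qed

text \<open>A value above c persists to the right of x and is therefore found at a rational point,
  so the uncountable supremum reduces to countably many conditions.\<close>

lemma measurable_SUP_right_continuous:
  fixes h :: "'a \<Rightarrow> real \<Rightarrow> real"
  assumes m: "\<And>x. (\<lambda>\<omega>. h \<omega> x) \<in> borel_measurable M"
    and b: "\<And>\<omega> x. h \<omega> x \<le> B" and rc: "\<And>\<omega> x. continuous (at_right x) (h \<omega>)"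
  shows "(\<lambda>\<omega>. SUP x. h \<omega> x) \<in> borel_measurable M"
  unfolding borel_measurable_iff_le
proof
  fix c
  have "(SUP x. h \<omega> x) \<le> c \<longleftrightarrow> (\<forall>x\<in>\<rat>. h \<omega> x \<le> c)" for \<omega>
  proof -
    have "(SUP x. h \<omega> x) \<le> c \<longleftrightarrow> (\<forall>x. h \<omega> x \<le> c)"
      by (subst cSUP_le_iff) (auto intro!: bdd_aboveI2 b)
    also have "\<dots> \<longleftrightarrow> (\<forall>x\<in>\<rat>. h \<omega> x \<le> c)"
    proof (intro iffI ballI allI)
      fix x assume r: "\<forall>x\<in>\<rat>. h \<omega> x \<le> c"
      show "h \<omega> x \<le> c"
      proof (rule ccontr)
        assume "\<not> ?thesis"
        then have "eventually (\<lambda>y. c < h \<omega> y) (at_right x)"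
          using rc[of x \<omega>] by (intro order_tendstoD(1)[of _ "h \<omega> x"]) (auto simp: continuous_within)
        then obtain d where d: "x < d" "\<And>y. x < y \<Longrightarrow> y < d \<Longrightarrow> c < h \<omega> y"
          unfolding eventually_at_right_field by auto
        obtain y where "y \<in> \<rat>" "x < y" "y < d" using Rats_dense_in_real[OF d(1)] by blast
        then show False using d(2) r by fastforce
      qed
    qed auto
    finally show ?thesis .
  qed
  then have "{\<omega> \<in> space M. (SUP x. h \<omega> x) \<le> c} = {\<omega> \<in> space M. \<forall>x\<in>\<rat>. h \<omega> x \<le> c}" by simp
  also have "\<dots> \<in> sets M"
    by (intro sets.sets_Collect_countable_All' countable_rat) (use m in measurable)
  finally show "{\<omega> \<in> space M. (SUP x. h \<omega> x) \<le> c} \<in> sets M" .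
qed

lemma boot_prob_eq_cdf:
  "boot_prob n s (\<lambda>s'. W s' \<le> x) = cdf (distr (measure_pmf (boot_pmf n s)) borel W) x"
  by (simp add: boot_prob_def cdf_def measure_distr vimage_def)

lemma real_distribution_boot: "real_distribution (distr (measure_pmf (boot_pmf n s)) borel (W :: _ \<Rightarrow> real))"
  by (intro prob_space.real_distribution_distr measure_pmf.prob_space_axioms) simp

lemma quad_stat_eq:
  assumes "transpose T = T"
  shows "quad_stat E n T A v = (sqrt (real (total_size n)) *\<^sub>R v) \<bullet> ((T ** E T A ** T) *v (sqrt (real (total_size n)) *\<^sub>R v))"
proof -
  have "v \<bullet> ((T ** E T A ** T) *v v) = (transpose T *v v) \<bullet> (E T A *v (T *v v))"
    by (simp only: inner_transpose flip: matrix_vector_mul_assoc)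
  then show ?thesis using assms by (simp add: quad_stat_def matrix_vector_mult_scaleR)
qed

lemma cdf_chi2_mixture_zero: "cdf (chi2_mixture (\<lambda>_ :: 'a::finite. 0)) x = (if 0 \<le> x then 1 else 0)"
  by (simp add: chi2_mixture_def cdf_def measure_return)

section \<open>Translation between the filters and convergence in probability\<close>

context quantile_model
begin

lemma tendsto_imp_conv_in_prob:
  assumes Z: "(Z \<longlongrightarrow> c) L1.LF" and m: "\<And>\<nu>. (\<lambda>\<omega>. Z (\<nu>, \<omega>)) \<in> borel_measurable M"
  shows "conv_in_prob M (\<lambda>\<nu> \<omega>. Z (\<nu>, \<omega>)) c"
  unfolding conv_in_prob_def
proof (intro conjI allI impI m)
  fix \<epsilon> :: real assume \<epsilon>: "\<epsilon> > 0"
  show "(\<lambda>\<nu>. prob {\<omega> \<in> space M. \<epsilon> < dist (Z (\<nu>, \<omega>)) c}) \<longlonglongrightarrow> 0"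
  proof (rule tendstoI)
    fix \<delta> :: real assume \<delta>: "\<delta> > 0"
    have "\<forall>\<^sub>F \<nu> in sequentially. big1 \<nu> (\<delta> / 2) (\<lambda>\<omega>. dist (Z (\<nu>, \<omega>)) c < \<epsilon>)"
      using tendstoD[OF Z \<epsilon>] \<delta> unfolding L1.eventually_LF by simp
    then show "\<forall>\<^sub>F \<nu> in sequentially. dist (prob {\<omega> \<in> space M. \<epsilon> < dist (Z (\<nu>, \<omega>)) c}) 0 < \<delta>"
    proof eventually_elim
      case (elim \<nu>)
      then obtain B where B: "B \<in> events" "1 - \<delta> / 2 \<le> prob B" "\<And>\<omega>. \<omega> \<in> B \<Longrightarrow> dist (Z (\<nu>, \<omega>)) c < \<epsilon>"
        unfolding big1_def by auto
      have "prob {\<omega> \<in> space M. \<epsilon> < dist (Z (\<nu>, \<omega>)) c} \<le> prob (space M - B)"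
        using B(1,3) by (intro finite_measure_mono) (auto, force)
      then show ?case using B(1,2) \<delta> by (simp add: prob_compl dist_real_def)
    qed
  qed
qed

lemma conv_in_prob_imp_tendsto:
  assumes "conv_in_prob M Z c" shows "((\<lambda>r. Z (fst r) (snd r)) \<longlongrightarrow> c) L1.LF"
proof (rule tendstoI)
  fix \<epsilon> :: real assume \<epsilon>: "\<epsilon> > 0"
  have m: "Z \<nu> \<in> borel_measurable M" for \<nu> using assms by (simp add: conv_in_prob_def)
  have l: "(\<lambda>\<nu>. prob {\<omega> \<in> space M. \<epsilon> / 2 < dist (Z \<nu> \<omega>) c}) \<longlonglongrightarrow> 0"
    using assms[unfolded conv_in_prob_def, THEN conjunct2, rule_format, of "\<epsilon> / 2"] \<epsilon> by simp
  show "eventually (\<lambda>r. dist (Z (fst r) (snd r)) c < \<epsilon>) L1.LF"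
    unfolding L1.eventually_LF
  proof (intro allI impI)
    fix \<delta> :: real assume "\<delta> > 0"
    then have "\<forall>\<^sub>F \<nu> in sequentially. prob {\<omega> \<in> space M. \<epsilon> / 2 < dist (Z \<nu> \<omega>) c} < \<delta>"
      by (rule order_tendstoD(2)[OF l])
    then show "\<forall>\<^sub>F \<nu> in sequentially. big1 \<nu> \<delta> (\<lambda>\<omega>. dist (Z (fst (\<nu>, \<omega>)) (snd (\<nu>, \<omega>))) c < \<epsilon>)"
    proof eventually_elim
      case (elim \<nu>)
      \<comment> \<open>\<open>conv_in_prob\<close> controls strict exceedance only; off the event
        for \<epsilon> / 2 the distance is at most \<epsilon> / 2 and hence below
        \<epsilon>.\<close>
      let ?A = "{\<omega> \<in> space M. \<epsilon> / 2 < dist (Z \<nu> \<omega>) c}"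
      have "(\<lambda>\<omega>. dist (Z \<nu> \<omega>) c) \<in> borel_measurable M"
        by (rule measurable_compose[OF m borel_measurable_continuous_onI]) (intro continuous_intros)
      then have A: "?A \<in> events" by measurable
      then have "1 - \<delta> \<le> prob (space M - ?A)" using elim by (simp add: prob_compl)
      then show ?case unfolding big1_def
        using A \<epsilon> by (intro bexI[of _ "space M - ?A"]) auto
    qed
  qed
qed

lemma boot_prob_not: "boot_prob n s (\<lambda>s'. \<not> Q s') = 1 - boot_prob n s Q"
proof -
  have "{s'. \<not> Q s'} = space (measure_pmf (boot_pmf n s)) - {s'. Q s'}" by auto
  then show ?thesis unfolding boot_prob_def using measure_pmf.prob_compl[of "{s'. Q s'}" "boot_pmf n s"] by simp
qed

lemma boot_consistent_imp_tendsto: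
  fixes W :: "nat \<Rightarrow> ('g, 'c) sample \<Rightarrow> 'v::real_normed_vector"
  assumes "boot_consistent M N X W c"
  shows "((\<lambda>r. W (fst r) (snd (snd r))) \<longlongrightarrow> c) L2.LF"
proof (rule tendstoI)
  fix \<epsilon> :: real assume \<epsilon>: "\<epsilon> > 0"
  have l: "((\<lambda>r. boot_prob (N (fst r)) (dat r) (\<lambda>s'. \<epsilon> / 2 < norm (W (fst r) s' - c))) \<longlongrightarrow> 0) L1.LF"
  proof -
    have "\<epsilon> / 2 > 0" using \<epsilon> by simp
    from conv_in_prob_imp_tendsto[OF assms[unfolded boot_consistent_def, rule_format, OF this]]
    show ?thesis by (simp add: dat_def)
  qed
  show "eventually (\<lambda>r. dist (W (fst r) (snd (snd r))) c < \<epsilon>) L2.LF"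
  proof (rule boot_eventually_L2)
    fix \<delta> :: real assume "\<delta> > 0"
    from order_tendstoD(2)[OF l this]
    show "\<forall>\<^sub>F r in L1.LF. 1 - \<delta> \<le> boot_prob (N (fst r)) (dat r) (\<lambda>s'. dist (W (fst (fst r, snd r, s')) (snd (snd (fst r, snd r, s')))) c < \<epsilon>)"
    proof eventually_elim
      case (elim r)
      have "1 - \<delta> \<le> boot_prob (N (fst r)) (dat r) (\<lambda>s'. \<not> \<epsilon> / 2 < norm (W (fst r) s' - c))"
        using elim by (simp only: boot_prob_not)
      also have "\<dots> \<le> boot_prob (N (fst r)) (dat r) (\<lambda>s'. dist (W (fst r) s') c < \<epsilon>)"
        by (rule boot_prob_mono) (use \<epsilon> in \<open>auto simp: dist_norm\<close>)
      finally show ?case by simp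
    qed
  qed
qed

lemma measurable_data: "(\<lambda>\<omega>. dat (\<nu>, \<omega>)) \<in> M \<rightarrow>\<^sub>M Pi\<^sub>M (obs_index (N \<nu>)) (\<lambda>_. borel)"
proof -
  have "(\<lambda>\<omega>. \<lambda>x\<in>obs_index (N \<nu>). X (fst x) (snd x) \<omega>) \<in> M \<rightarrow>\<^sub>M Pi\<^sub>M (obs_index (N \<nu>)) (\<lambda>_. borel)"
    by (rule measurable_restrict) (use group_sample.measurable_obs[OF gs, of _ \<nu>] in \<open>auto simp: obs_index_def\<close>)
  then show ?thesis by (simp add: dat_def data_def split_def)
qed

lemma measurable_resample:
  assumes "\<sigma> \<in> set_pmf (index_pmf (N \<nu>))"
  shows "(\<lambda>\<omega>. resample (N \<nu>) (dat (\<nu>, \<omega>)) \<sigma>) \<in> M \<rightarrow>\<^sub>M Pi\<^sub>M (obs_index (N \<nu>)) (\<lambda>_. borel)"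
proof -
  have "(\<lambda>\<omega>. \<lambda>x\<in>obs_index (N \<nu>). dat (\<nu>, \<omega>) (fst x, \<sigma> x)) \<in> M \<rightarrow>\<^sub>M Pi\<^sub>M (obs_index (N \<nu>)) (\<lambda>_. borel)"
  proof (rule measurable_restrict)
    fix x assume "x \<in> obs_index (N \<nu>)"
    then have "(fst x, \<sigma> x) \<in> obs_index (N \<nu>)"
      using index_pmf_less[OF sizes(1) assms] by (simp add: obs_index_def)
    then show "(\<lambda>\<omega>. dat (\<nu>, \<omega>) (fst x, \<sigma> x)) \<in> borel_measurable M"
      by (rule measurable_compose[OF measurable_data measurable_component_singleton])
  qed
  then show ?thesis by (simp add: resample_def restrict_def)
qed

end

text \<open>\<open>Bstar\<close> is one and the same mixture under both hypotheses: the bootstrap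
  statistic is centred at the empirical quantiles, so T q does not enter its limit. The null
  hypothesis matters for the original statistic alone.\<close>

theorem theorem9:
  fixes M :: "'a measure"
    and X :: "'g::finite \<Rightarrow> nat \<Rightarrow> 'a \<Rightarrow> real ^ ('c::finite)"
    and P :: "'g \<Rightarrow> (real ^ 'c) measure"
    and f :: "'g \<Rightarrow> 'c \<Rightarrow> real \<Rightarrow> real"
    and p :: real
    and N :: "nat \<Rightarrow> 'g \<Rightarrow> nat"
    and \<kappa> :: "'g \<Rightarrow> real"
    and H :: "real ^ ('g \<times> 'c) ^ ('r::finite)"
    and T \<Sigma> :: "real ^ ('g \<times> 'c) ^ ('g \<times> 'c)"
    and Sighat :: "nat \<Rightarrow> ('g, 'c) sample \<Rightarrow> real ^ ('g \<times> 'c) ^ ('g \<times> 'c)"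
    and E :: "real ^ ('g \<times> 'c) ^ ('g \<times> 'c) \<Rightarrow> real ^ ('g \<times> 'c) ^ ('g \<times> 'c) \<Rightarrow>
              real ^ ('g \<times> 'c) ^ ('g \<times> 'c)"
    and q :: "real ^ ('g \<times> 'c)"
    and S :: "nat \<Rightarrow> 'a \<Rightarrow> real"
    and Sboot :: "nat \<Rightarrow> ('g, 'c) sample \<Rightarrow> ('g, 'c) sample \<Rightarrow> real"
  assumes "prob_space M"
    and p: "0 < p" "p < 1"
    and indep: "prob_space.indep_vars M (\<lambda>_. borel) (\<lambda>(i, j). X i j) UNIV"
    and law: "\<And>i j. distr M borel (X i j) = P i"
    and density: "\<And>i l t. 0 \<le> f i l t"
      "\<And>i l. distributed (P i) lborel (\<lambda>x. x $ l) (\<lambda>t. ennreal (f i l t))"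
    and sizes: "\<And>\<nu> i. 0 < N \<nu> i" "filterlim (\<lambda>\<nu>. total_size (N \<nu>)) at_top sequentially"
    and A1: "\<And>i. (\<lambda>\<nu>. real (N \<nu> i) / real (total_size (N \<nu>))) \<longlonglongrightarrow> \<kappa> i" "\<And>i. 0 < \<kappa> i"
    and q_def: "q = quantiles p P"
    and A2: "\<And>i l. \<forall>\<^sub>F t in nhds (q $ (i, l)).
                (marginal_cdf (P i) l has_real_derivative f i l t) (at t)"
      "\<And>i l. isCont (f i l) (q $ (i, l))"
      "\<And>i l. 0 < f i l (q $ (i, l))"
    and H: "H *v (\<chi> _. 1) = 0"
    and T_def: "T = contrast_proj H"
    and \<Sigma>_def: "\<Sigma> = quantile_cov p \<kappa> P f"
    and Sighat_meas:
      "\<And>\<nu>. Sighat \<nu> \<in> borel_measurable (Pi\<^sub>M (obs_index (N \<nu>)) (\<lambda>_. borel))"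
    and Sighat_consistent: "conv_in_prob M (\<lambda>\<nu> \<omega>. Sighat \<nu> (data (N \<nu>) X \<omega>)) \<Sigma>"
    and Sighat_boot_consistent: "boot_consistent M N X Sighat \<Sigma>"
    and E: "E = ATS_E \<or> E = MATS_E"
    and ATS_defined: "E = ATS_E \<Longrightarrow> trace (T ** \<Sigma> ** T) \<noteq> 0"
    and S_def: "S = (\<lambda>\<nu> \<omega>. quad_stat E (N \<nu>) T (Sighat \<nu> (data (N \<nu>) X \<omega>))
                               (emp_quantiles p (N \<nu>) (data (N \<nu>) X \<omega>)))"
    and Sboot_def: "Sboot = (\<lambda>\<nu> s s'. quad_stat E (N \<nu>) T (Sighat \<nu> s')
                               (emp_quantiles p (N \<nu>) s' - emp_quantiles p (N \<nu>) s))"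
  shows "\<exists>Bstar.
      real_distribution Bstar \<and>
      (\<forall>x. isCont (cdf Bstar) x \<longrightarrow>
         conv_in_prob M
           (\<lambda>\<nu> \<omega>. boot_prob (N \<nu>) (data (N \<nu>) X \<omega>)
                     (\<lambda>s'. Sboot \<nu> (data (N \<nu>) X \<omega>) s' \<le> x))
           (cdf Bstar x)) \<and>
      (T = 0 \<or> T ** \<Sigma> ** T \<noteq> 0 \<longrightarrow>
         conv_in_prob M
           (\<lambda>\<nu> \<omega>. SUP x. \<bar>boot_prob (N \<nu>) (data (N \<nu>) X \<omega>)
                            (\<lambda>s'. Sboot \<nu> (data (N \<nu>) X \<omega>) s' \<le> x) - cdf Bstar x\<bar>)
           0) \<and>
      (\<exists>lamstar :: 'g \<times> 'c \<Rightarrow> real. (\<forall>a. 0 \<le> lamstar a) \<and> Bstar = chi2_mixture lamstar) \<and>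
      (T *v q = 0 \<longrightarrow>
         (\<exists>lam :: 'g \<times> 'c \<Rightarrow> real.
            eigenvalue_family (E T \<Sigma> ** T ** \<Sigma> ** T) lam \<and> (\<forall>a. 0 \<le> lam a) \<and>
            weak_conv_m (\<lambda>\<nu>. distr M borel (S \<nu>)) (chi2_mixture lam) \<and>
            Bstar = chi2_mixture lam))"
proof -
  interpret prob_space M by fact
  interpret quantile_model M X P f p N \<kappa> q
  proof
    show "(marginal_cdf (P i) l has_real_derivative f i l (q $ (i, l))) (at (q $ (i, l)))" for i l
      using A2(1)[of i l] by (rule eventually_nhds_x_imp_x)
  qed (rule p indep law sizes A1 q_def A2(3))+
  interpret symmetric_projection T
    by standard (simp_all add: T_def contrast_proj_symmetric contrast_proj_idem)
  have E_meas: "E T \<in> borel_measurable borel" using E measurable_ATS measurable_MATS by auto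
  \<comment> \<open>Continuity at the single point \<Sigma> is enough: there the trace that ATS
    divides by is nonzero, and the diagonal on which MATS relies is positive.\<close>
  have E_lim: "((\<lambda>x. T ** E T (A x) ** T) \<longlongrightarrow> T ** E T \<Sigma> ** T) G" if A: "(A \<longlongrightarrow> \<Sigma>) G"
    for A :: "'x \<Rightarrow> real ^ ('g \<times> 'c) ^ ('g \<times> 'c)" and G
  proof -
    have "((\<lambda>x. E T (A x)) \<longlongrightarrow> E T \<Sigma>) G"
      using E
    proof
      assume "E = ATS_E" then show ?thesis using tendsto_ATS[OF ATS_defined A] by simp
    next
      assume "E = MATS_E" then show ?thesis using tendsto_MATS[OF _ A] Sigma_diag_pos \<Sigma>_def by simp
    qed
    then show ?thesis by (intro tendsto_intros)
  qed
  have V: "psd \<Sigma>" and V_pos: "0 < \<Sigma> $ a $ a" for a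
    using psd_Sigma Sigma_diag_pos \<Sigma>_def by auto
  define \<Gamma> where "\<Gamma> = T ** E T \<Sigma> ** T"
  have "psd \<Gamma>" unfolding \<Gamma>_def by (rule weight_psd[OF V E V_pos])
  then obtain R lam where R: "\<Gamma> = transpose R ** R" "R ** \<Sigma> ** transpose R = diagm lam"
    and lam: "\<And>a. 0 \<le> lam a" and ev: "eigenvalue_family (\<Gamma> ** \<Sigma>) lam"
    using V by (rule simultaneous_diagonalization) blast
  note lim_hyps = R(1) R(2)[unfolded \<Sigma>_def] lam
  let ?L = "chi2_mixture lam"
  let ?B = "\<lambda>r x. boot_prob (N (fst r)) (dat r) (\<lambda>s'. Sboot (fst r) (dat r) s' \<le> x)"
  have dat: "data (N \<nu>) X \<omega> = dat (\<nu>, \<omega>)" for \<nu> \<omega> by (simp add: dat_def)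
  define G1 where "G1 r = T ** E T (Sighat (fst r) (dat r)) ** T" for r
  define G2 where "G2 r = T ** E T (Sighat (fst r) (snd (snd r))) ** T" for r :: "nat \<times> 'a \<times> ('g, 'c) sample"
  have G1: "(G1 \<longlongrightarrow> \<Gamma>) L1.LF"
    unfolding G1_def \<Gamma>_def using conv_in_prob_imp_tendsto[OF Sighat_consistent] by (intro E_lim) (simp add: dat_def)
  have G2: "(G2 \<longlongrightarrow> \<Gamma>) L2.LF"
    unfolding G2_def \<Gamma>_def by (intro E_lim boot_consistent_imp_tendsto Sighat_boot_consistent)
  have Sboot: "Sboot (fst r) (dat r) s' = Y2 (fst r, snd r, s') \<bullet> (G2 (fst r, snd r, s') *v Y2 (fst r, snd r, s'))" for r s'
    by (simp add: Sboot_def quad_stat_eq[OF sym] Y2_def G2_def tot_def proj_def)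
  have boot: "((\<lambda>r. ?B r x) \<longlongrightarrow> cdf ?L x) L1.LF" if "isCont (cdf ?L) x" for x
    unfolding Sboot by (rule boot_limit[OF lim_hyps G2 that])
  have eq: "emp_quantiles p (N \<nu>) \<in> borel_measurable (Pi\<^sub>M (obs_index (N \<nu>)) (\<lambda>_. borel))" for \<nu>
    by (rule measurable_emp_quantiles) (rule sizes p)+
  have B_meas: "(\<lambda>\<omega>. ?B (\<nu>, \<omega>) x) \<in> borel_measurable M" for \<nu> x
    unfolding fst_conv
  proof (rule measurable_boot_prob[OF sizes(1)])
    fix \<sigma> assume \<sigma>: "\<sigma> \<in> set_pmf (index_pmf (N \<nu>))"
    \<comment> \<open>The data enter twice, through the resampled observations and through the
      empirical quantiles that centre the statistic.\<close>
    have "(\<lambda>\<omega>. Sboot \<nu> (dat (\<nu>, \<omega>)) (resample (N \<nu>) (dat (\<nu>, \<omega>)) \<sigma>)) \<in> borel_measurable M"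
      unfolding Sboot_def
      by (intro measurable_quad_stat E_meas borel_measurable_diff
          measurable_compose[OF measurable_resample[OF \<sigma>] Sighat_meas]
          measurable_compose[OF measurable_resample[OF \<sigma>] eq] measurable_compose[OF measurable_data eq])
    then show "{\<omega> \<in> space M. Sboot \<nu> (dat (\<nu>, \<omega>)) (resample (N \<nu>) (dat (\<nu>, \<omega>)) \<sigma>) \<le> x} \<in> events"
      by measurable
  qed
  have L: "real_distribution ?L" by (rule real_distribution_chi2_mixture)
  interpret L: real_distribution ?L by (rule L)
  have B_cdf: "?B r x = cdf (distr (measure_pmf (boot_pmf (N (fst r)) (dat r))) borel (Sboot (fst r) (dat r))) x" for r x
    by (rule boot_prob_eq_cdf)
  \<comment> \<open>What is excluded is MATS with T \<noteq> 0 and T \<Sigma> T = 0. The limit is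
    then the point mass at 0, whose distribution function jumps, and the convergence at continuity
    points remains.\<close>
  have sup: "conv_in_prob M (\<lambda>\<nu> \<omega>. SUP x. \<bar>?B (\<nu>, \<omega>) x - cdf ?L x\<bar>) 0" if T: "T = 0 \<or> T ** \<Sigma> ** T \<noteq> 0"
  proof (rule tendsto_imp_conv_in_prob)
    let ?D = "\<lambda>r. distr (measure_pmf (boot_pmf (N (fst r)) (dat r))) borel (Sboot (fst r) (dat r))"
    have D: "real_distribution (?D r)" for r by (rule real_distribution_boot)
    show "(\<lambda>\<omega>. SUP x. \<bar>?B (\<nu>, \<omega>) x - cdf ?L x\<bar>) \<in> borel_measurable M" for \<nu>
    proof (rule measurable_SUP_right_continuous[where B = 1])
      show "(\<lambda>\<omega>. \<bar>?B (\<nu>, \<omega>) x - cdf ?L x\<bar>) \<in> borel_measurable M" for x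
        using B_meas[of \<nu> x] by measurable
      fix \<omega> x
      interpret D: real_distribution "?D (\<nu>, \<omega>)" by (rule D)
      show "\<bar>?B (\<nu>, \<omega>) x - cdf ?L x\<bar> \<le> 1"
        unfolding B_cdf using D.cdf_nonneg[of x] D.cdf_bounded_prob[of x] L.cdf_nonneg[of x] L.cdf_bounded_prob[of x] by linarith
      show "continuous (at_right x) (\<lambda>x. \<bar>?B (\<nu>, \<omega>) x - cdf ?L x\<bar>)"
        unfolding B_cdf by (intro continuous_intros D.cdf_is_right_cont L.cdf_is_right_cont)
    qed
    show "((\<lambda>r. SUP x. \<bar>?B r x - cdf ?L x\<bar>) \<longlongrightarrow> 0) L1.LF"
    proof (cases "T = 0")
      \<comment> \<open>Statistic and limit are both exactly 0, so the distribution functions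
        coincide and the jump at 0 does no harm.\<close>
      case True
      then have "\<Gamma> = 0" by (simp add: \<Gamma>_def)
      then have "transpose R ** transpose (transpose R) = 0" using R(1) by simp
      then have "transpose R = 0" by (rule mult_transpose_eq_0)
      then have "diagm lam = 0" using R(2) by simp
      then have "diagm lam $ a $ a = 0" for a by simp
      then have "lam = (\<lambda>_. 0)" by (simp add: diagm_def fun_eq_iff)
      moreover have "Sboot \<nu> s s' = 0" for \<nu> s s' using True by (simp add: Sboot_def quad_stat_def)
      ultimately have "?B r x = cdf ?L x" for r x
        by (simp add: cdf_chi2_mixture_zero boot_prob_def)
      then show ?thesis by simp
    next
      case False
      \<comment> \<open>A nonzero weight makes the limit continuous, so that Polya's argument
        applies.\<close>
      have "\<exists>a. lam a \<noteq> 0"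
      proof (rule ccontr)
        assume "\<not> ?thesis"
        then have "R ** \<Sigma> ** transpose R = 0" unfolding R(2) by (simp add: diagm_def vec_eq_iff)
        from weight_zero[OF V E V_pos ATS_defined _ this] have "T ** \<Sigma> ** T = 0"
          using R(1) by (simp add: \<Gamma>_def)
        then show False using T False by simp
      qed
      then have cont: "isCont (cdf ?L) x" for x using continuous_cdf_chi2_mixture by blast
      show ?thesis
      proof (rule polya[OF L cont])
        fix r
        interpret D: real_distribution "?D r" by (rule D)
        show "mono (?B r)" unfolding B_cdf by (rule monoI) (rule D.cdf_nondecreasing)
        show "?B r x \<in> {0..1}" for x
          unfolding B_cdf using D.cdf_nonneg[of x] D.cdf_bounded_prob[of x] by simp
      qed (rule boot[OF cont])
    qed
  qed
  have null: "weak_conv_m (\<lambda>\<nu>. distr M borel (S \<nu>)) ?L" if Tq: "T *v q = 0"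
  proof -
    have S_meas: "S \<nu> \<in> borel_measurable M" for \<nu>
      unfolding S_def dat
      by (intro measurable_quad_stat E_meas measurable_compose[OF measurable_data Sighat_meas]
          measurable_compose[OF measurable_data eq])
    have S: "S \<nu> \<omega> = Y1 (\<nu>, \<omega>) \<bullet> (G1 (\<nu>, \<omega>) *v Y1 (\<nu>, \<omega>))" for \<nu> \<omega>
    proof -
      \<comment> \<open>Under the null hypothesis T annihilates \<open>q\<close>, so centring at
        \<open>q\<close> leaves the statistic unchanged.\<close>
      have "quad_stat E (N \<nu>) T A v = quad_stat E (N \<nu>) T A (v - q)" for A v
        by (simp add: quad_stat_def matrix_vector_mult_diff_distrib Tq)
      then have "S \<nu> \<omega> = quad_stat E (N \<nu>) T (Sighat \<nu> (dat (\<nu>, \<omega>))) (emp_quantiles p (N \<nu>) (dat (\<nu>, \<omega>)) - q)"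
        unfolding S_def dat by blast
      then show ?thesis by (simp add: quad_stat_eq[OF sym] Y1_def G1_def tot_def)
    qed
    show ?thesis
      unfolding weak_conv_m_def weak_conv_def
    proof (intro allI impI)
      fix x assume "isCont (cdf ?L) x"
      moreover have "(\<lambda>\<omega>. Y1 (\<nu>, \<omega>) \<bullet> (G1 (\<nu>, \<omega>) *v Y1 (\<nu>, \<omega>))) \<in> borel_measurable M" for \<nu>
        using S_meas[of \<nu>] unfolding S[abs_def] .
      ultimately have "(\<lambda>\<nu>. prob {\<omega> \<in> space M. S \<nu> \<omega> \<le> x}) \<longlonglongrightarrow> cdf ?L x"
        unfolding S by (intro data_limit[OF lim_hyps G1])
      moreover have "cdf (distr M borel (S \<nu>)) x = prob {\<omega> \<in> space M. S \<nu> \<omega> \<le> x}" for \<nu>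
        using S_meas[of \<nu>] by (simp add: cdf_def measure_distr vimage_def Int_def conj_commute)
      ultimately show "(\<lambda>\<nu>. cdf (distr M borel (S \<nu>)) x) \<longlonglongrightarrow> cdf ?L x" by simp
    qed
  qed
  show ?thesis
  proof (intro exI[of _ ?L] conjI allI impI)
    show "real_distribution ?L" by (rule L)
    show "conv_in_prob M (\<lambda>\<nu> \<omega>. boot_prob (N \<nu>) (data (N \<nu>) X \<omega>) (\<lambda>s'. Sboot \<nu> (data (N \<nu>) X \<omega>) s' \<le> x)) (cdf ?L x)"
      if "isCont (cdf ?L) x" for x
      using tendsto_imp_conv_in_prob[OF boot[OF that] B_meas] by (simp add: dat_def)
    show "conv_in_prob M (\<lambda>\<nu> \<omega>. SUP x. \<bar>boot_prob (N \<nu>) (data (N \<nu>) X \<omega>)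
        (\<lambda>s'. Sboot \<nu> (data (N \<nu>) X \<omega>) s' \<le> x) - cdf ?L x\<bar>) 0" if "T = 0 \<or> T ** \<Sigma> ** T \<noteq> 0"
      using sup[OF that] by (simp add: dat_def)
    show "\<exists>lamstar :: 'g \<times> 'c \<Rightarrow> real. (\<forall>a. 0 \<le> lamstar a) \<and> ?L = chi2_mixture lamstar"
      by (intro exI[of _ lam] conjI allI lam refl)
    assume Tq: "T *v q = 0"
    have "eigenvalue_family (E T \<Sigma> ** T ** \<Sigma> ** T) lam"
      using ev unfolding \<Gamma>_def by (rule eigenvalue_family_weight)
    then show "\<exists>lam. eigenvalue_family (E T \<Sigma> ** T ** \<Sigma> ** T) lam \<and> (\<forall>a. 0 \<le> lam a) \<and>
        weak_conv_m (\<lambda>\<nu>. distr M borel (S \<nu>)) (chi2_mixture lam) \<and> ?L = chi2_mixture lam"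
      by (intro exI[of _ lam] conjI allI refl null[OF Tq] lam)
  qed
qed

end
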